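(* Let $g$ satisfy (A1), let $p$ satisfy the exponent conditions (P), let $\mu>0$ satisfy $p_2+\mu<\frac{2n}{n-2}$, and let $(u_0,u_1)\in H_0^1(\Omega)\times L^2(\Omega)$. Then for all sufficiently small $\alpha>0$ (i.e. there is $\alpha_0>0$, depending on $n,\Omega,p,g,\mu,u_0,u_1$, such that for every $\alpha\in(0,\alpha_0)$) the following holds. If $u$ is the solution of problem (W) and the initial data satisfy $$E(0)<E_1,\qquad \lambda(0)<\lambda_1,$$ then there exists a constant $C>0$, independent of $t$, such that $$\int_0^\infty E(t)\,\mathrm dt\le C\,E(0),\qquad E(t)\le C\,E(0)(1+t)^{-1}\quad\text{for all } t\ge 0.$$
   Context: Setting. $\Omega\subset\mathbb R^n$, $n\ge3$, is a bounded domain with smooth boundary; $\|\cdot\|_k$ is the norm of $L^k(\Omega)$; $2_*:=\frac{2n}{n-2}$. Problem (W), with constant $\alpha>0$: $$u_{tt}-\Delta u+\int_0^t g(t-s)\Delta u(s)\,\mathrm ds+u_t=\alpha|u|^{p(x)-2}u\log|u|\ \text{ in }\Omega\times(0,\infty),$$ $$u(x,0)=u_0(x),\quad u_t(x,0)=u_1(x)\ \text{ in }\Omega,\qquad u=0\ \text{ on }\partial\Omega\times(0,\infty).$$ Solutions are understood in the usual weak sense: $u\in C([0,T);H_0^1(\Omega))\cap C^1([0,T);L^2(\Omega))$, attaining the initial data and satisfying the equation in the weak sense (tested against $H_0^1(\Omega)$ functions). Convention: $|u|^{p}\log|u|=0$ where $u=0$. Under the hypotheses on $E(0)$ and $\lambda(0)$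 below the solution is global ($T_{\max}=\infty$). (P) $p:\Omega\to\mathbb R$ is measurable and bounded, $p_1:=\operatorname{ess\,inf}_\Omega p>2$, $p_2:=\operatorname{ess\,sup}_\Omega p<\frac{2(n-1)}{n-2}$, and $p$ is log-Hölder continuous: there is $A>0$ with $|p(x)-p(y)|\le-\frac{A}{\log|x-y|}$ for a.e. $x,y\in\Omega$ with $|x-y|<1$. (A1) $g\in C^1([0,\infty);(0,\infty))$ is non-increasing, $g(0)>0$, and $\ell:=1-\int_0^\infty g(s)\,\mathrm ds>0$. Notation. $(g\circ\nabla u)(t):=\int_0^t g(t-s)\|\nabla u(t)-\nabla u(s)\|_2^2\,\mathrm ds$. Energy: $$E(t):=\tfrac12\|u_t(t)\|_2^2+\tfrac12\Big(1-\int_0^t g(s)\,\mathrm ds\Big)\|\nabla u(t)\|_2^2+\tfrac12(g\circ\nabla u)(t)-\alpha\int_\Omega\frac{|u(t)|^{p(x)}\log|u(t)|}{p(x)}\,\mathrm dx+\alpha\int_\Omega\frac{|u(t)|^{p(x)}}{p(x)^2}\,\mathrm dx.$$ $\lambda(t):=\{\ell\|\nabla u(t)\|_2^2+(g\circ\nabla u)(t)\}^{1/2}$, so $\lambda(0)=\ell^{1/2}\|\nabla u_0\|_2$. For $2\le k\le2_*$, $B_k$ is the optimal constant in $\|v\|_k^k\le B_k\|\nabla v\|_2^k$ for all $v\in H_0^1(\Omega)$. With $\mathrm e$ Euler's number, $$B:=B_{p_2+\mu}\,\ell^{-\frac{p_2+\mu}{2}},\qquad \lambda_1:=\Big(\frac{\mathrm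 e\mu p_1}{\alpha(p_2+\mu)B}\Big)^{\frac1{p_2+\mu-2}},\qquad E_1:=\Big(\frac12-\frac1{p_2+\mu}\Big)\lambda_1^2 .$$ *)

theory Defs
  imports "HOL-Analysis.Analysis" "HOL-Probability.Essential_Supremum"
begin

section \<open>Smooth functions and domains with smooth boundary\<close>

definition partial_deriv :: "'n::finite \<Rightarrow> (real^'n \<Rightarrow> real) \<Rightarrow> real^'n \<Rightarrow> real" where
  "partial_deriv i f x = frechet_derivative f (at x) (axis i 1)"

primrec Ck :: "nat \<Rightarrow> (real^'n::finite \<Rightarrow> real) \<Rightarrow> bool" where
  "Ck 0 f \<longleftrightarrow> continuous_on UNIV f"
| "Ck (Suc k) f \<longleftrightarrow> (\<forall>x. f differentiable (at x)) \<and> (\<forall>i. Ck k (partial_deriv i f))"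

definition smooth :: "(real^'n::finite \<Rightarrow> real) \<Rightarrow> bool" where
  "smooth f \<longleftrightarrow> (\<forall>k. Ck k f)"

text \<open>After relabelling and reorienting the coordinate axes, \<open>\<Omega>\<close> is locally the region
  on one side of a smooth graph.  The graph function \<open>\<gamma>\<close> of \<open>n - 1\<close> variables is encoded as a
  function on the whole space that does not depend on the coordinate \<open>i\<close>.\<close>

definition smooth_boundary :: "(real^'n::finite) set \<Rightarrow> bool" where
  "smooth_boundary \<Omega> \<longleftrightarrow>
     (\<forall>x0\<in>frontier \<Omega>. \<exists>r>0. \<exists>i. \<exists>\<sigma>\<in>{-1, 1}. \<exists>\<gamma>.
        smooth \<gamma> \<and> (\<forall>x y. (\<forall>j. j \<noteq> i \<longrightarrow> x $ j = y $ j) \<longrightarrow> \<gamma> x = \<gamma> y) \<and>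
        \<Omega> \<inter> ball x0 r = {x \<in> ball x0 r. \<sigma> * x $ i > \<gamma> x})"

definition bounded_smooth_domain :: "(real^'n::finite) set \<Rightarrow> bool" where
  "bounded_smooth_domain \<Omega> \<longleftrightarrow>
     open \<Omega> \<and> connected \<Omega> \<and> \<Omega> \<noteq> {} \<and> bounded \<Omega> \<and> smooth_boundary \<Omega>"


section \<open>Lebesgue and Sobolev spaces\<close>

text \<open>Elements of the function spaces are represented by functions on the whole space, of which
  only the values on \<open>\<Omega>\<close>, up to null sets, matter.\<close>

definition Lnorm :: "(real^'n::finite) set \<Rightarrow> real \<Rightarrow> (real^'n \<Rightarrow> 'b::euclidean_space) \<Rightarrow> real" where
  "Lnorm \<Omega> k f = (LINT x|lebesgue_on \<Omega>. norm (f x) powr k) powr (1 / k)"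

definition L2 :: "(real^'n::finite) set \<Rightarrow> (real^'n \<Rightarrow> 'b::euclidean_space) set" where
  "L2 \<Omega> = {f. f \<in> borel_measurable (lebesgue_on \<Omega>) \<and>
              integrable (lebesgue_on \<Omega>) (\<lambda>x. (norm (f x))\<^sup>2)}"

definition L2_inner ::
  "(real^'n::finite) set \<Rightarrow> (real^'n \<Rightarrow> 'b::euclidean_space) \<Rightarrow> (real^'n \<Rightarrow> 'b) \<Rightarrow> real" where
  "L2_inner \<Omega> f h = (LINT x|lebesgue_on \<Omega>. f x \<bullet> h x)"

definition test_fun :: "(real^'n::finite) set \<Rightarrow> (real^'n \<Rightarrow> real) set" where
  "test_fun \<Omega> = {\<phi>. smooth \<phi> \<and> compact (closure {x. \<phi> x \<noteq> 0}) \<and> closure {x. \<phi> x \<noteq> 0} \<subseteq> \<Omega>}"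

definition is_weak_grad ::
  "(real^'n::finite) set \<Rightarrow> (real^'n \<Rightarrow> real) \<Rightarrow> (real^'n \<Rightarrow> real^'n) \<Rightarrow> bool" where
  "is_weak_grad \<Omega> v G \<longleftrightarrow>
     (\<forall>\<phi>\<in>test_fun \<Omega>. \<forall>i. (LINT x|lebesgue_on \<Omega>. v x * partial_deriv i \<phi> x)
                         = - (LINT x|lebesgue_on \<Omega>. G x $ i * \<phi> x))"

definition H1 :: "(real^'n::finite) set \<Rightarrow> (real^'n \<Rightarrow> real) set" where
  "H1 \<Omega> = {v \<in> L2 \<Omega>. \<exists>G\<in>L2 \<Omega>. is_weak_grad \<Omega> v G}"

text \<open>The weak gradient of an element of \<open>H1 \<Omega>\<close>; it is unique up to null subsets of \<open>\<Omega>\<close>.\<close>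

definition wgrad :: "(real^'n::finite) set \<Rightarrow> (real^'n \<Rightarrow> real) \<Rightarrow> real^'n \<Rightarrow> real^'n" where
  "wgrad \<Omega> v = (SOME G. G \<in> L2 \<Omega> \<and> is_weak_grad \<Omega> v G)"

definition H1_norm :: "(real^'n::finite) set \<Rightarrow> (real^'n \<Rightarrow> real) \<Rightarrow> real" where
  "H1_norm \<Omega> v = sqrt ((Lnorm \<Omega> 2 v)\<^sup>2 + (Lnorm \<Omega> 2 (wgrad \<Omega> v))\<^sup>2)"

definition H10 :: "(real^'n::finite) set \<Rightarrow> (real^'n \<Rightarrow> real) set" where
  "H10 \<Omega> = {v \<in> H1 \<Omega>. \<exists>\<phi>. (\<forall>k::nat. \<phi> k \<in> test_fun \<Omega>) \<and>
                         (\<lambda>k. H1_norm \<Omega> (\<lambda>x. \<phi> k x - v x)) \<longlonglongrightarrow> 0}"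

definition sobolev_const :: "(real^'n::finite) set \<Rightarrow> real \<Rightarrow> real" where
  "sobolev_const \<Omega> k =
     Inf {c. 0 \<le> c \<and> (\<forall>v\<in>H10 \<Omega>. Lnorm \<Omega> k v powr k \<le> c * Lnorm \<Omega> 2 (wgrad \<Omega> v) powr k)}"


section \<open>Hypotheses on the exponent and the relaxation function\<close>

definition exp_sup :: "(real^'n::finite) set \<Rightarrow> (real^'n \<Rightarrow> real) \<Rightarrow> real" where
  "exp_sup \<Omega> p = real_of_ereal (esssup (lebesgue_on \<Omega>) (\<lambda>x. ereal (p x)))"

definition exp_inf :: "(real^'n::finite) set \<Rightarrow> (real^'n \<Rightarrow> real) \<Rightarrow> real" where
  "exp_inf \<Omega> p = - exp_sup \<Omega> (\<lambda>x. - p x)"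

definition log_holder :: "(real^'n::finite) set \<Rightarrow> (real^'n \<Rightarrow> real) \<Rightarrow> bool" where
  "log_holder \<Omega> p \<longleftrightarrow>
     (\<exists>A>0. AE x in lebesgue_on \<Omega>. AE y in lebesgue_on \<Omega>.
        dist x y < 1 \<longrightarrow> \<bar>p x - p y\<bar> \<le> - (A / ln (dist x y)))"

definition cond_P :: "(real^'n::finite) set \<Rightarrow> (real^'n \<Rightarrow> real) \<Rightarrow> bool" where
  "cond_P \<Omega> p \<longleftrightarrow>
     p \<in> borel_measurable (lebesgue_on \<Omega>) \<and> bounded (p ` \<Omega>) \<and>
     2 < exp_inf \<Omega> p \<and>
     exp_sup \<Omega> p < 2 * (real CARD('n) - 1) / (real CARD('n) - 2) \<and>
     log_holder \<Omega> p"

definition ell :: "(real \<Rightarrow> real) \<Rightarrow> real" where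
  "ell g = 1 - integral {0..} g"

definition cond_A1 :: "(real \<Rightarrow> real) \<Rightarrow> bool" where
  "cond_A1 g \<longleftrightarrow>
     (\<exists>g'. continuous_on {0..} g' \<and>
           (\<forall>t\<ge>0. (g has_real_derivative g' t) (at t within {0..}))) \<and>
     (\<forall>t\<ge>0. 0 < g t) \<and> antimono_on {0..} g \<and>
     g integrable_on {0..} \<and> 0 < ell g"


section \<open>Weak solutions on the time interval \<open>[0, \<infinity>)\<close>\<close>

text \<open>The value \<open>u t\<close> is the function \<open>x \<mapsto> u(x,t)\<close>, and \<open>ut t\<close> is the derivative of \<open>u\<close> at time
  \<open>t\<close> as a curve in \<open>L\<^sup>2(\<Omega>)\<close>.\<close>

definition C0_H10 :: "(real^'n::finite) set \<Rightarrow> (real \<Rightarrow> real^'n \<Rightarrow> real) \<Rightarrow> bool" where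
  "C0_H10 \<Omega> u \<longleftrightarrow>
     (\<forall>t\<ge>0. u t \<in> H10 \<Omega> \<and>
        ((\<lambda>s. H1_norm \<Omega> (\<lambda>x. u s x - u t x)) \<longlongrightarrow> 0) (at t within {0..}))"

definition C1_L2 ::
  "(real^'n::finite) set \<Rightarrow> (real \<Rightarrow> real^'n \<Rightarrow> real) \<Rightarrow> (real \<Rightarrow> real^'n \<Rightarrow> real) \<Rightarrow> bool" where
  "C1_L2 \<Omega> u ut \<longleftrightarrow>
     (\<forall>t\<ge>0. u t \<in> L2 \<Omega> \<and> ut t \<in> L2 \<Omega> \<and>
        ((\<lambda>s. Lnorm \<Omega> 2 (\<lambda>x. (u s x - u t x) / (s - t) - ut t x)) \<longlongrightarrow> 0) (at t within {0..}) \<and>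
        ((\<lambda>s. Lnorm \<Omega> 2 (\<lambda>x. ut s x - ut t x)) \<longlongrightarrow> 0) (at t within {0..}))"

text \<open>Since \<open>ln 0 = 0\<close>, the source term vanishes where the function does.\<close>

definition log_source :: "(real^'n::finite \<Rightarrow> real) \<Rightarrow> (real^'n \<Rightarrow> real) \<Rightarrow> real^'n \<Rightarrow> real" where
  "log_source p v x = \<bar>v x\<bar> powr (p x - 2) * v x * ln \<bar>v x\<bar>"

text \<open>Tested against \<open>w\<close>, the equation reads
  \<open>d/dt (u\<^sub>t, w) = - (\<nabla>u, \<nabla>w) + \<integral>\<^sub>0\<^sup>t g(t-s) (\<nabla>u(s), \<nabla>w) ds - (u\<^sub>t, w) + \<alpha> (|u|\<^sup>p\<^sup>-\<^sup>2 u log |u|, w)\<close>.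
  It is imposed in integrated form, which requires no differentiability of \<open>(u\<^sub>t, w)\<close> in time and
  incorporates the initial velocity \<open>u1\<close>.\<close>

definition weak_solution ::
  "(real^'n::finite) set \<Rightarrow> real \<Rightarrow> (real^'n \<Rightarrow> real) \<Rightarrow> (real \<Rightarrow> real) \<Rightarrow>
   (real^'n \<Rightarrow> real) \<Rightarrow> (real^'n \<Rightarrow> real) \<Rightarrow>
   (real \<Rightarrow> real^'n \<Rightarrow> real) \<Rightarrow> (real \<Rightarrow> real^'n \<Rightarrow> real) \<Rightarrow> bool" where
  "weak_solution \<Omega> \<alpha> p g u0 u1 u ut \<longleftrightarrow>
     C0_H10 \<Omega> u \<and> C1_L2 \<Omega> u ut \<and>
     (AE x in lebesgue_on \<Omega>. u 0 x = u0 x) \<and>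
     (AE x in lebesgue_on \<Omega>. ut 0 x = u1 x) \<and>
     (\<forall>w\<in>H10 \<Omega>. \<forall>t\<ge>0.
        ((\<lambda>\<tau>. - L2_inner \<Omega> (wgrad \<Omega> (u \<tau>)) (wgrad \<Omega> w)
              + integral {0..\<tau>} (\<lambda>s. g (\<tau> - s) * L2_inner \<Omega> (wgrad \<Omega> (u s)) (wgrad \<Omega> w))
              - L2_inner \<Omega> (ut \<tau>) w
              + \<alpha> * L2_inner \<Omega> (log_source p (u \<tau>)) w)
          has_integral (L2_inner \<Omega> (ut t) w - L2_inner \<Omega> u1 w)) {0..t})"


section \<open>Energy and the potential well constants\<close>

definition memory ::
  "(real^'n::finite) set \<Rightarrow> (real \<Rightarrow> real) \<Rightarrow> (real \<Rightarrow> real^'n \<Rightarrow> real) \<Rightarrow> real \<Rightarrow> real" where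
  "memory \<Omega> g u t =
     integral {0..t} (\<lambda>s. g (t - s) * (Lnorm \<Omega> 2 (\<lambda>x. wgrad \<Omega> (u t) x - wgrad \<Omega> (u s) x))\<^sup>2)"

definition energy ::
  "(real^'n::finite) set \<Rightarrow> real \<Rightarrow> (real^'n \<Rightarrow> real) \<Rightarrow> (real \<Rightarrow> real) \<Rightarrow>
   (real \<Rightarrow> real^'n \<Rightarrow> real) \<Rightarrow> (real \<Rightarrow> real^'n \<Rightarrow> real) \<Rightarrow> real \<Rightarrow> real" where
  "energy \<Omega> \<alpha> p g u ut t =
     1/2 * (Lnorm \<Omega> 2 (ut t))\<^sup>2
     + 1/2 * (1 - integral {0..t} g) * (Lnorm \<Omega> 2 (wgrad \<Omega> (u t)))\<^sup>2
     + 1/2 * memory \<Omega> g u t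
     - \<alpha> * (LINT x|lebesgue_on \<Omega>. \<bar>u t x\<bar> powr p x * ln \<bar>u t x\<bar> / p x)
     + \<alpha> * (LINT x|lebesgue_on \<Omega>. \<bar>u t x\<bar> powr p x / (p x)\<^sup>2)"

definition lam ::
  "(real^'n::finite) set \<Rightarrow> (real \<Rightarrow> real) \<Rightarrow> (real \<Rightarrow> real^'n \<Rightarrow> real) \<Rightarrow> real \<Rightarrow> real" where
  "lam \<Omega> g u t = sqrt (ell g * (Lnorm \<Omega> 2 (wgrad \<Omega> (u t)))\<^sup>2 + memory \<Omega> g u t)"

definition Bconst ::
  "(real^'n::finite) set \<Rightarrow> (real^'n \<Rightarrow> real) \<Rightarrow> (real \<Rightarrow> real) \<Rightarrow> real \<Rightarrow> real" where
  "Bconst \<Omega> p g \<mu> =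
     sobolev_const \<Omega> (exp_sup \<Omega> p + \<mu>) * ell g powr (- (exp_sup \<Omega> p + \<mu>) / 2)"

definition lam1 ::
  "(real^'n::finite) set \<Rightarrow> real \<Rightarrow> (real^'n \<Rightarrow> real) \<Rightarrow> (real \<Rightarrow> real) \<Rightarrow> real \<Rightarrow> real" where
  "lam1 \<Omega> \<alpha> p g \<mu> =
     (exp 1 * \<mu> * exp_inf \<Omega> p / (\<alpha> * (exp_sup \<Omega> p + \<mu>) * Bconst \<Omega> p g \<mu>))
       powr (1 / (exp_sup \<Omega> p + \<mu> - 2))"

definition E1 ::
  "(real^'n::finite) set \<Rightarrow> real \<Rightarrow> (real^'n \<Rightarrow> real) \<Rightarrow> (real \<Rightarrow> real) \<Rightarrow> real \<Rightarrow> real" where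
  "E1 \<Omega> \<alpha> p g \<mu> = (1/2 - 1 / (exp_sup \<Omega> p + \<mu>)) * (lam1 \<Omega> \<alpha> p g \<mu>)\<^sup>2"

end

theory Submission
  imports Defs
begin

text \<open>The estimates hold for every \<open>\<alpha> > 0\<close>, so \<open>\<alpha>\<^sub>0 = 1\<close> does.

  Since \<open>p\<^sub>2 < 2(n-1)/(n-2)\<close>, the subcritical Sobolev inequality makes the source locally Lipschitz from
  \<open>H\<^sub>0\<^sup>1\<close> to \<open>L\<^sup>2\<close>, and a weak solution satisfies the energy identity, whose dissipation is at least
  \<open>\<parallel>u\<^sub>t\<parallel>\<^sup>2\<close> because \<open>g\<close> is positive and non-increasing.  The bound \<open>log s \<le> s\<^sup>\<mu>/(e\<mu>)\<close> gives
  \<open>E \<ge> \<lambda>\<^sup>2/2 - \<lambda>\<^sup>\<kappa>/(\<kappa> \<lambda>\<^sub>1\<^sup>\<kappa>\<^sup>-\<^sup>2)\<close> with \<open>\<kappa> = p\<^sub>2 + \<mu>\<close>, a function whose value at its maximum point \<open>\<lambda>\<^sub>1\<close> is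
  \<open>E\<^sub>1\<close>; as \<open>E\<close> decreases, \<open>\<lambda>\<close> never reaches \<open>\<lambda>\<^sub>1\<close>, and \<open>E\<close> dominates \<open>\<parallel>u\<^sub>t\<parallel>\<^sup>2 + \<parallel>\<nabla>u\<parallel>\<^sup>2\<close>.  Testing the equation
  with \<open>u\<close> then bounds \<open>\<integral> \<parallel>\<nabla>u\<parallel>\<^sup>2 dt\<close>, hence \<open>\<integral> E dt\<close>, by a multiple of \<open>E(0)\<close>, and monotonicity of \<open>E\<close> yields
  \<open>t E(t) \<le> \<integral> E dt\<close>.\<close>


section \<open>Square-integrable functions\<close>

text \<open>The obstacle is regularity. The velocity \<open>ut t\<close> lies only in
  \<open>L2\<close>, so it is not an admissible test function. All quantities are therefore pairings
  of the state at one time with the state at another: \<open>u t\<close> at a frozen time is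
  admissible, so such a pairing can be differentiated in each time separately, and the diagonal is
  reached only at the end.

  The source has to be differentiated along a curve that is continuous in H^1_0 but differentiable
  only in L2. This dictates a growth exponent m: it lies above p2 - 2, so that |u|^m absorbs the
  logarithm, while 2m + 2 stays below the critical exponent, which puts |u|^m times an H^1_0
  function into L2.

  The threshold \<open>lam1\<close> is the number for which the source potential is at most
  \<lambda>^\<kappa> / (\<kappa> lam1^(\<kappa>-2)). The potential carries a factor 1/p1 that the
  tested source does not, so testing with u leaves the factor p1/\<kappa> in front of \<ell> |grad
  u|^2; that this is less than 1 is what bounds the time integral.\<close>

lemma L2_measurable: "f \<in> L2 \<Omega> \<Longrightarrow> f \<in> borel_measurable (lebesgue_on \<Omega>)"
  by (simp add: L2_def)

lemma L2_integrable: "f \<in> L2 \<Omega> \<Longrightarrow> integrable (lebesgue_on \<Omega>) (\<lambda>x. (norm (f x))\<^sup>2)"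
  by (simp add: L2_def)

lemma L2_inner_integrable:
  fixes f h :: "real^'n::finite \<Rightarrow> 'b::euclidean_space"
  assumes "f \<in> L2 \<Omega>" "h \<in> L2 \<Omega>"
  shows "integrable (lebesgue_on \<Omega>) (\<lambda>x. f x \<bullet> h x)"
proof (rule Bochner_Integration.integrable_bound)
  show "integrable (lebesgue_on \<Omega>) (\<lambda>x. (norm (f x))\<^sup>2 + (norm (h x))\<^sup>2)"
    using assms by (intro Bochner_Integration.integrable_add L2_integrable)
  show "(\<lambda>x. f x \<bullet> h x) \<in> borel_measurable (lebesgue_on \<Omega>)"
    using assms by (intro borel_measurable_inner L2_measurable)
  have "\<bar>a \<bullet> b\<bar> \<le> (norm a)\<^sup>2 + (norm b)\<^sup>2" for a b :: 'b
  proof -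
    have "\<bar>a \<bullet> b\<bar> \<le> norm a * norm b" by (rule Cauchy_Schwarz_ineq2)
    also have "\<dots> \<le> (norm a)\<^sup>2 + (norm b)\<^sup>2"
      using sum_squares_bound[of "norm a" "norm b"] zero_le_power2[of "norm a"]
        zero_le_power2[of "norm b"] mult_nonneg_nonneg[of "norm a" "norm b"] norm_ge_zero[of a] norm_ge_zero[of b]
      by linarith
    finally show ?thesis .
  qed
  then show "AE x in lebesgue_on \<Omega>. norm (f x \<bullet> h x) \<le> norm ((norm (f x))\<^sup>2 + (norm (h x))\<^sup>2)"
    by (intro AE_I2) simp
qed

lemma L2_scale: "f \<in> L2 \<Omega> \<Longrightarrow> (\<lambda>x. c *\<^sub>R f x) \<in> L2 \<Omega>"
  by (auto simp: L2_def power_mult_distrib intro!: borel_measurable_scaleR)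

lemma L2_add:
  assumes "f \<in> L2 \<Omega>" "h \<in> L2 \<Omega>"
  shows "(\<lambda>x. f x + h x) \<in> L2 \<Omega>"
proof -
  have "(norm (f x + h x))\<^sup>2 = (norm (f x))\<^sup>2 + 2 * (f x \<bullet> h x) + (norm (h x))\<^sup>2" for x
    by (simp add: power2_norm_eq_inner inner_add inner_commute)
  moreover have "integrable (lebesgue_on \<Omega>)
      (\<lambda>x. (norm (f x))\<^sup>2 + 2 * (f x \<bullet> h x) + (norm (h x))\<^sup>2)"
    using assms by (intro Bochner_Integration.integrable_add integrable_mult_right
        L2_inner_integrable L2_integrable)
  ultimately show ?thesis
    using assms by (auto simp: L2_def intro!: borel_measurable_add)
qed

lemma L2_diff: "f \<in> L2 \<Omega> \<Longrightarrow> h \<in> L2 \<Omega> \<Longrightarrow> (\<lambda>x. f x - h x) \<in> L2 \<Omega>"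
  using L2_add[of f \<Omega> "\<lambda>x. (-1) *\<^sub>R h x"] L2_scale[of h \<Omega> "-1"] by simp

lemma L2_inner_commute: "L2_inner \<Omega> f h = L2_inner \<Omega> h f"
  by (simp add: L2_inner_def inner_commute)

lemma L2_inner_diff_left:
  "f \<in> L2 \<Omega> \<Longrightarrow> f' \<in> L2 \<Omega> \<Longrightarrow> h \<in> L2 \<Omega> \<Longrightarrow>
    L2_inner \<Omega> (\<lambda>x. f x - f' x) h = L2_inner \<Omega> f h - L2_inner \<Omega> f' h"
  unfolding L2_inner_def
  by (simp add: inner_diff_left Bochner_Integration.integral_diff L2_inner_integrable)

lemma L2_inner_add_left:
  "f \<in> L2 \<Omega> \<Longrightarrow> f' \<in> L2 \<Omega> \<Longrightarrow> h \<in> L2 \<Omega> \<Longrightarrow>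
    L2_inner \<Omega> (\<lambda>x. f x + f' x) h = L2_inner \<Omega> f h + L2_inner \<Omega> f' h"
  unfolding L2_inner_def
  by (simp add: inner_add_left Bochner_Integration.integral_add L2_inner_integrable)

lemma L2_inner_scale_left: "L2_inner \<Omega> (\<lambda>x. c *\<^sub>R f x) h = c * L2_inner \<Omega> f h"
  by (simp add: L2_inner_def)

lemma L2_inner_diff_right:
  "f \<in> L2 \<Omega> \<Longrightarrow> f' \<in> L2 \<Omega> \<Longrightarrow> h \<in> L2 \<Omega> \<Longrightarrow>
    L2_inner \<Omega> h (\<lambda>x. f x - f' x) = L2_inner \<Omega> h f - L2_inner \<Omega> h f'"
  by (simp add: L2_inner_commute[of \<Omega> h] L2_inner_diff_left)

lemma L2_inner_self: "L2_inner \<Omega> f f = (LINT x|lebesgue_on \<Omega>. (norm (f x))\<^sup>2)"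
  by (simp add: L2_inner_def power2_norm_eq_inner)

lemma L2_inner_self_nonneg: "0 \<le> L2_inner \<Omega> f f"
  by (simp add: L2_inner_self)

lemma Lnorm_2: "Lnorm \<Omega> 2 f = sqrt (L2_inner \<Omega> f f)"
  unfolding Lnorm_def L2_inner_self
  by (simp add: powr_half_sqrt powr_numeral)

lemma Lnorm_2_sq: "(Lnorm \<Omega> 2 f)\<^sup>2 = L2_inner \<Omega> f f"
  by (simp add: Lnorm_2 L2_inner_self_nonneg)

lemma Lnorm_nonneg: "0 \<le> Lnorm \<Omega> k f"
  by (simp add: Lnorm_def)

lemma L2_inner_cong_AE:
  assumes "AE x in lebesgue_on \<Omega>. f x = f' x" "AE x in lebesgue_on \<Omega>. h x = h' x"
    "f \<in> L2 \<Omega>" "f' \<in> L2 \<Omega>" "h \<in> L2 \<Omega>" "h' \<in> L2 \<Omega>"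
  shows "L2_inner \<Omega> f h = L2_inner \<Omega> f' h'"
  unfolding L2_inner_def
  using assms
  by (intro integral_cong_AE) (auto intro!: borel_measurable_integrable L2_inner_integrable)

lemma Lnorm_2_cong_AE:
  assumes "AE x in lebesgue_on \<Omega>. f x = f' x" "f \<in> L2 \<Omega>" "f' \<in> L2 \<Omega>"
  shows "Lnorm \<Omega> 2 f = Lnorm \<Omega> 2 f'"
  unfolding Lnorm_2 using assms L2_inner_cong_AE by metis

text \<open>On functions, as opposed to classes modulo null sets, \<open>L2_inner\<close> is only
  positive semidefinite. The argument is therefore the discriminant of t |-> |f - t h|^2, with
  \<open>?b = 0\<close> treated separately instead of being reduced to h = 0.\<close>

lemma L2_inner_Cauchy_Schwarz:
  assumes f: "f \<in> L2 \<Omega>" and h: "h \<in> L2 \<Omega>"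
  shows "\<bar>L2_inner \<Omega> f h\<bar> \<le> Lnorm \<Omega> 2 f * Lnorm \<Omega> 2 h"
proof -
  let ?a = "L2_inner \<Omega> f f" and ?b = "L2_inner \<Omega> h h" and ?c = "L2_inner \<Omega> f h"
  have q: "0 \<le> ?a - 2 * t * ?c + t\<^sup>2 * ?b" for t
  proof -
    let ?k = "\<lambda>x. f x - t *\<^sub>R h x"
    have th: "(\<lambda>x. t *\<^sub>R h x) \<in> L2 \<Omega>" using h by (rule L2_scale)
    have k: "?k \<in> L2 \<Omega>" using f th by (rule L2_diff)
    have e: "L2_inner \<Omega> g (\<lambda>x. t *\<^sub>R h x) = t * L2_inner \<Omega> g h" for g
      by (simp add: L2_inner_commute[of \<Omega> g] L2_inner_scale_left)
    have "L2_inner \<Omega> ?k ?k = ?a - 2 * t * ?c + t\<^sup>2 * ?b"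
      using f h th k
      by (simp add: L2_inner_diff_left L2_inner_diff_right e L2_inner_scale_left
          L2_inner_commute[of \<Omega> h f] power2_eq_square algebra_simps)
    then show ?thesis using L2_inner_self_nonneg[of \<Omega> ?k] by simp
  qed
  have "?c\<^sup>2 \<le> ?a * ?b"
  proof (cases "?b = 0")
    case True
    have "?c = 0"
    proof (rule ccontr)
      assume "?c \<noteq> 0"
      \<comment> \<open>With \<open>?b = 0\<close> the quadratic is affine in t, and this t gives it
        the value -1.\<close>
      then show False using q[of "(?a + 1) / (2 * ?c)"] True by (simp add: field_simps)
    qed
    then show ?thesis using True by simp
  next
    case False
    then have "0 < ?b" using L2_inner_self_nonneg[of \<Omega> h] by simp
    then show ?thesis using q[of "?c / ?b"] by (simp add: power2_eq_square field_simps)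
  qed
  then have "sqrt (?c\<^sup>2) \<le> sqrt (?a * ?b)" by (rule real_sqrt_le_mono)
  then show ?thesis by (simp add: Lnorm_2 real_sqrt_mult)
qed

lemma Lnorm_2_triangle:
  assumes f: "f \<in> L2 \<Omega>" and h: "h \<in> L2 \<Omega>"
  shows "Lnorm \<Omega> 2 (\<lambda>x. f x + h x) \<le> Lnorm \<Omega> 2 f + Lnorm \<Omega> 2 h"
proof (rule power2_le_imp_le)
  have fh: "(\<lambda>x. f x + h x) \<in> L2 \<Omega>" using f h by (rule L2_add)
  have r: "L2_inner \<Omega> g (\<lambda>x. f x + h x) = L2_inner \<Omega> g f + L2_inner \<Omega> g h" if "g \<in> L2 \<Omega>" for g
    using f h that by (simp add: L2_inner_commute[of \<Omega> g] L2_inner_add_left)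
  have "(Lnorm \<Omega> 2 (\<lambda>x. f x + h x))\<^sup>2 = L2_inner \<Omega> f f + 2 * L2_inner \<Omega> f h + L2_inner \<Omega> h h"
    using f h fh by (simp add: Lnorm_2_sq L2_inner_add_left r L2_inner_commute[of \<Omega> h f])
  also have "\<dots> \<le> (Lnorm \<Omega> 2 f + Lnorm \<Omega> 2 h)\<^sup>2"
    using L2_inner_Cauchy_Schwarz[OF f h] by (simp add: power2_sum Lnorm_2_sq)
  finally show "(Lnorm \<Omega> 2 (\<lambda>x. f x + h x))\<^sup>2 \<le> (Lnorm \<Omega> 2 f + Lnorm \<Omega> 2 h)\<^sup>2" .
qed (simp add: Lnorm_nonneg)

lemma Lnorm_2_scale: "Lnorm \<Omega> 2 (\<lambda>x. c *\<^sub>R f x) = \<bar>c\<bar> * Lnorm \<Omega> 2 f"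
  by (simp add: Lnorm_2 L2_inner_self power_mult_distrib real_sqrt_mult)

lemma Lnorm_2_commute: "Lnorm \<Omega> 2 (\<lambda>x. f x - h x) = Lnorm \<Omega> 2 (\<lambda>x. h x - f x)"
  by (simp add: Lnorm_2 L2_inner_self norm_minus_commute)

lemma Lnorm_2_diff_bound:
  assumes f: "f \<in> L2 \<Omega>" and h: "h \<in> L2 \<Omega>"
  shows "\<bar>Lnorm \<Omega> 2 f - Lnorm \<Omega> 2 h\<bar> \<le> Lnorm \<Omega> 2 (\<lambda>x. f x - h x)"
  using Lnorm_2_triangle[OF L2_diff[OF f h] h] Lnorm_2_triangle[OF L2_diff[OF h f] f]
  by (simp add: Lnorm_2_commute[of \<Omega> f h])

text \<open>Stated for an arbitrary filter because it is applied to a pair of times converging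
  jointly; \<open>S\<close> is the set of parameters for which the families are known to lie in
  \<open>L2\<close>.\<close>

lemma L2_inner_tendsto:
  assumes f: "\<And>s. s \<in> S \<Longrightarrow> f s \<in> L2 \<Omega>" and h: "\<And>s. s \<in> S \<Longrightarrow> h s \<in> L2 \<Omega>"
    and f0: "f0 \<in> L2 \<Omega>" and h0: "h0 \<in> L2 \<Omega>" and ev: "eventually (\<lambda>s. s \<in> S) F"
    and lf: "((\<lambda>s. Lnorm \<Omega> 2 (\<lambda>x. f s x - f0 x)) \<longlongrightarrow> 0) F"
    and lh: "((\<lambda>s. Lnorm \<Omega> 2 (\<lambda>x. h s x - h0 x)) \<longlongrightarrow> 0) F"
  shows "((\<lambda>s. L2_inner \<Omega> (f s) (h s)) \<longlongrightarrow> L2_inner \<Omega> f0 h0) F"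
proof -
  let ?a = "\<lambda>s. Lnorm \<Omega> 2 (\<lambda>x. f s x - f0 x)" and ?b = "\<lambda>s. Lnorm \<Omega> 2 (\<lambda>x. h s x - h0 x)"
  have "((\<lambda>s. L2_inner \<Omega> (f s) (h s) - L2_inner \<Omega> f0 h0) \<longlongrightarrow> 0) F"
  proof (rule Lim_null_comparison)
    show "((\<lambda>s. ?a s * (?b s + Lnorm \<Omega> 2 h0) + Lnorm \<Omega> 2 f0 * ?b s) \<longlongrightarrow> 0) F"
    proof -
      have "((\<lambda>s. ?a s * (?b s + Lnorm \<Omega> 2 h0) + Lnorm \<Omega> 2 f0 * ?b s) \<longlongrightarrow>
          0 * (0 + Lnorm \<Omega> 2 h0) + Lnorm \<Omega> 2 f0 * 0) F"
        by (intro tendsto_intros lf lh)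
      then show ?thesis by simp
    qed
    show "eventually (\<lambda>s. norm (L2_inner \<Omega> (f s) (h s) - L2_inner \<Omega> f0 h0)
        \<le> ?a s * (?b s + Lnorm \<Omega> 2 h0) + Lnorm \<Omega> 2 f0 * ?b s) F"
      using ev
    proof eventually_elim
      fix s assume s: "s \<in> S"
      have fs: "f s \<in> L2 \<Omega>" "h s \<in> L2 \<Omega>" using s f h by auto
      note d = L2_diff[OF fs(1) f0] L2_diff[OF fs(2) h0]
      have "L2_inner \<Omega> (f s) (h s) - L2_inner \<Omega> f0 h0
          = L2_inner \<Omega> (\<lambda>x. f s x - f0 x) (h s) + L2_inner \<Omega> f0 (\<lambda>x. h s x - h0 x)"
        using fs f0 h0 by (simp add: L2_inner_diff_left L2_inner_diff_right)
      moreover have "\<bar>L2_inner \<Omega> (\<lambda>x. f s x - f0 x) (h s)\<bar> \<le> ?a s * Lnorm \<Omega> 2 (h s)"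
        using d fs by (intro L2_inner_Cauchy_Schwarz)
      moreover have "\<dots> \<le> ?a s * (?b s + Lnorm \<Omega> 2 h0)"
        using Lnorm_2_diff_bound[OF fs(2) h0] by (intro mult_left_mono Lnorm_nonneg) simp
      moreover have "\<bar>L2_inner \<Omega> f0 (\<lambda>x. h s x - h0 x)\<bar> \<le> Lnorm \<Omega> 2 f0 * ?b s"
        using d f0 by (intro L2_inner_Cauchy_Schwarz)
      ultimately show "norm (L2_inner \<Omega> (f s) (h s) - L2_inner \<Omega> f0 h0)
        \<le> ?a s * (?b s + Lnorm \<Omega> 2 h0) + Lnorm \<Omega> 2 f0 * ?b s"
        by simp
    qed
  qed
  then show ?thesis by (simp add: LIM_zero_iff)
qed

section \<open>Smooth functions and bump functions\<close>

lemma partial_deriv_eqI: "(f has_derivative D) (at x) \<Longrightarrow> partial_deriv i f x = D (axis i 1)"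
  unfolding partial_deriv_def by (simp add: frechet_derivative_at[symmetric])

lemma partial_deriv_add:
  assumes "\<And>x. f differentiable (at x)" "\<And>x. h differentiable (at x)"
  shows "partial_deriv i (\<lambda>x. f x + h x) = (\<lambda>x. partial_deriv i f x + partial_deriv i h x)"
proof
  fix x
  have "((\<lambda>x. f x + h x) has_derivative
      (\<lambda>v. frechet_derivative f (at x) v + frechet_derivative h (at x) v)) (at x)"
    using assms by (intro has_derivative_add) (simp_all add: frechet_derivative_works[symmetric])
  then show "partial_deriv i (\<lambda>x. f x + h x) x = partial_deriv i f x + partial_deriv i h x"
    by (simp add: partial_deriv_eqI) (simp add: partial_deriv_def)
qed

lemma partial_deriv_mult:
  assumes "\<And>x. f differentiable (at x)" "\<And>x. h differentiable (at x)"
  shows "partial_deriv i (\<lambda>x. f x * h x) = (\<lambda>x. f x * partial_deriv i h x + partial_deriv i f x * h x)"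
proof
  fix x
  have "((\<lambda>x. f x * h x) has_derivative
      (\<lambda>v. f x * frechet_derivative h (at x) v + frechet_derivative f (at x) v * h x)) (at x)"
    using assms by (intro has_derivative_mult) (simp_all add: frechet_derivative_works[symmetric])
  then show "partial_deriv i (\<lambda>x. f x * h x) x = f x * partial_deriv i h x + partial_deriv i f x * h x"
    by (simp add: partial_deriv_eqI) (simp add: partial_deriv_def)
qed

lemma partial_deriv_const: "partial_deriv i (\<lambda>x. c) = (\<lambda>x. 0)"
  using partial_deriv_eqI[OF has_derivative_const] by fastforce

lemma Ck_const: "Ck k (\<lambda>x. c)"
  by (induction k arbitrary: c) (simp_all add: partial_deriv_const)

lemma Ck_continuous: "Ck k f \<Longrightarrow> continuous_on UNIV f"
  by (cases k) (auto simp: continuous_on_eq_continuous_at differentiable_imp_continuous_within)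

lemma Ck_Suc: "Ck (Suc k) f \<Longrightarrow> Ck k f"
proof (induction k arbitrary: f)
  case 0
  then show ?case using Ck_continuous[of "Suc 0" f] by simp
qed simp

lemma Ck_add: "Ck k f \<Longrightarrow> Ck k h \<Longrightarrow> Ck k (\<lambda>x. f x + h x)"
  by (induction k arbitrary: f h)
    (auto simp: continuous_on_add partial_deriv_add)

lemma Ck_mult: "Ck k f \<Longrightarrow> Ck k h \<Longrightarrow> Ck k (\<lambda>x. f x * h x)"
proof (induction k arbitrary: f h)
  case (Suc k)
  then have "Ck k f" "Ck k h" by (auto intro: Ck_Suc)
  with Suc show ?case by (auto simp: partial_deriv_mult intro!: Ck_add)
qed (simp add: continuous_on_mult)

lemma Ck_prod: "finite I \<Longrightarrow> (\<And>i. i \<in> I \<Longrightarrow> Ck k (f i)) \<Longrightarrow> Ck k (\<lambda>x. \<Prod>i\<in>I. f i x)"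
  by (induction I rule: finite_induct) (auto simp: Ck_const intro!: Ck_mult)

lemma smooth_add: "smooth f \<Longrightarrow> smooth h \<Longrightarrow> smooth (\<lambda>x. f x + h x)"
  and smooth_mult: "smooth f \<Longrightarrow> smooth h \<Longrightarrow> smooth (\<lambda>x. f x * h x)"
  and smooth_const: "smooth (\<lambda>x. c)"
  unfolding smooth_def by (blast intro: Ck_add Ck_mult Ck_const)+

lemma smooth_continuous: "smooth f \<Longrightarrow> continuous_on S f"
  unfolding smooth_def using Ck_continuous continuous_on_subset by blast

lemma smooth_partial_continuous: "smooth f \<Longrightarrow> continuous_on S (partial_deriv i f)"
  unfolding smooth_def using Ck.simps(2)[of 0 f] continuous_on_subset by fastforce

lemma smooth_differentiable: "smooth f \<Longrightarrow> f differentiable (at x)"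
  unfolding smooth_def using Ck.simps(2)[of 0 f] by blast

text \<open>The factor \<open>poly P (1 / x)\<close> makes the family closed under differentiation,
  so smoothness follows by an induction over all P at once. For P = 1 the values lie between 0 and 1
  and tend to the indicator of the positive half-line as c decreases to 0.\<close>

definition flat :: "real \<Rightarrow> real poly \<Rightarrow> real \<Rightarrow> real" where
  "flat c P x = (if 0 < x then poly P (1 / x) * exp (- c / x) else 0)"

lemma poly_exp_tendsto_0:
  fixes P :: "real poly"
  assumes "0 < c"
  shows "((\<lambda>y. poly P y * exp (- c * y)) \<longlongrightarrow> 0) at_top"
proof -
  have m: "((\<lambda>y. y ^ n * exp (- c * y)) \<longlongrightarrow> 0) at_top" for n
  proof -
    have "filterlim (\<lambda>y. c * y) at_top at_top"
      using assms by (intro filterlim_tendsto_pos_mult_at_top[OF tendsto_const _ filterlim_ident]) auto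
    then have "((\<lambda>y. (c * y) ^ n / exp (c * y)) \<longlongrightarrow> 0) at_top"
      by (rule filterlim_compose[OF tendsto_power_div_exp_0])
    then have "((\<lambda>y. (c * y) ^ n / exp (c * y) / c ^ n) \<longlongrightarrow> 0) at_top"
      by (rule tendsto_divide_zero)
    then show ?thesis
      using assms by (simp add: power_mult_distrib exp_minus field_simps)
  qed
  have "((\<lambda>y. \<Sum>n\<le>degree P. coeff P n * (y ^ n * exp (- c * y))) \<longlongrightarrow> 0) at_top"
    by (intro tendsto_null_sum tendsto_mult_right_zero m)
  then show ?thesis by (simp add: poly_altdef sum_distrib_right mult.assoc)
qed

text \<open>With y = 1/x the chain rule gives y^2 (c P(y) - P'(y)) exp(-c y), which is where the
  factor \<open>[:0, 0, 1:]\<close> comes from. At 0 both one-sided difference quotients tend to 0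
  because the exponential beats every polynomial.\<close>

lemma flat_has_derivative:
  assumes c: "0 < c"
  shows "(flat c P has_real_derivative
    flat c ([:0, 0, 1:] * (smult c P - pderiv P)) x) (at x)"
proof -
  consider "x < 0" | "x = 0" | "0 < x" by linarith
  then show ?thesis
  proof cases
    case 1
    have "((\<lambda>_. 0) has_real_derivative 0) (at x)" by simp
    then have "(flat c P has_real_derivative 0) (at x)"
      by (rule DERIV_cong_ev[THEN iffD1, rotated -1])
        (use 1 eventually_nhds_in_open[of "{..<0}" x] in \<open>auto simp: flat_def elim!: eventually_mono\<close>)
    then show ?thesis using 1 by (simp add: flat_def)
  next
    case 3
    have "((\<lambda>x. poly P (1 / x) * exp (- c / x)) has_real_derivative
      poly ([:0, 0, 1:] * (smult c P - pderiv P)) (1 / x) * exp (- c / x)) (at x)"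
      using 3 by (auto intro!: derivative_eq_intros poly_DERIV[THEN DERIV_chain2]
          simp: power2_eq_square field_simps)
    then have "(flat c P has_real_derivative
      poly ([:0, 0, 1:] * (smult c P - pderiv P)) (1 / x) * exp (- c / x)) (at x)"
      by (rule DERIV_cong_ev[THEN iffD1, rotated -1])
        (use 3 eventually_nhds_in_open[of "{0<..}" x] in \<open>auto simp: flat_def elim!: eventually_mono\<close>)
    then show ?thesis using 3 by (simp add: flat_def)
  next
    case 2
    have r: "((\<lambda>h. flat c P h / h) \<longlongrightarrow> 0) (at_right 0)"
    proof -
      \<comment> \<open>For h > 0 the quotient is y P(y) exp(-c y) at y = 1/h, hence of the same
        kind with P multiplied by the variable.\<close>
      have "((\<lambda>h. poly ([:0, 1:] * P) (inverse h) * exp (- c * inverse h)) \<longlongrightarrow> 0) (at_right 0)"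
        by (rule filterlim_compose[OF poly_exp_tendsto_0[OF c] filterlim_inverse_at_top_right])
      then show ?thesis
        by (rule Lim_transform_eventually)
          (auto simp: eventually_at_filter flat_def divide_inverse mult.commute intro!: always_eventually)
    qed
    have l: "((\<lambda>h. flat c P h / h) \<longlongrightarrow> 0) (at_left 0)"
      by (rule Lim_transform_eventually[OF tendsto_const])
        (auto simp: eventually_at_filter flat_def intro!: always_eventually)
    have "((\<lambda>h. flat c P h / h) \<longlongrightarrow> 0) (at 0)"
      using l r by (simp add: filterlim_split_at)
    then show ?thesis using 2 by (simp add: DERIV_def flat_def)
  qed
qed

lemma Ck_flat_affine:
  assumes c: "0 < c"
  shows "Ck k (\<lambda>x::real^'n::finite. flat c P (\<sigma> * x $ i + d))"
proof (induction k arbitrary: P)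
  case 0
  have "continuous_on UNIV (flat c P)"
    by (intro continuous_at_imp_continuous_on ballI DERIV_isCont[OF flat_has_derivative[OF c]])
  moreover have "continuous_on UNIV (\<lambda>x::real^'n. \<sigma> * x $ i + d)"
    by (intro continuous_intros)
  ultimately show ?case
    using continuous_on_compose2[of UNIV "flat c P" UNIV "\<lambda>x::real^'n. \<sigma> * x $ i + d"] by simp
next
  case (Suc k)
  let ?P' = "[:0, 0, 1:] * (smult c P - pderiv P)"
  have d: "((\<lambda>x::real^'n. flat c P (\<sigma> * x $ i + d)) has_derivative
      (\<lambda>v. flat c ?P' (\<sigma> * x $ i + d) * (\<sigma> * v $ i))) (at x)" for x
  proof -
    have "((\<lambda>x::real^'n. \<sigma> * x $ i + d) has_derivative (\<lambda>v. \<sigma> * v $ i)) (at x)"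
      by (auto intro!: derivative_eq_intros bounded_linear_imp_has_derivative bounded_linear_vec_nth)
    from has_derivative_compose[OF this, of "flat c P" "\<lambda>v. flat c ?P' (\<sigma> * x $ i + d) * v"]
    show ?thesis
      using flat_has_derivative[OF c, of P "\<sigma> * x $ i + d"] by (simp add: has_field_derivative_def)
  qed
  have "partial_deriv j (\<lambda>x. flat c P (\<sigma> * x $ i + d)) =
      (\<lambda>x::real^'n. (\<sigma> * axis j 1 $ i) * flat c ?P' (\<sigma> * x $ i + d))" for j
    using partial_deriv_eqI[OF d] by (intro ext) simp
  with d Suc show ?case
    by (auto simp: differentiable_def intro!: Ck_mult Ck_const)
qed

definition bump :: "real \<Rightarrow> real^'n \<Rightarrow> real^'n \<Rightarrow> real^'n::finite \<Rightarrow> real" where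
  "bump c a b x = (\<Prod>i\<in>UNIV. flat c 1 (x $ i - a $ i) * flat c 1 (b $ i - x $ i))"

lemma smooth_bump: "0 < c \<Longrightarrow> smooth (bump c a b)"
  unfolding smooth_def bump_def
  using Ck_flat_affine[of c _ 1 1 _ "- a $ _"] Ck_flat_affine[of c _ 1 "-1" _ "b $ _"]
  by (auto intro!: Ck_prod Ck_mult simp: add.commute)

lemma bump_in_test_fun:
  assumes "0 < c" "cbox a b \<subseteq> \<Omega>"
  shows "bump c a b \<in> test_fun \<Omega>"
proof -
  have "{x. bump c a b x \<noteq> 0} \<subseteq> cbox a b"
  proof
    fix x assume "x \<in> {x. bump c a b x \<noteq> 0}"
    then have "flat c 1 (x $ i - a $ i) \<noteq> 0 \<and> flat c 1 (b $ i - x $ i) \<noteq> 0" for i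
      by (auto simp: bump_def)
    then have "a $ i < x $ i \<and> x $ i < b $ i" for i
      by (simp add: flat_def) (metis less_irrefl)
    then show "x \<in> cbox a b" by (auto simp: mem_box_cart less_imp_le)
  qed
  then have "closure {x. bump c a b x \<noteq> 0} \<subseteq> cbox a b"
    by (intro closure_minimal) auto
  then show ?thesis
    using assms smooth_bump[of c a b] bounded_subset[OF bounded_cbox[of a b]]
      closure_subset[of "{x. bump c a b x \<noteq> 0}"] unfolding test_fun_def
    by auto
qed

lemma bump_bounds: "0 < c \<Longrightarrow> 0 \<le> bump c a b x" "0 < c \<Longrightarrow> bump c a b x \<le> 1"
proof -
  assume c: "0 < c"
  have *: "0 \<le> flat c 1 y \<and> flat c 1 y \<le> 1" for y
    using c by (auto simp: flat_def)
  show "0 \<le> bump c a b x" unfolding bump_def by (intro prod_nonneg) (use * in auto)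
  show "bump c a b x \<le> 1" unfolding bump_def
    by (intro prod_le_1) (use * in \<open>auto intro!: mult_le_one\<close>)
qed

lemma bump_tendsto_indicator:
  "(\<lambda>k. bump (inverse (real (Suc k))) a b x) \<longlonglongrightarrow> indicator (box a b) x"
proof -
  have f: "(\<lambda>k. flat (inverse (real (Suc k))) 1 y) \<longlonglongrightarrow> (if 0 < y then 1 else 0)" for y
  proof (cases "0 < y")
    case True
    have "(\<lambda>k. exp (- inverse (real (Suc k)) / y)) \<longlonglongrightarrow> exp (- 0 / y)"
      by (intro tendsto_intros LIMSEQ_inverse_real_of_nat) (use True in auto)
    then show ?thesis using True by (simp add: flat_def)
  qed (simp add: flat_def)
  have "(\<lambda>k. bump (inverse (real (Suc k))) a b x) \<longlonglongrightarrow>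
      (\<Prod>i\<in>UNIV. (if 0 < x $ i - a $ i then 1 else 0) * (if 0 < b $ i - x $ i then 1 else 0))"
    unfolding bump_def by (intro tendsto_prod tendsto_mult f)
  also have "(\<Prod>i\<in>UNIV. (if 0 < x $ i - a $ i then 1 else 0) * (if 0 < b $ i - x $ i then 1 else 0))
      = (indicator (box a b) x :: real)"
  proof (cases "x \<in> box a b")
    case True
    then show ?thesis by (auto simp: mem_box_cart intro!: prod.neutral)
  next
    case False
    then obtain i where "\<not> (a $ i < x $ i \<and> x $ i < b $ i)" by (auto simp: mem_box_cart)
    then show ?thesis using False by (auto intro!: prod_zero bexI[of _ i])
  qed
  finally show ?thesis .
qed

section \<open>Weak gradients\<close>

text \<open>The function spaces integrate over \<open>lebesgue_on \<Omega>\<close>, whereas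
  translation and scaling invariance are statements about \<open>lborel\<close>. This passes from
  one to the other for functions that are their own extension by zero.\<close>

lemma integral_lebesgue_on_eq_lborel:
  fixes f :: "'a::euclidean_space \<Rightarrow> real"
  assumes "continuous_on UNIV f" "S \<in> sets lebesgue" "\<And>x. x \<notin> S \<Longrightarrow> f x = 0"
  shows "(LINT x|lebesgue_on S. f x) = (LINT x|lborel. f x)"
    and "integrable (lebesgue_on S) f \<longleftrightarrow> integrable lborel f"
proof -
  have m: "f \<in> borel_measurable borel"
    using assms(1) by (rule borel_measurable_continuous_onI)
  have e: "(\<lambda>x. indicator S x *\<^sub>R f x) = f"
    using assms(3) by (fastforce simp: indicator_def)
  have S: "S \<inter> space lebesgue \<in> sets lebesgue" using assms(2) by simp
  show "(LINT x|lebesgue_on S. f x) = (LINT x|lborel. f x)"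
    using integral_restrict_space[OF S, of f] integral_completion[of f lborel] m unfolding e by simp
  show "integrable (lebesgue_on S) f \<longleftrightarrow> integrable lborel f"
    using integrable_restrict_space[OF S, of f] integrable_completion[of f lborel] m unfolding e by simp
qed

lemma integrable_continuous_compact_support:
  fixes f :: "'a::euclidean_space \<Rightarrow> real"
  assumes "continuous_on UNIV f" "compact S" "\<And>x. x \<notin> S \<Longrightarrow> f x = 0"
  shows "integrable lborel f"
proof -
  have "(\<lambda>x. indicator S x *\<^sub>R f x) = f"
    using assms(3) by (fastforce simp: indicator_def)
  then show ?thesis
    using borel_integrable_compact[OF assms(2), of f] assms(1) continuous_on_subset by fastforce
qed

lemma partial_deriv_eq_0_outside:
  assumes "\<And>x. x \<notin> S \<Longrightarrow> f x = 0" "closed S" "x \<notin> S"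
  shows "partial_deriv i f x = 0"
proof -
  have "((\<lambda>_. 0) has_derivative (\<lambda>_. 0)) (at x)" by simp
  then have "(f has_derivative (\<lambda>_. 0)) (at x)"
    by (rule has_derivative_transform_within_open[of _ _ _ _ "- S"]) (use assms in auto)
  then show ?thesis by (simp add: partial_deriv_eqI)
qed

lemma has_derivative_along_axis:
  fixes f :: "real^'n::finite \<Rightarrow> real"
  assumes "\<And>x. f differentiable (at x)"
  shows "((\<lambda>s. f (x + s *\<^sub>R v)) has_real_derivative frechet_derivative f (at (x + s *\<^sub>R v)) v) (at s)"
proof -
  have "((\<lambda>s. x + s *\<^sub>R v) has_derivative (\<lambda>h. h *\<^sub>R v)) (at s)"
    by (auto intro!: derivative_eq_intros)
  moreover have fd: "(f has_derivative frechet_derivative f (at y)) (at y)" for y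
    using assms by (simp add: frechet_derivative_works[symmetric])
  ultimately have "((\<lambda>s. f (x + s *\<^sub>R v)) has_derivative
      (\<lambda>h. frechet_derivative f (at (x + s *\<^sub>R v)) (h *\<^sub>R v))) (at s)"
    by (rule has_derivative_compose)
  moreover have "linear (frechet_derivative f (at (x + s *\<^sub>R v)))"
    using has_derivative_linear[OF fd] .
  ultimately show ?thesis
    by (simp add: has_field_derivative_def linear_scale mult_commute_abs)
qed

text \<open>Translation invariance: every difference quotient in direction i has integral 0, and
  dominated convergence passes this on to the derivative, with no slicing into one-dimensional
  integrals.\<close>

lemma integral_partial_deriv_eq_0:
  fixes f :: "real^'n::finite \<Rightarrow> real"
  assumes d: "\<And>x. f differentiable (at x)" and c: "continuous_on UNIV (partial_deriv i f)"
    and K: "compact K" "\<And>x. x \<notin> K \<Longrightarrow> f x = 0"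
  shows "(LINT x|lborel. partial_deriv i f x) = 0"
proof -
  let ?e = "axis i 1 :: real^'n"
  let ?h = "\<lambda>k::nat. inverse (real (Suc k))"
  let ?q = "\<lambda>k x. (f (x + ?h k *\<^sub>R ?e) - f x) / ?h k"
  have cf: "continuous_on UNIV f"
    using d by (simp add: continuous_on_eq_continuous_at differentiable_imp_continuous_within)
  have fint: "integrable lborel f"
    by (rule integrable_continuous_compact_support[OF cf K])
  have shift: "integrable lborel (\<lambda>x. f (x + v))" "(LINT x|lborel. f (x + v)) = (LINT x|lborel. f x)" for v
  proof -
    have b: "f \<in> borel_measurable borel" using cf by (rule borel_measurable_continuous_onI)
    have "integrable (distr lborel borel ((+) v)) f" using fint by (simp add: lborel_distr_plus)
    then show "integrable lborel (\<lambda>x. f (x + v))"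
      by (subst (asm) integrable_distr_eq) (auto simp: b add.commute)
    have "(LINT x|distr lborel borel ((+) v). f x) = (LINT x|lborel. f (v + x))"
      by (rule integral_distr) (auto simp: b)
    then show "(LINT x|lborel. f (x + v)) = (LINT x|lborel. f x)"
      by (simp add: lborel_distr_plus add.commute)
  qed
  obtain R where R: "\<And>x. x \<in> K \<Longrightarrow> norm x \<le> R"
    using compact_imp_bounded[OF K(1)] by (auto simp: bounded_iff)
  \<comment> \<open>Shifts have length at most 1. Off this ball both x and its shift miss K, so the
    quotient is 0; on it the mean value point stays in the ball of radius R + 2, where
    \<open>M\<close> bounds the derivative.\<close>
  let ?C = "cball (0::real^'n) (R + 1)"
  obtain M where M: "\<And>x. x \<in> cball 0 (R + 2) \<Longrightarrow> \<bar>partial_deriv i f x\<bar> \<le> M"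
  proof -
    have "compact (partial_deriv i f ` cball 0 (R + 2))"
      using c continuous_on_subset by (intro compact_continuous_image) auto
    then obtain M where "\<forall>y\<in>partial_deriv i f ` cball 0 (R + 2). norm y \<le> M"
      using compact_imp_bounded bounded_iff by blast
    then show ?thesis using that[of M] by auto
  qed
  have mvt: "\<exists>s. 0 < s \<and> s < h \<and> f (x + h *\<^sub>R ?e) - f x = h * partial_deriv i f (x + s *\<^sub>R ?e)"
    if "0 < h" for h x
    using MVT2[of 0 h "\<lambda>s. f (x + s *\<^sub>R ?e)" "\<lambda>s. partial_deriv i f (x + s *\<^sub>R ?e)"] that
      has_derivative_along_axis[OF d, of x ?e] by (auto simp: partial_deriv_def)
  have lim: "(\<lambda>k. LINT x|lborel. ?q k x) \<longlonglongrightarrow> (LINT x|lborel. partial_deriv i f x)"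
  proof (rule integral_dominated_convergence[where w="\<lambda>x. indicator ?C x *\<^sub>R M"])
    show "partial_deriv i f \<in> borel_measurable lborel"
      using c by (simp add: borel_measurable_continuous_onI)
    show "?q k \<in> borel_measurable lborel" for k
      using borel_measurable_continuous_onI[OF cf]
      by (simp add: borel_measurable_diff measurable_compose[of "\<lambda>x. x + _"])
    show "integrable lborel (\<lambda>x. indicator ?C x *\<^sub>R M)"
      by (rule borel_integrable_compact) auto
    show "AE x in lborel. (\<lambda>k. ?q k x) \<longlonglongrightarrow> partial_deriv i f x"
    proof (rule AE_I2)
      fix x
      have "((\<lambda>s. (f (x + s *\<^sub>R ?e) - f x) / s) \<longlongrightarrow> partial_deriv i f x) (at 0)"
        using has_derivative_along_axis[OF d, of x ?e 0] by (simp add: DERIV_def partial_deriv_def)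
      moreover have "filterlim ?h (at 0) sequentially"
        using LIMSEQ_inverse_real_of_nat by (simp add: filterlim_at del: of_nat_Suc)
      ultimately show "(\<lambda>k. ?q k x) \<longlonglongrightarrow> partial_deriv i f x"
        by (rule filterlim_compose)
    qed
    show "AE x in lborel. norm (?q k x) \<le> indicator ?C x *\<^sub>R M" for k
    proof (rule AE_I2)
      fix x
      have hk: "0 < ?h k" "?h k \<le> 1" by (simp_all add: inverse_le_1_iff)
      show "norm (?q k x) \<le> indicator ?C x *\<^sub>R M"
      proof (cases "x \<in> ?C")
        case True
        obtain s where s: "0 < s" "s < ?h k"
          "f (x + ?h k *\<^sub>R ?e) - f x = ?h k * partial_deriv i f (x + s *\<^sub>R ?e)"
          using mvt[OF hk(1)] by blast
        have "norm (x + s *\<^sub>R ?e) \<le> norm x + s"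
          using norm_triangle_ineq[of x "s *\<^sub>R ?e"] s(1) by simp
        then have "x + s *\<^sub>R ?e \<in> cball 0 (R + 2)" using True s hk by simp
        then show ?thesis using M s(3) hk True by (simp del: of_nat_Suc)
      next
        case False
        then have "x \<notin> K" using R by fastforce
        have "norm (x + ?h k *\<^sub>R ?e) \<ge> norm x - ?h k"
          using norm_diff_ineq[of x "?h k *\<^sub>R ?e"] hk by simp
        then have "x + ?h k *\<^sub>R ?e \<notin> K" using R False hk by fastforce
        then show ?thesis using K(2) \<open>x \<notin> K\<close> False by simp
      qed
    qed
  qed
  have "(LINT x|lborel. ?q k x) = 0" for k
    using shift[of "?h k *\<^sub>R ?e"] fint by (simp del: of_nat_Suc)
  then have "(\<lambda>k. LINT x|lborel. ?q k x) \<longlonglongrightarrow> 0" by (simp only: tendsto_const)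
  then show ?thesis using LIMSEQ_unique[OF lim] by simp
qed

definition grad :: "(real^'n::finite \<Rightarrow> real) \<Rightarrow> real^'n \<Rightarrow> real^'n" where
  "grad \<phi> x = (\<chi> i. partial_deriv i \<phi> x)"

lemma smooth_grad_continuous: "smooth \<phi> \<Longrightarrow> continuous_on S (grad \<phi>)"
  unfolding grad_def by (intro continuous_on_vec_lambda smooth_partial_continuous)

lemma test_funD:
  assumes "\<phi> \<in> test_fun \<Omega>"
  shows "smooth \<phi>" "\<exists>K. compact K \<and> K \<subseteq> \<Omega> \<and> (\<forall>x. x \<notin> K \<longrightarrow> \<phi> x = 0 \<and> grad \<phi> x = 0)"
proof -
  define K where "K = closure {x. \<phi> x \<noteq> 0}"
  have z: "\<phi> x = 0" if "x \<notin> K" for x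
    using that closure_subset[of "{x. \<phi> x \<noteq> 0}"] by (auto simp: K_def)
  have "partial_deriv i \<phi> x = 0" if "x \<notin> K" for x i
    using partial_deriv_eq_0_outside[OF z _ that] by (simp add: K_def)
  moreover have "compact K" "K \<subseteq> \<Omega>" using assms by (simp_all add: test_fun_def K_def)
  ultimately show "\<exists>K. compact K \<and> K \<subseteq> \<Omega> \<and> (\<forall>x. x \<notin> K \<longrightarrow> \<phi> x = 0 \<and> grad \<phi> x = 0)"
    using z by (intro exI[of _ K]) (simp add: grad_def vec_eq_iff)
  show "smooth \<phi>" using assms by (simp add: test_fun_def)
qed

lemma test_fun_diff:
  assumes f: "f \<in> test_fun \<Omega>" and h: "h \<in> test_fun \<Omega>"
  shows "(\<lambda>x. f x - h x) \<in> test_fun \<Omega>"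
proof -
  have "smooth (\<lambda>x. f x + (- 1) * h x)"
    using f h by (intro smooth_add smooth_mult smooth_const) (auto simp: test_fun_def)
  moreover have c: "closure {x. f x - h x \<noteq> 0} \<subseteq> closure {x. f x \<noteq> 0} \<union> closure {x. h x \<noteq> 0}"
    by (subst closure_Un[symmetric], rule closure_mono) auto
  moreover have "compact (closure {x. f x - h x \<noteq> 0})"
  proof -
    have "compact (closure {x. f x \<noteq> 0} \<union> closure {x. h x \<noteq> 0})"
      using f h by (intro compact_Un) (auto simp: test_fun_def)
    then show ?thesis using bounded_subset[OF compact_imp_bounded c]
      by (simp add: compact_eq_bounded_closed)
  qed
  ultimately show ?thesis using f h unfolding test_fun_def by auto
qed

lemma continuous_in_L2:
  fixes f :: "real^'n::finite \<Rightarrow> 'b::euclidean_space"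
  assumes "open \<Omega>" "continuous_on UNIV f" "compact K" "K \<subseteq> \<Omega>" "\<And>x. x \<notin> K \<Longrightarrow> f x = 0"
  shows "f \<in> L2 \<Omega>"
proof -
  have "f \<in> borel_measurable borel" using assms(2) by (rule borel_measurable_continuous_onI)
  then have "f \<in> borel_measurable lebesgue"
    by (auto intro: measurable_completion)
  then have "f \<in> borel_measurable (lebesgue_on \<Omega>)" by (rule measurable_restrict_space1)
  moreover have "integrable (lebesgue_on \<Omega>) (\<lambda>x. (norm (f x))\<^sup>2)"
  proof (subst integral_lebesgue_on_eq_lborel(2))
    show c: "continuous_on UNIV (\<lambda>x. (norm (f x))\<^sup>2)"
      using assms(2) by (intro continuous_intros)
    show "integrable lborel (\<lambda>x. (norm (f x))\<^sup>2)"
      using assms by (intro integrable_continuous_compact_support[OF c, of K]) auto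
  qed (use assms in auto)
  ultimately show ?thesis by (simp add: L2_def)
qed

lemma test_fun_L2:
  assumes "open \<Omega>" "\<phi> \<in> test_fun \<Omega>"
  shows "\<phi> \<in> L2 \<Omega>" "grad \<phi> \<in> L2 \<Omega>"
  using test_funD[OF assms(2)] assms(1)
  by (auto intro!: continuous_in_L2 smooth_continuous smooth_grad_continuous)

text \<open>Integration by parts is the product rule for \<phi> \<psi> together with the vanishing
  integral of the derivative of this compactly supported product.\<close>

lemma test_fun_weak_grad:
  assumes "open \<Omega>" and phi: "\<phi> \<in> test_fun \<Omega>"
  shows "is_weak_grad \<Omega> \<phi> (grad \<phi>)"
  unfolding is_weak_grad_def
proof (intro ballI allI)
  fix \<psi> i assume psi: "\<psi> \<in> test_fun \<Omega>"
  obtain K where K: "compact K" "K \<subseteq> \<Omega>" "\<And>x. x \<notin> K \<Longrightarrow> \<phi> x = 0 \<and> grad \<phi> x = 0"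
    using test_funD(2)[OF phi] by blast
  have s: "smooth \<phi>" "smooth \<psi>" using test_funD phi psi by auto
  have z: "x \<notin> K \<Longrightarrow> partial_deriv j \<phi> x = 0" for x j
    using K(3) by (auto simp: grad_def vec_eq_iff)
  note cs = smooth_continuous smooth_partial_continuous
  have c: "continuous_on UNIV (\<lambda>x. \<phi> x * partial_deriv i \<psi> x)"
    "continuous_on UNIV (\<lambda>x. partial_deriv i \<phi> x * \<psi> x)"
    using s by (intro continuous_on_mult cs; simp)+
  have int: "integrable lborel (\<lambda>x. \<phi> x * partial_deriv i \<psi> x)"
    "integrable lborel (\<lambda>x. partial_deriv i \<phi> x * \<psi> x)"
    using K z by (auto intro!: integrable_continuous_compact_support[OF _ K(1)] c)
  have pm: "partial_deriv i (\<lambda>x. \<phi> x * \<psi> x) =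
      (\<lambda>x. \<phi> x * partial_deriv i \<psi> x + partial_deriv i \<phi> x * \<psi> x)"
    using s by (intro partial_deriv_mult smooth_differentiable)
  have "(LINT x|lborel. partial_deriv i (\<lambda>x. \<phi> x * \<psi> x) x) = 0"
    using s K by (intro integral_partial_deriv_eq_0[of _ _ K] smooth_differentiable smooth_mult
        smooth_partial_continuous) auto
  then have "(LINT x|lborel. \<phi> x * partial_deriv i \<psi> x) = - (LINT x|lborel. partial_deriv i \<phi> x * \<psi> x)"
    using int by (simp add: pm)
  then show "(LINT x|lebesgue_on \<Omega>. \<phi> x * partial_deriv i \<psi> x) =
      - (LINT x|lebesgue_on \<Omega>. grad \<phi> x $ i * \<psi> x)"
    unfolding grad_def vec_lambda_beta
    using K(2,3) z assms(1) c by (subst (1 2) integral_lebesgue_on_eq_lborel(1)) auto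
qed

lemma L2_component:
  fixes G :: "real^'n::finite \<Rightarrow> real^'m"
  assumes "G \<in> L2 \<Omega>"
  shows "(\<lambda>x. G x $ i) \<in> L2 \<Omega>"
proof -
  have m: "(\<lambda>x. G x $ i) \<in> borel_measurable (lebesgue_on \<Omega>)"
    using borel_measurable_inner[OF L2_measurable[OF assms] borel_measurable_const[of "axis i 1"]]
    by (simp add: inner_axis)
  have "integrable (lebesgue_on \<Omega>) (\<lambda>x. (G x $ i)\<^sup>2)"
  proof (rule Bochner_Integration.integrable_bound[OF L2_integrable[OF assms]])
    show "AE x in lebesgue_on \<Omega>. norm ((G x $ i)\<^sup>2) \<le> norm ((norm (G x))\<^sup>2)"
      using component_le_norm_cart[of "G _" i]
      by (intro AE_I2) (metis abs_norm_cancel norm_power power2_abs power_mono abs_ge_zero real_norm_def)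
  qed (use m in measurable)
  with m show ?thesis by (simp add: L2_def)
qed

lemma L2_imp_integrable:
  fixes f :: "real^'n::finite \<Rightarrow> real"
  assumes "f \<in> L2 \<Omega>" "bounded \<Omega>" "open \<Omega>"
  shows "integrable (lebesgue_on \<Omega>) f"
proof -
  have "(\<lambda>x. 1 :: real) \<in> L2 \<Omega>"
    using finite_measure.integrable_const[OF finite_measure_lebesgue_on, of \<Omega> "1 :: real"] assms(2,3)
    by (simp add: L2_def bounded_set_imp_lmeasurable)
  then show ?thesis using L2_inner_integrable[OF assms(1), of "\<lambda>x. 1"] by simp
qed

text \<open>Bumps converge to indicators of boxes, so the averages of \<open>f\<close> over all small boxes vanish.\<close>

lemma fundamental_lemma_variations:
  fixes f :: "real^'n::finite \<Rightarrow> real"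
  assumes "open \<Omega>" and f: "integrable (lebesgue_on \<Omega>) f"
    and z: "\<And>\<phi>. \<phi> \<in> test_fun \<Omega> \<Longrightarrow> (LINT x|lebesgue_on \<Omega>. f x * \<phi> x) = 0"
  shows "AE x in lebesgue_on \<Omega>. f x = 0"
proof -
  have O: "\<Omega> \<in> sets lebesgue" using assms(1) by auto
  have box0: "integral (cbox a b) f = 0" if "cbox a b \<subseteq> \<Omega>" for a b
  proof -
    let ?b = "\<lambda>k. bump (inverse (real (Suc k))) a b"
    have B: "box a b \<in> sets (lebesgue_on \<Omega>)"
      using O that box_subset_cbox[of a b] by (subst sets_restrict_space_iff) auto
    have lim: "(\<lambda>k. LINT x|lebesgue_on \<Omega>. f x * ?b k x) \<longlonglongrightarrow>
        (LINT x|lebesgue_on \<Omega>. f x * indicator (box a b) x)"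
    proof (rule integral_dominated_convergence[where w="\<lambda>x. \<bar>f x\<bar>"])
      show "(\<lambda>x. f x * indicator (box a b) x) \<in> borel_measurable (lebesgue_on \<Omega>)"
        using f B by (intro borel_measurable_times borel_measurable_integrable borel_measurable_indicator)
      show "(\<lambda>x. f x * ?b k x) \<in> borel_measurable (lebesgue_on \<Omega>)" for k
      proof (intro borel_measurable_times borel_measurable_integrable[OF f])
        have "?b k \<in> L2 \<Omega>"
          using that by (intro test_fun_L2 assms(1) bump_in_test_fun) auto
        then show "?b k \<in> borel_measurable (lebesgue_on \<Omega>)" by (rule L2_measurable)
      qed
      show "AE x in lebesgue_on \<Omega>. (\<lambda>k. f x * ?b k x) \<longlonglongrightarrow> f x * indicator (box a b) x"
        by (intro AE_I2 tendsto_mult tendsto_const bump_tendsto_indicator)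
      show "AE x in lebesgue_on \<Omega>. norm (f x * ?b k x) \<le> \<bar>f x\<bar>" for k
        using bump_bounds[of "inverse (real (Suc k))" a b]
        by (intro AE_I2) (simp add: abs_mult mult_left_le)
    qed (use f in auto)
    have "(LINT x|lebesgue_on \<Omega>. f x * ?b k x) = 0" for k
      using that by (intro z bump_in_test_fun) auto
    then have "(\<lambda>k. LINT x|lebesgue_on \<Omega>. f x * ?b k x) \<longlonglongrightarrow> 0" by (simp only: tendsto_const)
    then have l: "(LINT x|lebesgue_on \<Omega>. f x * indicator (box a b) x) = 0"
      using LIMSEQ_unique[OF lim] by simp
    have i: "integrable (lebesgue_on \<Omega>) (\<lambda>x. f x * indicator (box a b) x)"
      using f B by (intro integrable_real_mult_indicator)
    have "integral (cbox a b) f = integral (box a b) f"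
      by (simp add: integral_open_interval)
    also have "\<dots> = integral \<Omega> (\<lambda>x. if x \<in> box a b then f x else 0)"
    proof -
      have "box a b \<inter> \<Omega> = box a b" using that box_subset_cbox[of a b] by auto
      then show ?thesis by (simp add: integral_restrict_Int)
    qed
    also have "(\<lambda>x. if x \<in> box a b then f x else 0) = (\<lambda>x. f x * indicator (box a b) x)"
      by (auto simp: indicator_def)
    also have "integral \<Omega> \<dots> = 0"
      using lebesgue_integral_eq_integral[OF i O] l by simp
    finally show ?thesis .
  qed
  \<comment> \<open>Extended by zero, f is integrable on every box, and the differentiation theorem
    makes its averages over cubes with corner x converge to its value at almost every x.\<close>
  let ?f = "\<lambda>x. if x \<in> \<Omega> then f x else 0"
  have "?f integrable_on UNIV"
    using integrable_on_lebesgue_on[OF f O] by (simp add: integrable_restrict_UNIV)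
  then have "?f integrable_on cbox a b" for a b
    by (rule integrable_on_subcbox) simp
  then obtain N where N: "negligible N" and
    lim: "\<And>x e. \<lbrakk>x \<notin> N; 0 < e\<rbrakk> \<Longrightarrow> \<exists>d>0. \<forall>h. 0 < h \<and> h < d \<longrightarrow>
        norm (integral (cbox x (x + h *\<^sub>R One)) ?f /\<^sub>R h ^ DIM(real^'n) - ?f x) < e"
    using integrable_ccontinuous_explicit[of ?f] by blast
  have "f x = 0" if x: "x \<in> \<Omega>" "x \<notin> N" for x
  proof (rule ccontr)
    assume "f x \<noteq> 0"
    then obtain d where d: "d > 0" and dl: "\<And>h. 0 < h \<Longrightarrow> h < d \<Longrightarrow>
        norm (integral (cbox x (x + h *\<^sub>R One)) ?f /\<^sub>R h ^ DIM(real^'n) - ?f x) < \<bar>f x\<bar>"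
      using lim[OF x(2), of "\<bar>f x\<bar>"] by auto
    obtain r where r: "r > 0" "ball x r \<subseteq> \<Omega>" using assms(1) x(1) open_contains_ball by blast
    let ?n = "norm (One :: real^'n)"
    have n0: "0 < ?n" using norm_ge_zero by (metis One_neq_0 zero_less_norm_iff)
    \<comment> \<open>The cube with corner x and side h has diameter \<open>h * ?n\<close>; the
      choice keeps it inside the ball of radius r about x, hence inside \<Omega>, where
      \<open>box0\<close> applies.\<close>
    define h where "h = min (d / 2) (r / (2 * ?n))"
    have h: "0 < h" "h < d" "h * ?n < r"
    proof -
      show "0 < h" "h < d" using d r n0 by (auto simp: h_def)
      have "h * ?n \<le> r / (2 * ?n) * ?n" unfolding h_def using n0 by (intro mult_right_mono) auto
      also have "\<dots> < r" using r n0 by simp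
      finally show "h * ?n < r" .
    qed
    have sub: "cbox x (x + h *\<^sub>R One) \<subseteq> \<Omega>"
    proof
      fix y assume y: "y \<in> cbox x (x + h *\<^sub>R One)"
      have "norm (y - x) \<le> norm (h *\<^sub>R (One :: real^'n))"
        by (rule norm_le_componentwise) (use y h(1) in \<open>auto simp: mem_box inner_diff_left inner_add_left\<close>)
      then have "y \<in> ball x r" using h by (simp add: dist_norm norm_minus_commute)
      then show "y \<in> \<Omega>" using r by blast
    qed
    have "integral (cbox x (x + h *\<^sub>R One)) ?f = integral (cbox x (x + h *\<^sub>R One)) f"
      using sub by (intro Henstock_Kurzweil_Integration.integral_cong) auto
    then have "integral (cbox x (x + h *\<^sub>R One)) ?f = 0" using box0[OF sub] by simp
    then show False using dl[OF h(1,2)] x by simp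
  qed
  moreover have "AE x in lebesgue. x \<notin> N"
    using N by (intro AE_not_in) (simp add: negligible_iff_null_sets)
  ultimately have "AE x in lebesgue. x \<in> \<Omega> \<longrightarrow> f x = 0"
    by (auto elim: eventually_mono)
  then show ?thesis using O by (simp add: AE_restrict_space_iff)
qed

text \<open>\<open>wgrad\<close> selects an arbitrary representative, so identities such as its
  linearity hold only almost everywhere, and this lemma is what provides them. Componentwise, the
  difference of two weak gradients is orthogonal to all test functions.\<close>

lemma weak_grad_unique:
  fixes \<Omega> :: "(real^'n::finite) set"
  assumes "open \<Omega>" "bounded \<Omega>" "G \<in> L2 \<Omega>" "G' \<in> L2 \<Omega>" "is_weak_grad \<Omega> v G" "is_weak_grad \<Omega> v G'"
  shows "AE x in lebesgue_on \<Omega>. G x = G' x"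
proof -
  have "AE x in lebesgue_on \<Omega>. G x $ i - G' x $ i = 0" for i
  proof (rule fundamental_lemma_variations[OF assms(1)])
    have L: "(\<lambda>x. G x $ i) \<in> L2 \<Omega>" "(\<lambda>x. G' x $ i) \<in> L2 \<Omega>" using assms L2_component by blast+
    show "integrable (lebesgue_on \<Omega>) (\<lambda>x. G x $ i - G' x $ i)"
      using L assms by (intro L2_imp_integrable L2_diff)
    fix \<phi> assume phi: "\<phi> \<in> test_fun \<Omega>"
    have "integrable (lebesgue_on \<Omega>) (\<lambda>x. G x $ i * \<phi> x)" "integrable (lebesgue_on \<Omega>) (\<lambda>x. G' x $ i * \<phi> x)"
      using L2_inner_integrable[OF L(1) test_fun_L2(1)[OF assms(1) phi]]
        L2_inner_integrable[OF L(2) test_fun_L2(1)[OF assms(1) phi]] by auto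
    then show "(LINT x|lebesgue_on \<Omega>. (G x $ i - G' x $ i) * \<phi> x) = 0"
      using assms(5,6) phi unfolding is_weak_grad_def by (simp add: left_diff_distrib)
  qed
  then have "AE x in lebesgue_on \<Omega>. \<forall>i. G x $ i - G' x $ i = 0"
    by (subst AE_all_countable) auto
  then show ?thesis by eventually_elim (simp add: vec_eq_iff)
qed

section \<open>Subcritical Sobolev inequality\<close>

text \<open>The weighted arithmetic-geometric mean inequality, integrated after dividing X and Y by
  their integrals. If one of these is 0, the product vanishes almost everywhere. Integrability of
  the product comes from the same pointwise inequality.\<close>

lemma Hoelder_integral:
  fixes X Y :: "'a \<Rightarrow> real"
  assumes X: "integrable M X" and Y: "integrable M Y" and nn: "\<And>x. 0 \<le> X x" "\<And>x. 0 \<le> Y x"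
    and \<theta>: "0 < \<theta>" "\<theta> < 1"
  shows "integrable M (\<lambda>x. X x powr \<theta> * Y x powr (1 - \<theta>))"
    and "(LINT x|M. X x powr \<theta> * Y x powr (1 - \<theta>)) \<le> (LINT x|M. X x) powr \<theta> * (LINT x|M. Y x) powr (1 - \<theta>)"
proof -
  have young: "a powr \<theta> * b powr (1 - \<theta>) \<le> \<theta> * a + (1 - \<theta>) * b" if "0 \<le> a" "0 \<le> b" for a b :: real
    using that \<theta> Youngs_inequality_0[of \<theta> "1 - \<theta>" a b] by (cases "a = 0 \<or> b = 0") auto
  have [measurable]: "X \<in> borel_measurable M" "Y \<in> borel_measurable M" using X Y by auto
  show i: "integrable M (\<lambda>x. X x powr \<theta> * Y x powr (1 - \<theta>))"
  proof (rule Bochner_Integration.integrable_bound)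
    show "integrable M (\<lambda>x. \<theta> * X x + (1 - \<theta>) * Y x)" using X Y by auto
    show "AE x in M. norm (X x powr \<theta> * Y x powr (1 - \<theta>)) \<le> norm (\<theta> * X x + (1 - \<theta>) * Y x)"
      using young[OF nn(1) nn(2)] nn \<theta> by (intro AE_I2) (simp add: abs_of_nonneg)
  qed measurable
  let ?a = "LINT x|M. X x" and ?b = "LINT x|M. Y x"
  have ab: "0 \<le> ?a" "0 \<le> ?b" using nn by auto
  show "(LINT x|M. X x powr \<theta> * Y x powr (1 - \<theta>)) \<le> ?a powr \<theta> * ?b powr (1 - \<theta>)"
  proof (cases "?a = 0 \<or> ?b = 0")
    case True
    then have "(AE x in M. X x = 0) \<or> (AE x in M. Y x = 0)"
      using integral_nonneg_eq_0_iff_AE[OF X] integral_nonneg_eq_0_iff_AE[OF Y] nn by auto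
    then have "AE x in M. X x powr \<theta> * Y x powr (1 - \<theta>) = 0" by auto
    then show ?thesis by (simp add: integral_eq_zero_AE)
  next
    case False
    then have ab: "0 < ?a" "0 < ?b" using ab by auto
    let ?c = "?a powr \<theta> * ?b powr (1 - \<theta>)"
    have "(LINT x|M. X x powr \<theta> * Y x powr (1 - \<theta>))
        \<le> (LINT x|M. ?c * (\<theta> * (X x / ?a) + (1 - \<theta>) * (Y x / ?b)))"
    proof (rule integral_mono[OF i])
      fix x
      have "X x powr \<theta> * Y x powr (1 - \<theta>) = ?c * ((X x / ?a) powr \<theta> * (Y x / ?b) powr (1 - \<theta>))"
        using ab nn by (simp add: powr_divide)
      also have "\<dots> \<le> ?c * (\<theta> * (X x / ?a) + (1 - \<theta>) * (Y x / ?b))"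
        using ab nn by (intro mult_left_mono young) auto
      finally show "X x powr \<theta> * Y x powr (1 - \<theta>) \<le> ?c * (\<theta> * (X x / ?a) + (1 - \<theta>) * (Y x / ?b))" .
    qed (use X Y in auto)
    also have "\<dots> = ?c * (\<theta> * (?a / ?a) + (1 - \<theta>) * (?b / ?b))"
      using X Y by simp
    also have "\<dots> = ?c" using ab by simp
    finally show ?thesis .
  qed
qed

lemma frechet_derivative_eq_grad:
  assumes "smooth \<phi>"
  shows "frechet_derivative \<phi> (at x) v = grad \<phi> x \<bullet> v"
proof -
  have "linear (frechet_derivative \<phi> (at x))"
    using smooth_differentiable[OF assms] linear_frechet_derivative by blast
  then have "frechet_derivative \<phi> (at x) (\<Sum>i\<in>UNIV. v $ i *\<^sub>R axis i 1)
      = (\<Sum>i\<in>UNIV. v $ i *\<^sub>R frechet_derivative \<phi> (at x) (axis i 1))"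
    by (simp add: linear_sum linear_scale)
  moreover have "(\<Sum>i\<in>UNIV. v $ i *\<^sub>R axis i 1) = v"
    using basis_expansion[of v] by (simp add: scalar_mult_eq_scaleR)
  ultimately show ?thesis
    by (simp add: inner_vec_def grad_def partial_deriv_def mult.commute)
qed

lemma lborel_integral_affine:
  fixes f :: "'a::euclidean_space \<Rightarrow> real"
  assumes "c \<noteq> 0" "f \<in> borel_measurable borel"
  shows "(LINT x|lborel. f x) = \<bar>c\<bar> ^ DIM('a) * (LINT x|lborel. f (t + c *\<^sub>R x))"
proof -
  have m: "(\<lambda>x. t + c *\<^sub>R x) \<in> measurable lborel (borel :: 'a measure)" by simp
  have "(LINT x|lborel. f x) = (LINT x|distr lborel borel (\<lambda>x. t + c *\<^sub>R x). \<bar>c\<bar> ^ DIM('a) *\<^sub>R f x)"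
    by (subst lborel_affine[OF assms(1), of t])
      (subst integral_density, use assms in auto)
  also have "\<dots> = (LINT x|lborel. \<bar>c\<bar> ^ DIM('a) *\<^sub>R f (t + c *\<^sub>R x))"
    by (rule integral_distr) (use assms in auto)
  finally show ?thesis by simp
qed

text \<open>For \<open>x \<in> \<Omega>\<close> and \<open>y\<close> in the cube \<open>[1,2]\<^sup>n\<close> the ray \<open>x + r y\<close> leaves the support of \<open>\<phi>\<close> before a
  fixed \<open>T\<close>, so \<open>\<phi>(x) = -\<integral>\<^sub>0\<^sup>T \<nabla>\<phi>(x + r y) \<bullet> y dr\<close>.  Averaging over \<open>y\<close>, the operator
  \<open>G \<mapsto> \<integral> G(x + r y) dy\<close> maps \<open>L\<^sup>2\<close> to \<open>L\<^sup>2\<close> with norm at most \<open>1\<close> and \<open>L\<^sup>2\<close> to \<open>L\<^sup>\<infinity>\<close> with norm at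
  most \<open>r\<^sup>-\<^sup>n\<^sup>/\<^sup>2\<close>, hence \<open>L\<^sup>2\<close> to \<open>L\<^sup>k\<close> with norm at most \<open>r\<^sup>-\<^sup>\<beta>\<close>, where \<open>\<beta> = n (1/2 - 1/k) < 1\<close>
  is integrable at \<open>0\<close>.\<close>

lemma cube_average_bounds:
  fixes G :: "real^'n::finite \<Rightarrow> real"
  assumes G: "continuous_on UNIV G" "\<And>x. 0 \<le> G x" and K: "compact K" "\<And>x. x \<notin> K \<Longrightarrow> G x = 0"
    and r: "0 < r"
  defines "Y \<equiv> cbox (vec 1) (vec 2) :: (real^'n) set"
  defines "J \<equiv> \<lambda>x. integral Y (\<lambda>y. G (x + r *\<^sub>R y))"
  defines "N \<equiv> (LINT x|lborel. (G x)\<^sup>2)"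
  shows "0 \<le> J x" "(J x)\<^sup>2 \<le> inverse (r ^ CARD('n)) * N"
    and "integral (cbox a b) (\<lambda>x. (J x)\<^sup>2) \<le> N" "continuous_on UNIV J"
proof -
  have mY: "measure lborel Y = 1"
    unfolding Y_def by (subst content_cbox_cart) (auto simp: interval_ne_empty_cart)
  have c2: "continuous_on S (\<lambda>y. G (x + r *\<^sub>R y))" for S x
    by (rule continuous_on_compose2[OF G(1)]) (auto intro!: continuous_intros)
  have i: "(\<lambda>y. G (x + r *\<^sub>R y)) integrable_on Y" "(\<lambda>y. (G (x + r *\<^sub>R y))\<^sup>2) integrable_on Y" for x
    unfolding Y_def by (intro integrable_continuous continuous_intros c2)+
  show "0 \<le> J x" unfolding J_def by (intro integral_nonneg i) (use G in auto)
  have m2: "(\<lambda>x. (G x)\<^sup>2) \<in> borel_measurable borel"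
    by (intro borel_measurable_continuous_onI continuous_intros G)
  have int2: "integrable lborel (\<lambda>x. (G x)\<^sup>2)"
    using K by (intro integrable_continuous_compact_support[OF _ K(1)] continuous_intros G) auto
  \<comment> \<open>Jensen's inequality as nonnegativity of a variance: \<open>J x\<close> is the
    mean of G(x + r y) over a cube of measure 1.\<close>
  have sq: "(J x)\<^sup>2 \<le> integral Y (\<lambda>y. (G (x + r *\<^sub>R y))\<^sup>2)" for x
  proof -
    have "0 \<le> integral Y (\<lambda>y. (G (x + r *\<^sub>R y) - J x)\<^sup>2)"
      unfolding Y_def by (intro integral_nonneg integrable_continuous continuous_intros c2) auto
    also have "(\<lambda>y. (G (x + r *\<^sub>R y) - J x)\<^sup>2) =
        (\<lambda>y. (G (x + r *\<^sub>R y))\<^sup>2 - 2 * J x * G (x + r *\<^sub>R y) + (J x)\<^sup>2)"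
      by (simp add: power2_diff algebra_simps)
    also have "integral Y \<dots> = integral Y (\<lambda>y. (G (x + r *\<^sub>R y))\<^sup>2) - 2 * J x * J x + (J x)\<^sup>2"
    proof -
      have 1: "((\<lambda>y. 2 * J x * G (x + r *\<^sub>R y)) has_integral 2 * J x * J x) Y"
        unfolding J_def by (intro has_integral_mult_right integrable_integral i)
      have 2: "((\<lambda>y. (J x)\<^sup>2) has_integral (J x)\<^sup>2) Y"
        using has_integral_const[of "(J x)\<^sup>2" "vec 1 :: real^'n" "vec 2"] mY by (simp add: Y_def)
      show ?thesis
        by (intro integral_unique has_integral_add has_integral_diff 1 2 integrable_integral i)
    qed
    finally show ?thesis by (simp add: power2_eq_square)
  qed
  \<comment> \<open>Enlarge the region to the whole space and substitute z = x + c y. With c = r in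
    the variable y this bounds J pointwise; with c = 1 in the variable x it bounds the integral of
    J^2.\<close>
  have whole: "integral S (\<lambda>y. (G (x + c *\<^sub>R y))\<^sup>2) \<le> inverse (c ^ CARD('n)) * N"
    if c: "0 < c" and S: "S = cbox u v" for c S x and u v :: "real^'n"
  proof -
    have cc: "continuous_on U (\<lambda>y. G (x + c *\<^sub>R y))" for U
      by (rule continuous_on_compose2[OF G(1)]) (auto intro!: continuous_intros)
    let ?h = "\<lambda>y. (G (x + c *\<^sub>R y))\<^sup>2"
    have "N = c ^ CARD('n) * (LINT y|lborel. ?h y)"
      unfolding N_def using lborel_integral_affine[OF _ m2, of c x] c by simp
    then have e: "(LINT y|lborel. ?h y) = inverse (c ^ CARD('n)) * N"
      using c by (simp add: field_simps)
    have "?h y = 0" if "y \<notin> (\<lambda>z. inverse c *\<^sub>R (z - x)) ` K" for y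
    proof -
      have "x + c *\<^sub>R y \<notin> K" using that c by (auto simp: image_iff dest!: bspec[of K _ "x + c *\<^sub>R y"])
      then show ?thesis using K by simp
    qed
    moreover have "compact ((\<lambda>z. inverse c *\<^sub>R (z - x)) ` K)"
      using K(1) by (intro compact_continuous_image continuous_intros)
    ultimately have I: "integrable lborel ?h"
      by (intro integrable_continuous_compact_support continuous_intros cc)
    have "integral S ?h \<le> integral UNIV ?h"
      using I S integrable_on_lborel[OF I] by (intro integral_subset_le)
        (auto intro!: integrable_continuous continuous_intros cc)
    also have "\<dots> = (LINT y|lborel. ?h y)" using integral_lborel[OF I] by simp
    finally show ?thesis using e by simp
  qed
  show "(J x)\<^sup>2 \<le> inverse (r ^ CARD('n)) * N"
    using order_trans[OF sq whole[OF r meta_eq_to_obj_eq[OF Y_def]]] .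
  have cJ: "continuous_on U J" for U
    unfolding J_def Y_def
    by (rule integral_continuous_on_param)
      (auto simp: split_beta intro!: continuous_on_compose2[OF G(1)] continuous_intros)
  show "continuous_on UNIV J" by (rule cJ)
  have c3: "continuous_on U (\<lambda>(x, y). (G (x + r *\<^sub>R y))\<^sup>2)" for U
    by (auto simp: split_beta intro!: continuous_on_compose2[OF G(1)] continuous_intros)
  have "integral (cbox a b) (\<lambda>x. (J x)\<^sup>2) \<le> integral (cbox a b) (\<lambda>x. integral Y (\<lambda>y. (G (x + r *\<^sub>R y))\<^sup>2))"
    unfolding Y_def
    by (intro integral_le integrable_continuous continuous_intros cJ integral_continuous_on_param c3)
      (use sq in \<open>auto simp: Y_def\<close>)
  also have "\<dots> = integral Y (\<lambda>y. integral (cbox a b) (\<lambda>x. (G (x + r *\<^sub>R y))\<^sup>2))"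
    unfolding Y_def by (rule integral_swap_continuous[OF c3])
  also have "\<dots> \<le> integral Y (\<lambda>y. N)"
  proof -
    have c4: "continuous_on U (\<lambda>(y, x). (G (x + r *\<^sub>R y))\<^sup>2)" for U
      by (auto simp: split_beta intro!: continuous_on_compose2[OF G(1)] continuous_intros)
    have "integral (cbox a b) (\<lambda>x. (G (x + r *\<^sub>R y))\<^sup>2) \<le> N" for y
      using whole[of 1 "cbox a b" a b "r *\<^sub>R y"] by (simp add: add.commute)
    then show ?thesis
      unfolding Y_def by (intro integral_le integrable_continuous continuous_intros integral_continuous_on_param c4)
  qed
  also have "\<dots> = N" using mY by (simp add: Y_def)
  finally show "integral (cbox a b) (\<lambda>x. (J x)\<^sup>2) \<le> N" .
qed

text \<open>Interpolation between the two bounds: J^k = J^(k-2) J^2, where the first factor is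
  estimated by its supremum and the second is integrated. The power of r becomes -n (k-2)/(2k) = -n
  (1/2 - 1/k).\<close>

lemma cube_average_Lk_bound:
  fixes G :: "real^'n::finite \<Rightarrow> real"
  assumes G: "continuous_on UNIV G" "\<And>x. 0 \<le> G x" and K: "compact K" "\<And>x. x \<notin> K \<Longrightarrow> G x = 0"
    and r: "0 < r" and k: "2 \<le> k"
  defines "J \<equiv> \<lambda>x. integral (cbox (vec 1) (vec 2)) (\<lambda>y. G (x + r *\<^sub>R y))"
  shows "(integral (cbox a b) (\<lambda>x. J x powr k)) powr (1 / k)
    \<le> r powr (- (real CARD('n) * (1/2 - 1/k))) * sqrt (LINT x|lborel. (G x)\<^sup>2)"
proof -
  let ?N = "LINT x|lborel. (G x)\<^sup>2"
  have J: "0 \<le> J x" "(J x)\<^sup>2 \<le> inverse (r ^ CARD('n)) * ?N"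
    "integral (cbox a b) (\<lambda>x. (J x)\<^sup>2) \<le> ?N" "continuous_on UNIV J" for x a b
    unfolding J_def by (rule cube_average_bounds[OF G K(1) _ r]; simp add: K(2))+
  have N0: "0 \<le> ?N" by simp
  let ?m = "inverse (r ^ CARD('n)) * ?N"
  have m0: "0 \<le> ?m" using r N0 by simp
  have p: "J x powr k \<le> ?m powr ((k - 2) / 2) * (J x)\<^sup>2" for x
  proof (cases "J x = 0")
    case False
    then have j: "0 < J x" using J(1)[of x] by linarith
    have "J x powr k = J x powr (k - 2) * J x powr 2"
      by (simp add: powr_add[symmetric])
    also have "J x powr 2 = (J x)\<^sup>2" using j by simp
    also have "J x powr (k - 2) = ((J x)\<^sup>2) powr ((k - 2) / 2)"
    proof -
      have "((J x)\<^sup>2) powr ((k - 2) / 2) = (J x powr 2) powr ((k - 2) / 2)" using j by simp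
      also have "\<dots> = J x powr (2 * ((k - 2) / 2))" by (rule powr_powr)
      also have "2 * ((k - 2) / 2) = k - 2" by simp
      finally show ?thesis by simp
    qed
    also have "\<dots> \<le> ?m powr ((k - 2) / 2)"
      using J(2)[of x] j k by (intro powr_mono2) auto
    finally show ?thesis by (simp add: mult_right_mono)
  qed (use m0 in simp)
  have ck: "continuous_on U (\<lambda>x. J x powr k)" for U
    using k continuous_on_subset[OF J(4)]
    by (intro continuous_on_powr' continuous_intros) (auto simp: J(1))
  have "integral (cbox a b) (\<lambda>x. J x powr k) \<le> integral (cbox a b) (\<lambda>x. ?m powr ((k - 2) / 2) * (J x)\<^sup>2)"
    using p continuous_on_subset[OF J(4)]
    by (intro integral_le integrable_continuous ck continuous_intros) auto
  also have "\<dots> \<le> ?m powr ((k - 2) / 2) * ?N"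
    using J(3)[of a b] by (simp add: mult_left_mono)
  finally have "integral (cbox a b) (\<lambda>x. J x powr k) powr (1 / k) \<le> (?m powr ((k - 2) / 2) * ?N) powr (1 / k)"
    using k by (intro powr_mono2 integral_nonneg integrable_continuous ck) auto
  also have "\<dots> = r powr (- (real CARD('n) * (1/2 - 1/k))) * sqrt ?N"
  proof (cases "?N = 0")
    case False
    then have N: "0 < ?N" using N0 by linarith
    have "?m powr ((k - 2) / 2) * ?N = (r powr (- real CARD('n))) powr ((k - 2) / 2) * (?N powr ((k - 2) / 2) * ?N powr 1)"
      using r N by (simp add: powr_mult powr_minus powr_realpow)
    also have "\<dots> = r powr (- real CARD('n) * ((k - 2) / 2)) * ?N powr (k / 2)"
      by (simp only: powr_powr powr_add[symmetric]) (simp add: field_simps)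
    also have "\<dots> powr (1 / k) = r powr (- real CARD('n) * ((k - 2) / 2) * (1 / k)) * ?N powr (k / 2 * (1 / k))"
      by (simp add: powr_mult powr_powr)
    also have "- real CARD('n) * ((k - 2) / 2) * (1 / k) = - (real CARD('n) * (1/2 - 1/k))"
      using k by (simp add: field_simps)
    also have "k / 2 * (1 / k) = 1 / 2" using k by simp
    finally show ?thesis using N by (simp add: powr_half_sqrt)
  qed simp
  finally show ?thesis .
qed

lemma LINT_on_eq_integral_cbox:
  fixes f :: "'a::euclidean_space \<Rightarrow> real"
  assumes "continuous_on UNIV f" "open \<Omega>" "\<Omega> \<subseteq> cbox a b" "\<And>x. x \<notin> \<Omega> \<Longrightarrow> f x = 0"
  shows "(LINT x|lebesgue_on \<Omega>. f x) = integral (cbox a b) f"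
proof -
  have "(LINT x|lebesgue_on \<Omega>. f x) = (LINT x|lborel. f x)"
    using assms by (intro integral_lebesgue_on_eq_lborel) auto
  also have "\<dots> = (LINT x|lebesgue_on (cbox a b). f x)"
    using assms by (intro integral_lebesgue_on_eq_lborel(1)[symmetric]) auto
  also have "\<dots> = integral (cbox a b) f"
    by (intro lebesgue_integral_eq_integral continuous_imp_integrable continuous_on_subset[OF assms(1)]) auto
  finally show ?thesis .
qed

lemma test_fun_ray_bound:
  assumes phi: "\<phi> \<in> test_fun \<Omega>" and R: "\<And>x. x \<in> \<Omega> \<Longrightarrow> norm x < R" and x: "x \<in> \<Omega>"
  shows "\<bar>\<phi> x\<bar> \<le> 2 * real CARD('n) *
    integral {0..2 * R} (\<lambda>r. integral (cbox (vec 1) (vec 2 :: real^'n::finite)) (\<lambda>y. norm (grad \<phi> (x + r *\<^sub>R y))))"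
proof -
  let ?Y = "cbox (vec 1) (vec 2) :: (real^'n) set" and ?T = "2 * R" and ?c = "2 * real CARD('n)"
  let ?G = "\<lambda>x. norm (grad \<phi> x)"
  have s: "smooth \<phi>" using test_funD[OF phi] by simp
  have R0: "0 \<le> ?T" using R[OF x] norm_ge_zero[of x] by linarith
  have mY: "measure lborel ?Y = 1"
    by (subst content_cbox_cart) (auto simp: interval_ne_empty_cart)
  have cG: "continuous_on U ?G" for U by (intro continuous_intros smooth_grad_continuous s)
  have cr: "continuous_on U (\<lambda>r. ?G (x + r *\<^sub>R y))" for U y
    by (intro continuous_on_norm continuous_on_compose2[OF smooth_grad_continuous[OF s, of UNIV]] continuous_intros) auto
  have bd: "\<bar>\<phi> x\<bar> \<le> ?c * integral {0..?T} (\<lambda>r. ?G (x + r *\<^sub>R y))" if y: "y \<in> ?Y" for y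
  proof -
    have yi: "1 \<le> y $ i" "y $ i \<le> 2" for i using y by (auto simp: mem_box_cart)
    have y1: "1 \<le> norm y" using component_le_norm_cart[of y undefined] yi(1)[of undefined] by linarith
    \<comment> \<open>Origin of the factor \<open>?c\<close>: on the cube the l1 norm of y is at
      most twice the dimension.\<close>
    have "norm y \<le> (\<Sum>i\<in>UNIV. \<bar>y $ i\<bar>)" by (rule norm_le_l1_cart)
    also have "\<dots> \<le> (\<Sum>i\<in>(UNIV::'n set). 2)"
    proof (rule sum_mono)
      fix i show "\<bar>y $ i\<bar> \<le> 2" using yi[of i] by simp
    qed
    finally have y2: "norm y \<le> ?c" by simp
    \<comment> \<open>All coordinates of y are at least 1, hence so is its norm; from a point of the
      ball of radius R, a displacement of length at least 2 R leads out of that ball.\<close>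
    have "x + ?T *\<^sub>R y \<notin> \<Omega>"
    proof
      assume "x + ?T *\<^sub>R y \<in> \<Omega>"
      then have "norm (x + ?T *\<^sub>R y) < R" by (rule R)
      moreover have "norm (?T *\<^sub>R y) \<le> norm (x + ?T *\<^sub>R y) + norm x"
        using norm_triangle_ineq4[of "x + ?T *\<^sub>R y" x] by simp
      moreover have "norm (?T *\<^sub>R y) \<ge> ?T * 1" using y1 R0 by (simp only: norm_scaleR abs_of_nonneg mult_left_mono)
      ultimately show False using R[OF x] by simp
    qed
    then have z: "\<phi> (x + ?T *\<^sub>R y) = 0" using test_funD(2)[OF phi] by blast
    have d: "((\<lambda>r. \<phi> (x + r *\<^sub>R y)) has_vector_derivative grad \<phi> (x + r *\<^sub>R y) \<bullet> y) (at r within {0..?T})" for r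
      using has_derivative_along_axis[OF smooth_differentiable[OF s], of x y r]
      by (simp add: frechet_derivative_eq_grad[OF s] has_real_derivative_iff_has_vector_derivative
          has_vector_derivative_at_within)
    have "((\<lambda>r. grad \<phi> (x + r *\<^sub>R y) \<bullet> y) has_integral \<phi> (x + ?T *\<^sub>R y) - \<phi> (x + 0 *\<^sub>R y)) {0..?T}"
      by (rule fundamental_theorem_of_calculus[OF R0 d])
    then have h: "((\<lambda>r. grad \<phi> (x + r *\<^sub>R y) \<bullet> y) has_integral - \<phi> x) {0..?T}" using z by simp
    have "norm (integral {0..?T} (\<lambda>r. grad \<phi> (x + r *\<^sub>R y) \<bullet> y)) \<le> integral {0..?T} (\<lambda>r. ?c * ?G (x + r *\<^sub>R y))"
    proof (rule integral_norm_bound_integral)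
      show "(\<lambda>r. ?c * ?G (x + r *\<^sub>R y)) integrable_on {0..?T}"
        by (intro integrable_continuous_real continuous_intros cr)
      fix r
      have "norm (grad \<phi> (x + r *\<^sub>R y) \<bullet> y) \<le> ?G (x + r *\<^sub>R y) * norm y"
        using Cauchy_Schwarz_ineq2 by simp
      also have "\<dots> \<le> ?G (x + r *\<^sub>R y) * ?c" using y2 by (intro mult_left_mono) auto
      finally show "norm (grad \<phi> (x + r *\<^sub>R y) \<bullet> y) \<le> ?c * ?G (x + r *\<^sub>R y)" by (simp only: mult.commute)
    qed (use h in blast)
    then show ?thesis using integral_unique[OF h] by simp
  qed
  have c2: "continuous_on U (\<lambda>(y, r). ?G (x + r *\<^sub>R y))" for U
    unfolding split_beta by (intro continuous_on_norm continuous_on_compose2[OF smooth_grad_continuous[OF s, of UNIV]] continuous_intros) auto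
  have cI: "continuous_on U (\<lambda>y. integral {0..?T} (\<lambda>r. ?G (x + r *\<^sub>R y)))" for U
    using integral_continuous_on_param[of U 0 ?T "\<lambda>y r. ?G (x + r *\<^sub>R y)"] c2 by simp
  have "\<bar>\<phi> x\<bar> = integral ?Y (\<lambda>y. \<bar>\<phi> x\<bar>)" using mY by simp
  also have "\<dots> \<le> integral ?Y (\<lambda>y. ?c * integral {0..?T} (\<lambda>r. ?G (x + r *\<^sub>R y)))"
    using bd by (intro integral_le integrable_continuous continuous_intros cI) auto
  also have "\<dots> = ?c * integral ?Y (\<lambda>y. integral {0..?T} (\<lambda>r. ?G (x + r *\<^sub>R y)))" by simp
  also have "integral ?Y (\<lambda>y. integral {0..?T} (\<lambda>r. ?G (x + r *\<^sub>R y)))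
      = integral {0..?T} (\<lambda>r. integral ?Y (\<lambda>y. ?G (x + r *\<^sub>R y)))"
    using integral_swap_continuous[OF c2, of "vec 1" "vec 2" 0 ?T] by simp
  finally show ?thesis .
qed

text \<open>Duality takes the place of Minkowski's inequality for integrals: the ray bound is
  multiplied by |\<phi>|^(k-1), the integrals are exchanged, and Hoelder is applied for each r. With
  S the integral of |\<phi>|^k this gives S \<le> S^(1-1/k) C |grad \<phi>|, from which the power of
  S is cancelled.\<close>

lemma test_fun_Sobolev:
  fixes \<Omega> :: "(real^'n::finite) set"
  assumes O: "open \<Omega>" "bounded \<Omega>" and k: "2 \<le> k" "real CARD('n) * (1/2 - 1/k) < 1"
  shows "\<exists>c\<ge>0. \<forall>\<phi>\<in>test_fun \<Omega>. (LINT x|lebesgue_on \<Omega>. \<bar>\<phi> x\<bar> powr k) \<le> c * Lnorm \<Omega> 2 (grad \<phi>) powr k"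
proof -
  let ?\<beta> = "real CARD('n) * (1/2 - 1/k)"
  obtain R where R: "0 < R" "\<And>x. x \<in> \<Omega> \<Longrightarrow> norm x < R"
  proof -
    obtain B where "\<forall>x\<in>\<Omega>. norm x \<le> B" using O(2) by (auto simp: bounded_iff)
    then show ?thesis by (intro that[of "\<bar>B\<bar> + 1"]) fastforce+
  qed
  obtain a where a: "\<Omega> \<subseteq> cbox (- a) a" using O(2) bounded_subset_cbox_symmetric by blast
  let ?D = "cbox (- a) a" and ?T = "2 * R" and ?c = "2 * real CARD('n)"
  let ?I = "?T powr (1 - ?\<beta>) / (1 - ?\<beta>)"
  have I0: "0 \<le> ?I" using k by simp
  have I: "((\<lambda>r. r powr (- ?\<beta>)) has_integral ?I) {0..?T}"
    using has_integral_powr_from_0[of "- ?\<beta>" ?T] R k by simp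
  show ?thesis
  proof (intro exI[of _ "(?c * ?I) powr k"] conjI ballI)
    fix \<phi> assume phi: "\<phi> \<in> test_fun \<Omega>"
    obtain K where K: "compact K" "K \<subseteq> \<Omega>" "\<And>x. x \<notin> K \<Longrightarrow> \<phi> x = 0 \<and> grad \<phi> x = 0"
      using test_funD(2)[OF phi] by blast
    have s: "smooth \<phi>" using test_funD[OF phi] by simp
    let ?G = "\<lambda>x. norm (grad \<phi> x)"
    let ?J = "\<lambda>r x. integral (cbox (vec 1) (vec 2 :: real^'n)) (\<lambda>y. ?G (x + r *\<^sub>R y))"
    let ?N = "LINT x|lborel. (?G x)\<^sup>2"
    let ?S = "integral ?D (\<lambda>x. \<bar>\<phi> x\<bar> powr k)"
    have cG: "continuous_on U ?G" for U by (intro continuous_intros smooth_grad_continuous s)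
    have cp: "continuous_on U \<phi>" for U by (rule smooth_continuous[OF s])
    have cpk: "continuous_on U (\<lambda>x. \<bar>\<phi> x\<bar> powr q)" if "0 < q" for U q
      using that by (intro continuous_on_powr' continuous_intros cp) auto
    have cJ2: "continuous_on U (\<lambda>(x, r). ?J r x)" for U :: "((real^'n) \<times> real) set"
    proof -
      have "continuous_on U (\<lambda>z. integral (cbox (vec 1) (vec 2 :: real^'n)) (\<lambda>y. ?G (fst z + snd z *\<^sub>R y)))"
        by (rule integral_continuous_on_param, unfold split_beta)
          (intro continuous_on_norm continuous_on_compose2[OF smooth_grad_continuous[OF s, of UNIV]] continuous_intros, auto)
      then show ?thesis by (simp add: split_beta)
    qed
    have cJx: "continuous_on U (\<lambda>r. ?J r x)" for U x
    proof -
      have "continuous_on U (\<lambda>r. (x, r))" by (intro continuous_intros)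
      from continuous_on_compose2[OF cJ2[of UNIV] this] show ?thesis by simp
    qed
    have cJr: "continuous_on U (\<lambda>x. ?J r x)" for U r
    proof -
      have "continuous_on U (\<lambda>x. (x, r))" by (intro continuous_intros)
      from continuous_on_compose2[OF cJ2[of UNIV] this] show ?thesis by simp
    qed
    have J0: "0 \<le> ?J r x" for r x
      by (intro integral_nonneg integrable_continuous continuous_on_norm
          continuous_on_compose2[OF smooth_grad_continuous[OF s, of UNIV]] continuous_intros) auto
    have N: "Lnorm \<Omega> 2 (grad \<phi>) = sqrt ?N"
    proof -
      have "(LINT x|lebesgue_on \<Omega>. (?G x)\<^sup>2) = ?N"
        using K O by (intro integral_lebesgue_on_eq_lborel(1) continuous_intros cG) auto
      then show ?thesis by (simp add: Lnorm_2 L2_inner_self)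
    qed
    have LS: "(LINT x|lebesgue_on \<Omega>. \<bar>\<phi> x\<bar> powr k) = ?S"
      using K k a O(1) by (intro LINT_on_eq_integral_cbox cpk) auto
    have S0: "0 \<le> ?S"
      using k by (intro integral_nonneg integrable_continuous cpk) auto
    have hold: "integral ?D (\<lambda>x. \<bar>\<phi> x\<bar> powr (k - 1) * ?J r x)
        \<le> ?S powr (1 - 1/k) * (r powr (- ?\<beta>) * sqrt ?N)" if r: "0 < r" for r
    proof -
      have D: "?D \<in> sets lebesgue" by simp
      have th: "0 < 1 - 1/k" "1 - 1/k < 1" using k by (auto simp: field_simps)
      have iX: "integrable (lebesgue_on ?D) (\<lambda>x. \<bar>\<phi> x\<bar> powr k)"
        using k by (intro continuous_imp_integrable cpk) auto
      have cJk: "continuous_on ?D (\<lambda>x. ?J r x powr k)"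
        by (intro continuous_on_powr' cJr continuous_intros) (use J0 k in auto)
      have iY: "integrable (lebesgue_on ?D) (\<lambda>x. ?J r x powr k)"
        by (rule continuous_imp_integrable[OF cJk])
      have e: "(\<bar>\<phi> x\<bar> powr k) powr (1 - 1/k) * (?J r x powr k) powr (1 - (1 - 1/k))
          = \<bar>\<phi> x\<bar> powr (k - 1) * ?J r x" for x
        using k J0[of x r] by (simp add: powr_powr right_diff_distrib)
      note H = Hoelder_integral[OF iX iY powr_ge_zero powr_ge_zero th, unfolded e]
      have "integral ?D (\<lambda>x. \<bar>\<phi> x\<bar> powr (k - 1) * ?J r x)
          = (LINT x|lebesgue_on ?D. \<bar>\<phi> x\<bar> powr (k - 1) * ?J r x)"
        by (rule lebesgue_integral_eq_integral[OF H(1) D, symmetric])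
      also have "\<dots> \<le> (LINT x|lebesgue_on ?D. \<bar>\<phi> x\<bar> powr k) powr (1 - 1/k) *
          (LINT x|lebesgue_on ?D. ?J r x powr k) powr (1 - (1 - 1/k))"
        by (rule H(2))
      also have "\<dots> = ?S powr (1 - 1/k) * (integral ?D (\<lambda>x. ?J r x powr k)) powr (1/k)"
        using lebesgue_integral_eq_integral[OF iX D] lebesgue_integral_eq_integral[OF iY D] by simp
      also have "\<dots> \<le> ?S powr (1 - 1/k) * (r powr (- ?\<beta>) * sqrt ?N)"
        using K r k cG by (intro mult_left_mono cube_average_Lk_bound[of ?G K]) auto
      finally show ?thesis .
    qed
    have c3: "continuous_on U (\<lambda>(x, r). \<bar>\<phi> x\<bar> powr (k - 1) * ?J r x)" for U :: "((real^'n) \<times> real) set"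
    proof -
      have "continuous_on U (\<lambda>z. \<bar>\<phi> (fst z)\<bar> powr (k - 1) * ?J (snd z) (fst z))"
        using k cJ2[of U]
        by (intro continuous_on_mult continuous_on_compose2[OF cpk[of "k - 1" UNIV]] continuous_intros)
          (auto simp: split_beta)
      then show ?thesis by (simp add: split_beta)
    qed
    have "?S \<le> integral ?D (\<lambda>x. ?c * integral {0..?T} (\<lambda>r. \<bar>\<phi> x\<bar> powr (k - 1) * ?J r x))"
    proof (rule integral_le)
      show "(\<lambda>x. \<bar>\<phi> x\<bar> powr k) integrable_on ?D" using k by (intro integrable_continuous cpk) auto
      have "continuous_on ?D (\<lambda>x. integral {0..?T} (\<lambda>r. \<bar>\<phi> x\<bar> powr (k - 1) * ?J r x))"
        using integral_continuous_on_param[OF c3, of ?D 0 ?T] by simp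
      then show "(\<lambda>x. ?c * integral {0..?T} (\<lambda>r. \<bar>\<phi> x\<bar> powr (k - 1) * ?J r x)) integrable_on ?D"
        by (intro integrable_continuous continuous_intros)
      fix x
      have "\<bar>\<phi> x\<bar> powr k = \<bar>\<phi> x\<bar> powr (k - 1) * \<bar>\<phi> x\<bar>"
        using powr_mult_base[of "\<bar>\<phi> x\<bar>" "k - 1"] k by (cases "\<phi> x = 0") (auto simp: mult.commute)
      also have "\<dots> \<le> \<bar>\<phi> x\<bar> powr (k - 1) * (?c * integral {0..?T} (\<lambda>r. ?J r x))"
      proof (cases "x \<in> \<Omega>")
        case True
        then show ?thesis using test_fun_ray_bound[OF phi R(2) True] by (intro mult_left_mono) auto
      next
        case False
        then have "\<phi> x = 0" using K by blast
        then show ?thesis by simp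
      qed
      also have "\<dots> = ?c * integral {0..?T} (\<lambda>r. \<bar>\<phi> x\<bar> powr (k - 1) * ?J r x)" by simp
      finally show "\<bar>\<phi> x\<bar> powr k \<le> \<dots>" .
    qed
    also have "\<dots> = ?c * integral ?D (\<lambda>x. integral {0..?T} (\<lambda>r. \<bar>\<phi> x\<bar> powr (k - 1) * ?J r x))" by simp
    also have "integral ?D (\<lambda>x. integral {0..?T} (\<lambda>r. \<bar>\<phi> x\<bar> powr (k - 1) * ?J r x))
        = integral {0..?T} (\<lambda>r. integral ?D (\<lambda>x. \<bar>\<phi> x\<bar> powr (k - 1) * ?J r x))"
      using integral_swap_continuous[OF c3, of "- a" a 0 ?T] by simp
    also have "\<dots> \<le> ?S powr (1 - 1/k) * (?I * sqrt ?N)"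
    proof -
      let ?W = "\<lambda>r. integral ?D (\<lambda>x. \<bar>\<phi> x\<bar> powr (k - 1) * ?J r x)"
      \<comment> \<open>The estimate \<open>hold\<close> is for r > 0, so the majorant is changed at
        the single point r = 0.\<close>
      let ?w = "\<lambda>r. if r = 0 then ?W 0 else ?S powr (1 - 1/k) * (r powr (- ?\<beta>) * sqrt ?N)"
      have "((\<lambda>r. ?S powr (1 - 1/k) * (r powr (- ?\<beta>) * sqrt ?N)) has_integral
          ?S powr (1 - 1/k) * (?I * sqrt ?N)) {0..?T}"
        by (intro has_integral_mult_right has_integral_mult_left I)
      then have w: "(?w has_integral ?S powr (1 - 1/k) * (?I * sqrt ?N)) {0..?T}"
        by (rule has_integral_spike_finite[of "{0}", rotated 2]) auto
      have "continuous_on {0..?T} ?W"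
        using integral_continuous_on_param[of "{0..?T}" "- a" a "\<lambda>r x. \<bar>\<phi> x\<bar> powr (k - 1) * ?J r x"]
          continuous_on_compose2[OF c3[of UNIV] continuous_on_swap[of "{0..?T} \<times> ?D"]]
        by (simp add: split_beta)
      then have W: "(?W has_integral integral {0..?T} ?W) {0..?T}"
        by (intro integrable_integral integrable_continuous_real)
      show ?thesis
        by (rule has_integral_le[OF W w]) (use hold in auto)
    qed
    finally have "?S \<le> ?c * (?S powr (1 - 1/k) * (?I * sqrt ?N))" by simp
    then have main: "?S \<le> ?S powr (1 - 1/k) * (?c * ?I * sqrt ?N)" by (simp only: mult.assoc mult.left_commute)
    have "?S \<le> (?c * ?I) powr k * sqrt ?N powr k"
    proof (cases "?S = 0")
      case False
      then have Sp: "0 < ?S" using S0 by linarith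
      have "?S = ?S powr (1 - 1/k) * ?S powr (1/k)" using Sp by (simp add: powr_add[symmetric])
      then have "?S powr (1 - 1/k) * ?S powr (1/k) \<le> ?S powr (1 - 1/k) * (?c * ?I * sqrt ?N)" using main by simp
      then have "?S powr (1/k) \<le> ?c * ?I * sqrt ?N" by (rule mult_left_le_imp_le) (use Sp in simp)
      then have "(?S powr (1/k)) powr k \<le> (?c * ?I * sqrt ?N) powr k" using k by (intro powr_mono2) auto
      moreover have "(?S powr (1/k)) powr k = ?S" using Sp k by (simp add: powr_powr)
      ultimately show ?thesis by (simp only: powr_mult)
    qed simp
    then show "(LINT x|lebesgue_on \<Omega>. \<bar>\<phi> x\<bar> powr k) \<le> (?c * ?I) powr k * Lnorm \<Omega> 2 (grad \<phi>) powr k"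
      unfolding LS N .
  qed simp
qed

section \<open>The space \<open>H\<^sub>0\<^sup>1\<close>\<close>

lemma H1_wgrad:
  assumes "v \<in> H1 \<Omega>"
  shows "v \<in> L2 \<Omega>" "wgrad \<Omega> v \<in> L2 \<Omega>" "is_weak_grad \<Omega> v (wgrad \<Omega> v)"
proof -
  have "\<exists>G. G \<in> L2 \<Omega> \<and> is_weak_grad \<Omega> v G" and "v \<in> L2 \<Omega>"
    using assms by (auto simp: H1_def)
  then show "v \<in> L2 \<Omega>" "wgrad \<Omega> v \<in> L2 \<Omega>" "is_weak_grad \<Omega> v (wgrad \<Omega> v)"
    unfolding wgrad_def by (simp_all add: someI_ex[of "\<lambda>G. G \<in> L2 \<Omega> \<and> is_weak_grad \<Omega> v G", THEN conjunct1]
      someI_ex[of "\<lambda>G. G \<in> L2 \<Omega> \<and> is_weak_grad \<Omega> v G", THEN conjunct2])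
qed

lemma is_weak_grad_diff:
  fixes \<Omega> :: "(real^'n::finite) set"
  assumes O: "open \<Omega>" and "v \<in> L2 \<Omega>" "w \<in> L2 \<Omega>" "G \<in> L2 \<Omega>" "G' \<in> L2 \<Omega>"
    "is_weak_grad \<Omega> v G" "is_weak_grad \<Omega> w G'"
  shows "is_weak_grad \<Omega> (\<lambda>x. v x - w x) (\<lambda>x. G x - G' x)"
  unfolding is_weak_grad_def
proof (intro ballI allI)
  fix \<phi> i assume phi: "\<phi> \<in> test_fun \<Omega>"
  have p: "partial_deriv i \<phi> \<in> L2 \<Omega>"
    using L2_component[OF test_fun_L2(2)[OF O phi], of i] by (simp add: grad_def)
  note f = test_fun_L2(1)[OF O phi]
  have "integrable (lebesgue_on \<Omega>) (\<lambda>x. v x * partial_deriv i \<phi> x)"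
    "integrable (lebesgue_on \<Omega>) (\<lambda>x. w x * partial_deriv i \<phi> x)"
    "integrable (lebesgue_on \<Omega>) (\<lambda>x. G x $ i * \<phi> x)" "integrable (lebesgue_on \<Omega>) (\<lambda>x. G' x $ i * \<phi> x)"
    using L2_inner_integrable[OF assms(2) p] L2_inner_integrable[OF assms(3) p]
      L2_inner_integrable[OF L2_component[OF assms(4)] f] L2_inner_integrable[OF L2_component[OF assms(5)] f]
    by simp_all
  then show "(LINT x|lebesgue_on \<Omega>. (v x - w x) * partial_deriv i \<phi> x) =
      - (LINT x|lebesgue_on \<Omega>. (G x - G' x) $ i * \<phi> x)"
    using assms(6,7) phi by (simp add: is_weak_grad_def left_diff_distrib)
qed

lemma H1_diff:
  fixes \<Omega> :: "(real^'n::finite) set"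
  assumes O: "open \<Omega>" "bounded \<Omega>" and v: "v \<in> H1 \<Omega>" and w: "w \<in> H1 \<Omega>"
  shows "(\<lambda>x. v x - w x) \<in> H1 \<Omega>"
    and "AE x in lebesgue_on \<Omega>. wgrad \<Omega> (\<lambda>x. v x - w x) x = wgrad \<Omega> v x - wgrad \<Omega> w x"
proof -
  note vw = H1_wgrad[OF v] H1_wgrad[OF w]
  have g: "is_weak_grad \<Omega> (\<lambda>x. v x - w x) (\<lambda>x. wgrad \<Omega> v x - wgrad \<Omega> w x)"
    using vw by (intro is_weak_grad_diff O)
  have l: "(\<lambda>x. wgrad \<Omega> v x - wgrad \<Omega> w x) \<in> L2 \<Omega>" using vw by (intro L2_diff)
  show h: "(\<lambda>x. v x - w x) \<in> H1 \<Omega>"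
    using vw l g unfolding H1_def by (auto intro!: L2_diff)
  show "AE x in lebesgue_on \<Omega>. wgrad \<Omega> (\<lambda>x. v x - w x) x = wgrad \<Omega> v x - wgrad \<Omega> w x"
    using H1_wgrad[OF h] l g by (intro weak_grad_unique[OF O]) auto
qed

lemma test_fun_H1:
  fixes \<Omega> :: "(real^'n::finite) set"
  assumes O: "open \<Omega>" "bounded \<Omega>" and phi: "\<phi> \<in> test_fun \<Omega>"
  shows "\<phi> \<in> H1 \<Omega>" "AE x in lebesgue_on \<Omega>. wgrad \<Omega> \<phi> x = grad \<phi> x"
proof -
  note p = test_fun_L2[OF O(1) phi] test_fun_weak_grad[OF O(1) phi]
  show h: "\<phi> \<in> H1 \<Omega>" using p by (auto simp: H1_def)
  show "AE x in lebesgue_on \<Omega>. wgrad \<Omega> \<phi> x = grad \<phi> x"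
    using H1_wgrad[OF h] p by (intro weak_grad_unique[OF O]) auto
qed

lemma H1_norm_bounds:
  "Lnorm \<Omega> 2 v \<le> H1_norm \<Omega> v" "Lnorm \<Omega> 2 (wgrad \<Omega> v) \<le> H1_norm \<Omega> v"
  "H1_norm \<Omega> v \<le> Lnorm \<Omega> 2 v + Lnorm \<Omega> 2 (wgrad \<Omega> v)"
  unfolding H1_norm_def
  by (auto intro!: real_le_rsqrt sqrt_sum_squares_le_sum Lnorm_nonneg)

lemma H1_norm_tendsto_0_iff:
  "((\<lambda>k. H1_norm \<Omega> (f k)) \<longlongrightarrow> 0) F \<longleftrightarrow>
    ((\<lambda>k. Lnorm \<Omega> 2 (f k)) \<longlongrightarrow> 0) F \<and> ((\<lambda>k. Lnorm \<Omega> 2 (wgrad \<Omega> (f k))) \<longlongrightarrow> 0) F"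
proof (intro iffI conjI; (elim conjE)?)
  assume h: "((\<lambda>k. H1_norm \<Omega> (f k)) \<longlongrightarrow> 0) F"
  show "((\<lambda>k. Lnorm \<Omega> 2 (f k)) \<longlongrightarrow> 0) F" "((\<lambda>k. Lnorm \<Omega> 2 (wgrad \<Omega> (f k))) \<longlongrightarrow> 0) F"
    by (rule tendsto_sandwich[OF _ _ tendsto_const h]; simp add: Lnorm_nonneg H1_norm_bounds)+
next
  assume "((\<lambda>k. Lnorm \<Omega> 2 (f k)) \<longlongrightarrow> 0) F" "((\<lambda>k. Lnorm \<Omega> 2 (wgrad \<Omega> (f k))) \<longlongrightarrow> 0) F"
  then have s: "((\<lambda>k. Lnorm \<Omega> 2 (f k) + Lnorm \<Omega> 2 (wgrad \<Omega> (f k))) \<longlongrightarrow> 0) F"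
    using tendsto_add by fastforce
  have "0 \<le> H1_norm \<Omega> v" for v by (simp add: H1_norm_def)
  then show "((\<lambda>k. H1_norm \<Omega> (f k)) \<longlongrightarrow> 0) F"
    by (intro tendsto_sandwich[OF _ _ tendsto_const s]) (simp_all add: H1_norm_bounds)
qed

lemma Lnorm_wgrad_diff:
  fixes \<Omega> :: "(real^'n::finite) set"
  assumes "open \<Omega>" "bounded \<Omega>" "v \<in> H1 \<Omega>" "w \<in> H1 \<Omega>"
  shows "Lnorm \<Omega> 2 (wgrad \<Omega> (\<lambda>x. v x - w x)) = Lnorm \<Omega> 2 (\<lambda>x. wgrad \<Omega> v x - wgrad \<Omega> w x)"
  using H1_diff[OF assms] assms(3,4)
  by (intro Lnorm_2_cong_AE L2_diff H1_wgrad) auto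

text \<open>\<open>wgrad\<close> of a test function agrees with its classical gradient only almost
  everywhere. The exchange is made here once, so that later limits can work with
  \<open>grad\<close>.\<close>

lemma H10_approx:
  fixes \<Omega> :: "(real^'n::finite) set"
  assumes O: "open \<Omega>" "bounded \<Omega>" and v: "v \<in> H10 \<Omega>"
  obtains \<phi> where "\<And>k::nat. \<phi> k \<in> test_fun \<Omega>"
    "(\<lambda>k. Lnorm \<Omega> 2 (\<lambda>x. \<phi> k x - v x)) \<longlonglongrightarrow> 0"
    "(\<lambda>k. Lnorm \<Omega> 2 (\<lambda>x. grad (\<phi> k) x - wgrad \<Omega> v x)) \<longlonglongrightarrow> 0"
proof -
  obtain \<phi> where p: "\<And>k::nat. \<phi> k \<in> test_fun \<Omega>" and l: "(\<lambda>k. H1_norm \<Omega> (\<lambda>x. \<phi> k x - v x)) \<longlonglongrightarrow> 0"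
    and v1: "v \<in> H1 \<Omega>"
    using v unfolding H10_def by blast
  have e: "Lnorm \<Omega> 2 (wgrad \<Omega> (\<lambda>x. \<phi> k x - v x)) = Lnorm \<Omega> 2 (\<lambda>x. grad (\<phi> k) x - wgrad \<Omega> v x)" for k
  proof -
    note t = test_fun_H1[OF O p[of k]]
    have "AE x in lebesgue_on \<Omega>. wgrad \<Omega> (\<lambda>x. \<phi> k x - v x) x = grad (\<phi> k) x - wgrad \<Omega> v x"
      using H1_diff(2)[OF O t(1) v1] t(2) by eventually_elim simp
    then show ?thesis
      using H1_wgrad[OF H1_diff(1)[OF O t(1) v1]] H1_wgrad[OF v1] test_fun_L2[OF O(1) p]
      by (intro Lnorm_2_cong_AE L2_diff) auto
  qed
  note l' = l[unfolded H1_norm_tendsto_0_iff e]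
  show ?thesis by (rule that[of \<phi>]) (use p l' in auto)
qed

lemma H10_H1: "v \<in> H10 \<Omega> \<Longrightarrow> v \<in> H1 \<Omega>"
  by (simp add: H10_def)

lemma H10_L2: "v \<in> H10 \<Omega> \<Longrightarrow> v \<in> L2 \<Omega>" "v \<in> H10 \<Omega> \<Longrightarrow> wgrad \<Omega> v \<in> L2 \<Omega>"
  using H1_wgrad H10_H1 by blast+

lemma H10_diff:
  fixes \<Omega> :: "(real^'n::finite) set"
  assumes O: "open \<Omega>" "bounded \<Omega>" and v: "v \<in> H10 \<Omega>" and w: "w \<in> H10 \<Omega>"
  shows "(\<lambda>x. v x - w x) \<in> H10 \<Omega>"
proof -
  obtain \<phi> where p: "\<And>k::nat. \<phi> k \<in> test_fun \<Omega>" and lp: "(\<lambda>k. H1_norm \<Omega> (\<lambda>x. \<phi> k x - v x)) \<longlonglongrightarrow> 0"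
    using v unfolding H10_def by blast
  obtain \<psi> where q: "\<And>k::nat. \<psi> k \<in> test_fun \<Omega>" and lq: "(\<lambda>k. H1_norm \<Omega> (\<lambda>x. \<psi> k x - w x)) \<longlonglongrightarrow> 0"
    using w unfolding H10_def by blast
  let ?d = "\<lambda>k x. \<phi> k x - \<psi> k x - (v x - w x)"
  have "(\<lambda>k. H1_norm \<Omega> (?d k)) \<longlonglongrightarrow> 0"
  proof (rule tendsto_sandwich[OF _ _ tendsto_const])
    let ?B = "\<lambda>f. Lnorm \<Omega> 2 f + Lnorm \<Omega> 2 (wgrad \<Omega> f)"
    let ?u = "\<lambda>k. ?B (\<lambda>x. \<phi> k x - v x) + ?B (\<lambda>x. \<psi> k x - w x)"
    show "?u \<longlonglongrightarrow> 0"
      using lp lq unfolding H1_norm_tendsto_0_iff by (auto intro!: tendsto_add_zero)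
    show "\<forall>\<^sub>F k in sequentially. 0 \<le> H1_norm \<Omega> (?d k)" by (simp add: H1_norm_def)
    have "H1_norm \<Omega> (?d k) \<le> ?u k" for k
    proof -
      let ?f = "\<lambda>x. \<phi> k x - v x" and ?h = "\<lambda>x. \<psi> k x - w x"
      have fh: "?f \<in> H1 \<Omega>" "?h \<in> H1 \<Omega>"
        using test_fun_H1[OF O] p q H10_H1 v w by (auto intro!: H1_diff[OF O])
      have tri: "Lnorm \<Omega> 2 (\<lambda>x. a x - b x) \<le> Lnorm \<Omega> 2 a + Lnorm \<Omega> 2 b"
        if "a \<in> L2 \<Omega>" "b \<in> L2 \<Omega>" for a b :: "real^'n \<Rightarrow> 'z::euclidean_space"
        using Lnorm_2_triangle[OF that(1) L2_scale[OF that(2), of "-1"]] Lnorm_2_scale[of \<Omega> "-1" b] by simp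
      have e: "?d k = (\<lambda>x. ?f x - ?h x)" by auto
      have "H1_norm \<Omega> (?d k) \<le> ?B (\<lambda>x. ?f x - ?h x)" unfolding e by (rule H1_norm_bounds)
      also have "\<dots> = Lnorm \<Omega> 2 (\<lambda>x. ?f x - ?h x) + Lnorm \<Omega> 2 (\<lambda>x. wgrad \<Omega> ?f x - wgrad \<Omega> ?h x)"
        by (simp only: Lnorm_wgrad_diff[OF O fh])
      also have "\<dots> \<le> (Lnorm \<Omega> 2 ?f + Lnorm \<Omega> 2 ?h) + (Lnorm \<Omega> 2 (wgrad \<Omega> ?f) + Lnorm \<Omega> 2 (wgrad \<Omega> ?h))"
        using H1_wgrad[OF fh(1)] H1_wgrad[OF fh(2)] by (intro add_mono tri)
      finally show ?thesis by simp
    qed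
    then show "\<forall>\<^sub>F k in sequentially. H1_norm \<Omega> (?d k) \<le> ?u k" by simp
  qed
  then show ?thesis
    using p q v w unfolding H10_def
    by (auto intro!: H1_diff[OF O] exI[of _ "\<lambda>k x. \<phi> k x - \<psi> k x"] test_fun_diff)
qed

lemma L2_tendsto_AE_subseq:
  fixes f :: "nat \<Rightarrow> real^'n::finite \<Rightarrow> real"
  assumes "\<And>k. f k \<in> L2 \<Omega>" "v \<in> L2 \<Omega>" "(\<lambda>k. Lnorm \<Omega> 2 (\<lambda>x. f k x - v x)) \<longlonglongrightarrow> 0"
  shows "\<exists>r. strict_mono r \<and> (AE x in lebesgue_on \<Omega>. (\<lambda>k. f (r k) x) \<longlonglongrightarrow> v x)"
proof -
  have "(\<lambda>k. (Lnorm \<Omega> 2 (\<lambda>x. f k x - v x))\<^sup>2) \<longlonglongrightarrow> 0\<^sup>2" by (intro tendsto_power assms)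
  then have "(\<lambda>k. LINT x|lebesgue_on \<Omega>. norm ((f k x - v x)\<^sup>2)) \<longlonglongrightarrow> 0"
    by (simp add: Lnorm_2_sq L2_inner_self)
  then obtain r where r: "strict_mono r" "AE x in lebesgue_on \<Omega>. (\<lambda>k. (f (r k) x - v x)\<^sup>2) \<longlonglongrightarrow> 0"
    using tendsto_L1_AE_subseq[of "lebesgue_on \<Omega>" "\<lambda>k x. (f k x - v x)\<^sup>2"]
      L2_integrable[OF L2_diff[OF assms(1,2)]] by auto
  have "AE x in lebesgue_on \<Omega>. (\<lambda>k. f (r k) x) \<longlonglongrightarrow> v x"
    using r(2)
  proof eventually_elim
    fix x assume "(\<lambda>k. (f (r k) x - v x)\<^sup>2) \<longlonglongrightarrow> 0"
    then have "(\<lambda>k. sqrt ((f (r k) x - v x)\<^sup>2)) \<longlonglongrightarrow> sqrt 0" by (rule tendsto_real_sqrt)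
    then have "(\<lambda>k. f (r k) x - v x) \<longlonglongrightarrow> 0" by (simp add: tendsto_rabs_zero_iff)
    then show "(\<lambda>k. f (r k) x) \<longlonglongrightarrow> v x" by (simp add: LIM_zero_iff)
  qed
  with r(1) show ?thesis by blast
qed

text \<open>Fatou's lemma along an almost everywhere convergent subsequence of test functions. It
  yields the integrability of |v|^k together with the bound; the convergence of the gradients serves
  the right-hand side.\<close>

lemma H10_Sobolev:
  fixes \<Omega> :: "(real^'n::finite) set"
  assumes O: "open \<Omega>" "bounded \<Omega>" and k: "2 \<le> k" "real CARD('n) * (1/2 - 1/k) < 1"
  shows "\<exists>c\<ge>0. \<forall>v\<in>H10 \<Omega>. integrable (lebesgue_on \<Omega>) (\<lambda>x. \<bar>v x\<bar> powr k) \<and>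
    (LINT x|lebesgue_on \<Omega>. \<bar>v x\<bar> powr k) \<le> c * Lnorm \<Omega> 2 (wgrad \<Omega> v) powr k"
proof -
  obtain c where c: "0 \<le> c" "\<And>\<phi>. \<phi> \<in> test_fun \<Omega> \<Longrightarrow>
      (LINT x|lebesgue_on \<Omega>. \<bar>\<phi> x\<bar> powr k) \<le> c * Lnorm \<Omega> 2 (grad \<phi>) powr k"
    using test_fun_Sobolev[OF O k] by blast
  show ?thesis
  proof (intro exI[of _ c] conjI ballI c(1))
    fix v assume v: "v \<in> H10 \<Omega>"
    obtain \<phi> where p: "\<And>k::nat. \<phi> k \<in> test_fun \<Omega>"
      and l0: "(\<lambda>k. Lnorm \<Omega> 2 (\<lambda>x. \<phi> k x - v x)) \<longlonglongrightarrow> 0"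
      and l1: "(\<lambda>k. Lnorm \<Omega> 2 (\<lambda>x. grad (\<phi> k) x - wgrad \<Omega> v x)) \<longlonglongrightarrow> 0"
      using H10_approx[OF O v] by blast
    note pL = test_fun_L2[OF O(1) p] and vL = H10_L2[OF v]
    obtain r where r: "strict_mono r" "AE x in lebesgue_on \<Omega>. (\<lambda>k. \<phi> (r k) x) \<longlonglongrightarrow> v x"
      using L2_tendsto_AE_subseq[OF pL(1) vL(1) l0] by blast
    let ?b = "\<lambda>j. Lnorm \<Omega> 2 (grad (\<phi> (r j)))" and ?bv = "Lnorm \<Omega> 2 (wgrad \<Omega> v)"
    have "(\<lambda>j. Lnorm \<Omega> 2 (grad (\<phi> j)) - ?bv) \<longlonglongrightarrow> 0"
      by (rule Lim_null_comparison[OF _ l1])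
        (simp add: Lnorm_2_diff_bound[OF pL(2) vL(2)])
    then have "(\<lambda>j. Lnorm \<Omega> 2 (grad (\<phi> j))) \<longlonglongrightarrow> ?bv" by (simp add: LIM_zero_iff)
    then have b: "?b \<longlonglongrightarrow> ?bv" using LIMSEQ_subseq_LIMSEQ[OF _ r(1)] by (simp add: o_def)
    have blim: "(\<lambda>j. c * ?b j powr k) \<longlonglongrightarrow> c * ?bv powr k"
      using k by (intro tendsto_mult tendsto_const tendsto_powr2 b) (auto simp: Lnorm_nonneg)
    have meas: "(\<lambda>x. \<bar>f x\<bar> powr k) \<in> borel_measurable (lebesgue_on \<Omega>)" if "f \<in> L2 \<Omega>" for f :: "real^'n \<Rightarrow> real"
      using L2_measurable[OF that] by measurable
    have ptint: "integrable (lebesgue_on \<Omega>) (\<lambda>x. \<bar>\<phi> j x\<bar> powr k)" for j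
    proof -
      obtain K where K: "compact K" "K \<subseteq> \<Omega>" "\<And>x. x \<notin> K \<Longrightarrow> \<phi> j x = 0"
        using test_funD(2)[OF p[of j]] by blast
      have ct: "continuous_on UNIV (\<lambda>x. \<bar>\<phi> j x\<bar> powr k)"
        using k by (intro continuous_on_powr' continuous_intros smooth_continuous test_funD(1)[OF p]) auto
      show ?thesis
        using K O integrable_continuous_compact_support[OF ct K(1)]
        by (subst integral_lebesgue_on_eq_lborel(2)[OF ct]) auto
    qed
    have "(\<integral>\<^sup>+x. ennreal (\<bar>v x\<bar> powr k) \<partial>lebesgue_on \<Omega>)
        = (\<integral>\<^sup>+x. liminf (\<lambda>j. ennreal (\<bar>\<phi> (r j) x\<bar> powr k)) \<partial>lebesgue_on \<Omega>)"
    proof (rule nn_integral_cong_AE)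
      show "AE x in lebesgue_on \<Omega>. ennreal (\<bar>v x\<bar> powr k) = liminf (\<lambda>j. ennreal (\<bar>\<phi> (r j) x\<bar> powr k))"
        using r(2)
      proof eventually_elim
        fix x assume "(\<lambda>j. \<phi> (r j) x) \<longlonglongrightarrow> v x"
        then have "(\<lambda>j. ennreal (\<bar>\<phi> (r j) x\<bar> powr k)) \<longlonglongrightarrow> ennreal (\<bar>v x\<bar> powr k)"
          using k by (intro tendsto_ennrealI tendsto_powr2 tendsto_rabs tendsto_const) auto
        then show "ennreal (\<bar>v x\<bar> powr k) = liminf (\<lambda>j. ennreal (\<bar>\<phi> (r j) x\<bar> powr k))"
          by (intro lim_imp_Liminf[symmetric]) auto
      qed
    qed
    also have "\<dots> \<le> liminf (\<lambda>j. \<integral>\<^sup>+x. ennreal (\<bar>\<phi> (r j) x\<bar> powr k) \<partial>lebesgue_on \<Omega>)"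
      by (intro nn_integral_liminf measurable_compose[OF meas[OF pL(1)] measurable_ennreal])
    also have "\<dots> \<le> liminf (\<lambda>j. ennreal (c * ?b j powr k))"
    proof (rule Liminf_mono, intro always_eventually allI)
      fix j
      have "(\<integral>\<^sup>+x. ennreal (\<bar>\<phi> (r j) x\<bar> powr k) \<partial>lebesgue_on \<Omega>) =
          ennreal (LINT x|lebesgue_on \<Omega>. \<bar>\<phi> (r j) x\<bar> powr k)"
        by (intro nn_integral_eq_integral ptint) simp
      also have "\<dots> \<le> ennreal (c * ?b j powr k)" by (intro ennreal_leI c p)
      finally show "(\<integral>\<^sup>+x. ennreal (\<bar>\<phi> (r j) x\<bar> powr k) \<partial>lebesgue_on \<Omega>) \<le> ennreal (c * ?b j powr k)" .
    qed
    also have "\<dots> = ennreal (c * ?bv powr k)"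
      by (intro lim_imp_Liminf tendsto_ennrealI blim) simp
    finally have nn: "(\<integral>\<^sup>+x. ennreal (\<bar>v x\<bar> powr k) \<partial>lebesgue_on \<Omega>) \<le> ennreal (c * ?bv powr k)" .
    show i: "integrable (lebesgue_on \<Omega>) (\<lambda>x. \<bar>v x\<bar> powr k)"
      using nn by (intro integrableI_nonneg meas vL) (auto simp: le_less_trans)
    have "ennreal (LINT x|lebesgue_on \<Omega>. \<bar>v x\<bar> powr k) \<le> ennreal (c * ?bv powr k)"
      using nn nn_integral_eq_integral[OF i] by simp
    then show "(LINT x|lebesgue_on \<Omega>. \<bar>v x\<bar> powr k) \<le> c * ?bv powr k"
      using c(1) by (subst (asm) ennreal_le_iff) auto
  qed
qed

text \<open>\<open>H10_Sobolev\<close> makes the set of admissible constants nonempty, which is what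
  gives \<open>Inf\<close> a meaning here. Dividing by the gradient term shows that the infimum is
  itself admissible; if that term is 0, a single admissible constant already gives the
  claim.\<close>

lemma sobolev_const_bound:
  fixes \<Omega> :: "(real^'n::finite) set"
  assumes O: "open \<Omega>" "bounded \<Omega>" and k: "2 \<le> k" "real CARD('n) * (1/2 - 1/k) < 1"
  shows "0 \<le> sobolev_const \<Omega> k"
    and "v \<in> H10 \<Omega> \<Longrightarrow> (LINT x|lebesgue_on \<Omega>. \<bar>v x\<bar> powr k) \<le> sobolev_const \<Omega> k * Lnorm \<Omega> 2 (wgrad \<Omega> v) powr k"
proof -
  let ?C = "{c. 0 \<le> c \<and> (\<forall>v\<in>H10 \<Omega>. Lnorm \<Omega> k v powr k \<le> c * Lnorm \<Omega> 2 (wgrad \<Omega> v) powr k)}"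
  have e: "Lnorm \<Omega> k v powr k = (LINT x|lebesgue_on \<Omega>. \<bar>v x\<bar> powr k)" for v :: "real^'n \<Rightarrow> real"
  proof -
    have "0 \<le> (LINT x|lebesgue_on \<Omega>. \<bar>v x\<bar> powr k)" by simp
    then show ?thesis using k by (simp add: Lnorm_def powr_powr)
  qed
  obtain c where "c \<in> ?C" using H10_Sobolev[OF O k] unfolding e by blast
  then have ne: "?C \<noteq> {}" by blast
  show "0 \<le> sobolev_const \<Omega> k"
    unfolding sobolev_const_def by (rule cInf_greatest[OF ne]) simp
  assume v: "v \<in> H10 \<Omega>"
  let ?g = "Lnorm \<Omega> 2 (wgrad \<Omega> v) powr k"
  show "(LINT x|lebesgue_on \<Omega>. \<bar>v x\<bar> powr k) \<le> sobolev_const \<Omega> k * ?g"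
  proof (cases "?g = 0")
    case True
    then show ?thesis using \<open>c \<in> ?C\<close> v unfolding e by fastforce
  next
    case False
    then have g: "0 < ?g" by (simp add: less_le)
    have "(LINT x|lebesgue_on \<Omega>. \<bar>v x\<bar> powr k) / ?g \<le> sobolev_const \<Omega> k"
      unfolding sobolev_const_def
    proof (rule cInf_greatest[OF ne])
      fix d assume "d \<in> ?C"
      then show "(LINT x|lebesgue_on \<Omega>. \<bar>v x\<bar> powr k) / ?g \<le> d"
        using v g unfolding e by (simp add: pos_divide_le_eq)
    qed
    then show ?thesis using g by (simp add: pos_divide_le_eq)
  qed
qed

text \<open>The exponent k = 2, for which the dimension condition of \<open>H10_Sobolev\<close>
  reads 0 < 1.\<close>

lemma H10_Poincare:
  fixes \<Omega> :: "(real^'n::finite) set"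
  assumes O: "open \<Omega>" "bounded \<Omega>"
  shows "\<exists>c\<ge>0. \<forall>v\<in>H10 \<Omega>. (Lnorm \<Omega> 2 v)\<^sup>2 \<le> c * (Lnorm \<Omega> 2 (wgrad \<Omega> v))\<^sup>2"
proof -
  obtain c where c: "c \<ge> 0" "\<forall>v\<in>H10 \<Omega>. (LINT x|lebesgue_on \<Omega>. \<bar>v x\<bar> powr 2) \<le> c * Lnorm \<Omega> 2 (wgrad \<Omega> v) powr 2"
    using H10_Sobolev[OF O, of 2] by auto
  then show ?thesis
    by (intro exI[of _ c]) (simp add: Lnorm_2_sq L2_inner_self Lnorm_nonneg)
qed

section \<open>Convolutions and the energy identity\<close>

lemma at_within_Ici_eq:
  fixes T B :: real
  assumes "T < B" "0 \<le> T"
  shows "at T within {0..} = at T within {0..B}"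
  by (rule at_within_nhd[of T "{..<B}"]) (use assms in auto)

lemma continuous_on_pair_fst:
  assumes "continuous_on (S \<times> T) (\<lambda>(s, t). f s t)" "t \<in> T"
  shows "continuous_on S (\<lambda>s. f s t)"
proof -
  have "continuous_on S (\<lambda>s. (s, t))" by (intro continuous_intros)
  from continuous_on_compose2[OF assms(1) this] assms(2) show ?thesis by auto
qed

lemma integral_unit_rescale:
  fixes f :: "real \<Rightarrow> real"
  assumes "0 \<le> s" "f integrable_on {0..s}"
  shows "integral {0..s} f = integral {0..1} (\<lambda>\<theta>. s * f (s * \<theta>))"
proof (cases "s = 0")
  case False
  then have s: "0 < s" using assms by simp
  have "(f has_integral integral {0..s} f) {0..s}" using assms by blast
  from has_integral_stretch_real[OF this, of s] s
  have "((\<lambda>\<theta>. f (s * \<theta>)) has_integral (1 / s) * integral {0..s} f) ((\<lambda>x. x / s) ` {0..s})"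
    by simp
  also have "(\<lambda>x. x / s) ` {0..s} = {0..1}"
    using s by (auto simp: image_iff field_simps intro!: bexI[of _ "s * _"])
  finally have "((\<lambda>\<theta>. s * f (s * \<theta>)) has_integral s * ((1 / s) * integral {0..s} f)) {0..1}"
    by (rule has_integral_mult_right)
  then have "integral {0..1} (\<lambda>\<theta>. s * f (s * \<theta>)) = s * ((1 / s) * integral {0..s} f)"
    by (rule integral_unique)
  moreover have "s * ((1 / s) * integral {0..s} f) = integral {0..s} f" using s by simp
  ultimately show ?thesis by (simp only:)
qed simp

text \<open>The interval of integration moves with s. The substitution r = s \<theta> fixes it to
  [0,1], after which continuity in a parameter applies.\<close>

lemma continuous_on_convolution:
  fixes g :: "real \<Rightarrow> real" and A :: "real \<Rightarrow> real \<Rightarrow> real"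
  assumes g: "continuous_on {0..} g" and A: "continuous_on ({0..} \<times> {0..}) (\<lambda>(s, t). A s t)"
  shows "continuous_on ({0..} \<times> {0..}) (\<lambda>(s, t). integral {0..s} (\<lambda>r. g (s - r) * A r t))"
proof -
  have c: "continuous_on (({0..} \<times> {0..}) \<times> {0..1})
      (\<lambda>z. fst (fst z) * (g (fst (fst z) - fst (fst z) * snd z) * A (fst (fst z) * snd z) (snd (fst z))))"
  proof -
    have "continuous_on (({0..} \<times> {0..}) \<times> {0..1}) (\<lambda>z::(real\<times>real)\<times>real. g (fst (fst z) - fst (fst z) * snd z))"
      by (rule continuous_on_compose2[OF g]) (auto intro!: continuous_intros simp: mult_left_le)
    moreover have "continuous_on (({0..} \<times> {0..}) \<times> {0..1})
        (\<lambda>z::(real\<times>real)\<times>real. (\<lambda>(s, t). A s t) (fst (fst z) * snd z, snd (fst z)))"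
      by (rule continuous_on_compose2[OF A]) (auto intro!: continuous_intros)
    ultimately show ?thesis by (auto intro!: continuous_intros)
  qed
  have "continuous_on ({0..} \<times> {0..}) (\<lambda>z. integral {0..1} (\<lambda>\<theta>.
      fst z * (g (fst z - fst z * \<theta>) * A (fst z * \<theta>) (snd z))))"
    using integral_continuous_on_param[of "{0..} \<times> {0..}" 0 1
        "\<lambda>z \<theta>. fst z * (g (fst z - fst z * \<theta>) * A (fst z * \<theta>) (snd z))"] c
    by (simp add: split_beta)
  then show ?thesis
  proof (rule continuous_on_eq)
    fix z :: "real \<times> real" assume z: "z \<in> {0..} \<times> {0..}"
    then have A': "continuous_on {0..fst z} (\<lambda>r. A r (snd z))"
      using continuous_on_subset[OF continuous_on_pair_fst[OF A], of "snd z" "{0..fst z}"] by auto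
    have "continuous_on {0..fst z} (\<lambda>r. g (fst z - r))"
      by (rule continuous_on_compose2[OF g]) (auto intro!: continuous_intros)
    then have "(\<lambda>r. g (fst z - r) * A r (snd z)) integrable_on {0..fst z}"
      by (intro integrable_continuous_real continuous_intros A')
    from integral_unit_rescale[OF _ this] z
    show "integral {0..1} (\<lambda>\<theta>. fst z * (g (fst z - fst z * \<theta>) * A (fst z * \<theta>) (snd z)))
      = (case z of (s, t) \<Rightarrow> integral {0..s} (\<lambda>r. g (s - r) * A r t))"
      by (auto simp: split_beta)
  qed
qed

text \<open>One partial derivative together with continuity of the other gives total
  differentiability, hence the chain rule along a diagonal. The shifts c and d are there for
  functions such as U(t, t+h).\<close>

lemma has_derivative_diag:
  fixes W :: "real \<Rightarrow> real \<Rightarrow> real"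
  assumes W1: "\<And>s t. 0 \<le> s \<Longrightarrow> 0 \<le> t \<Longrightarrow> ((\<lambda>s. W s t) has_real_derivative W1 s t) (at s within {0..})"
    and W2: "\<And>s t. 0 \<le> s \<Longrightarrow> 0 \<le> t \<Longrightarrow> ((\<lambda>t. W s t) has_real_derivative W2 s t) (at t within {0..})"
    and c2: "continuous_on ({0..} \<times> {0..}) (\<lambda>(s, t). W2 s t)"
    and "0 \<le> c" "0 \<le> d" "0 \<le> t"
  shows "((\<lambda>t. W (t + c) (t + d)) has_real_derivative W1 (t + c) (t + d) + W2 (t + c) (t + d)) (at t within {0..})"
proof -
  let ?x = "t + c" and ?y = "t + d"
  have xy: "0 \<le> ?x" "0 \<le> ?y" using assms by auto
  have h1: "((\<lambda>(s, t). W s t) has_derivative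
      (\<lambda>(tx, ty). W1 ?x ?y * tx + blinfun_apply (blinfun_scaleR_left (W2 ?x ?y)) ty)) (at (?x, ?y) within {0..} \<times> {0..})"
  proof (rule has_derivative_partialsI[where fy="\<lambda>s t. blinfun_scaleR_left (W2 s t)"])
    show "((\<lambda>x. W x ?y) has_derivative (*) (W1 ?x ?y)) (at ?x within {0..})"
      using W1[OF xy] by (simp add: has_field_derivative_def)
    show "((\<lambda>y. W x y) has_derivative blinfun_apply (blinfun_scaleR_left (W2 x y))) (at y within {0..})"
      if "x \<in> {0..}" "y \<in> {0..}" for x y
      using W2[of x y] that by (simp add: has_field_derivative_def mult_commute_abs)
    have "continuous (at (?x, ?y) within {0..} \<times> {0..}) (\<lambda>(s, t). W2 s t)"
      using c2 xy by (auto simp: continuous_on_eq_continuous_within)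
    then show "continuous (at (?x, ?y) within {0..} \<times> {0..}) (\<lambda>(x, y). blinfun_scaleR_left (W2 x y))"
      unfolding split_beta continuous_within
      by (rule bounded_linear.tendsto[OF bounded_linear_blinfun_scaleR_left])
  qed (use xy in auto)
  have h2: "((\<lambda>t. (t + c, t + d)) has_derivative (\<lambda>h. (h, h))) (at t within {0..})"
    by (auto intro!: derivative_eq_intros)
  have sub: "(\<lambda>t. (t + c, t + d)) ` {0..} \<subseteq> {0..} \<times> {0..}" using assms(4,5) by auto
  have "((\<lambda>t. (\<lambda>(s, t). W s t) (t + c, t + d)) has_derivative
      (\<lambda>h. (\<lambda>(tx, ty). W1 ?x ?y * tx + blinfun_apply (blinfun_scaleR_left (W2 ?x ?y)) ty) (h, h))) (at t within {0..})"
    by (rule has_derivative_in_compose[OF h2 has_derivative_subset[OF h1 sub]])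
  moreover have "(\<lambda>h. (\<lambda>(tx, ty). W1 ?x ?y * tx + blinfun_apply (blinfun_scaleR_left (W2 ?x ?y)) ty) (h, h))
      = (*) (W1 ?x ?y + W2 ?x ?y)"
    by (simp add: fun_eq_iff distrib_right)
  ultimately show ?thesis by (simp add: has_field_derivative_def)
qed

text \<open>T occurs both as the upper limit and in the kernel. The two occurrences are separated
  into \<open>F x y\<close>, differentiated one by one, and put back on the diagonal.\<close>

lemma convolution_has_derivative:
  fixes g g' a :: "real \<Rightarrow> real"
  assumes g: "\<And>t. 0 \<le> t \<Longrightarrow> (g has_real_derivative g' t) (at t within {0..})"
    and g': "continuous_on {0..} g'" and a: "continuous_on {0..} a" and T: "0 \<le> T"
  shows "((\<lambda>T. integral {0..T} (\<lambda>s. g (T - s) * a s)) has_real_derivative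
    g 0 * a T + integral {0..T} (\<lambda>s. g' (T - s) * a s)) (at T within {0..})"
proof -
  \<comment> \<open>Off the diagonal the kernel is evaluated at negative arguments. The affine
    continuation keeps it continuously differentiable on the whole line; on the diagonal its values
    there do not enter.\<close>
  define G where "G x = (if 0 \<le> x then g x else g 0 + g' 0 * x)" for x
  define G' where "G' x = g' (max 0 x)" for x
  define b where "b x = a (max 0 x)" for x
  have dG: "(G has_real_derivative G' x) (at x)" for x
  proof -
    consider "x < 0" | "x = 0" | "0 < x" by linarith
    then show ?thesis
    proof cases
      case 1
      have "((\<lambda>x. g 0 + g' 0 * x) has_real_derivative g' 0) (at x)"
        by (auto intro!: derivative_eq_intros)
      then have "(G has_real_derivative g' 0) (at x)"
        by (rule has_field_derivative_transform_within_open[of _ _ _ "{..<0}"]) (use 1 in \<open>auto simp: G_def\<close>)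
      then show ?thesis using 1 by (simp add: G'_def)
    next
      case 3
      then have "(g has_real_derivative g' x) (at x)"
    proof -
        have "at x within {0..} = at x"
          by (rule at_within_open_subset[of x "{0<..}"]) (use 3 in auto)
        then show ?thesis using g[of x] 3 by simp
      qed
      then have "(G has_real_derivative g' x) (at x)"
        by (rule has_field_derivative_transform_within_open[of _ _ _ "{0<..}"]) (use 3 in \<open>auto simp: G_def\<close>)
      then show ?thesis using 3 by (simp add: G'_def)
    next
      case 2
      have "((\<lambda>h. (g h - g 0) / h) \<longlongrightarrow> g' 0) (at_right 0)"
        using g[of 0] by (simp add: has_field_derivative_iff at_within_Ici_at_right)
      then have r: "((\<lambda>h. (G h - G 0) / h) \<longlongrightarrow> g' 0) (at_right 0)"
        by (rule Lim_transform_eventually) (auto simp: G_def eventually_at_filter intro!: always_eventually)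
      have l: "((\<lambda>h. (G h - G 0) / h) \<longlongrightarrow> g' 0) (at_left 0)"
        by (rule Lim_transform_eventually[OF tendsto_const])
          (auto simp: G_def eventually_at_filter intro!: always_eventually)
      show ?thesis using 2 l r by (simp add: has_field_derivative_iff filterlim_split_at G'_def)
    qed
  qed
  have cG: "continuous_on U G" for U
    by (rule continuous_at_imp_continuous_on) (use dG DERIV_isCont in blast)
  have cG': "continuous_on U G'" for U
    unfolding G'_def by (rule continuous_on_compose2[OF g']) (auto intro!: continuous_intros)
  have cb: "continuous_on U b" for U
    unfolding b_def by (rule continuous_on_compose2[OF a]) (auto intro!: continuous_intros)
  \<comment> \<open>Room to the right of T, so that the derivatives at T within
    \<open>{0..?B}\<close> and within \<open>{0..}\<close> coincide.\<close>
  let ?B = "T + 1"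
  define F where "F x y = integral {0..y} (\<lambda>s. G (x - s) * b s)" for x y
  have h1: "((\<lambda>(x, y). F x y) has_derivative
      (\<lambda>(tx, ty). integral {0..T} (\<lambda>s. G' (T - s) * b s) * tx + blinfun_apply (blinfun_scaleR_left (G (T - T) * b T)) ty))
      (at (T, T) within UNIV \<times> {0..?B})"
  proof (rule has_derivative_partialsI[where fy="\<lambda>x y. blinfun_scaleR_left (G (x - y) * b y)"])
    have "((\<lambda>x. integral (cbox 0 T) (\<lambda>s. G (x - s) * b s)) has_field_derivative
        integral (cbox 0 T) (\<lambda>s. G' (T - s) * b s)) (at T within UNIV)"
    proof (rule leibniz_rule_field_derivative)
      show "((\<lambda>x. G (x - s) * b s) has_field_derivative G' (x - s) * b s) (at x within UNIV)" for x s
      proof -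
        have "((\<lambda>x. x - s) has_real_derivative 1) (at x)" by (auto intro!: derivative_eq_intros)
        from DERIV_chain2[OF dG this] have "((\<lambda>x. G (x - s)) has_real_derivative G' (x - s)) (at x)" by simp
        then show ?thesis by (rule DERIV_cmult_right)
      qed
      show "(\<lambda>s. G (x - s) * b s) integrable_on cbox 0 T" for x
        by (intro integrable_continuous continuous_intros continuous_on_compose2[OF cG[of UNIV]] cb) auto
      show "continuous_on (UNIV \<times> cbox 0 T) (\<lambda>(x, s). G' (x - s) * b s)"
        unfolding split_beta
        by (intro continuous_intros continuous_on_compose2[OF cG'[of UNIV]] continuous_on_compose2[OF cb[of UNIV]]) auto
    qed auto
    then show "((\<lambda>x. F x T) has_derivative (*) (integral {0..T} (\<lambda>s. G' (T - s) * b s))) (at T within UNIV)"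
      by (simp add: F_def has_field_derivative_def)
    show "((\<lambda>y. F x y) has_derivative blinfun_apply (blinfun_scaleR_left (G (x - y) * b y))) (at y within {0..?B})"
      if "y \<in> {0..?B}" for x y
    proof -
      have "continuous_on {0..?B} (\<lambda>s. G (x - s) * b s)"
        by (intro continuous_intros continuous_on_compose2[OF cG[of UNIV]] cb) auto
      from integral_has_real_derivative[OF this that] show ?thesis
        by (simp add: F_def has_field_derivative_def mult_commute_abs)
    qed
    have "continuous_on UNIV (\<lambda>z. G (fst z - snd z) * b (snd z))"
      by (intro continuous_intros continuous_on_compose2[OF cG[of UNIV]] continuous_on_compose2[OF cb[of UNIV]]) auto
    then have l: "((\<lambda>z. G (fst z - snd z) * b (snd z)) \<longlongrightarrow> G (fst (T, T) - snd (T, T)) * b (snd (T, T))) (at (T, T))"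
      unfolding continuous_on_def by blast
    have "((\<lambda>z. G (fst z - snd z) * b (snd z)) \<longlongrightarrow> G (T - T) * b T) (at (T, T) within UNIV \<times> {0..?B})"
      using tendsto_within_subset[OF l subset_UNIV] by simp
    then show "continuous (at (T, T) within UNIV \<times> {0..?B}) (\<lambda>(x, y). blinfun_scaleR_left (G (x - y) * b y))"
      unfolding split_beta continuous_within fst_conv snd_conv
      by (rule bounded_linear.tendsto[OF bounded_linear_blinfun_scaleR_left])
  qed (use T in auto)
  have h2: "((\<lambda>t. (t, t)) has_derivative (\<lambda>h. (h, h))) (at T within {0..?B})"
    by (auto intro!: derivative_eq_intros)
  have sub: "(\<lambda>t. (t, t)) ` {0..?B} \<subseteq> UNIV \<times> {0..?B}" by auto
  have "((\<lambda>t. (\<lambda>(x, y). F x y) (t, t)) has_derivative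
      (\<lambda>h. (\<lambda>(tx, ty). integral {0..T} (\<lambda>s. G' (T - s) * b s) * tx +
        blinfun_apply (blinfun_scaleR_left (G (T - T) * b T)) ty) (h, h))) (at T within {0..?B})"
    by (rule has_derivative_in_compose[OF h2 has_derivative_subset[OF h1 sub]])
  moreover have "(\<lambda>h. (\<lambda>(tx, ty). integral {0..T} (\<lambda>s. G' (T - s) * b s) * tx +
        blinfun_apply (blinfun_scaleR_left (G (T - T) * b T)) ty) (h, h))
      = (*) (G 0 * b T + integral {0..T} (\<lambda>s. G' (T - s) * b s))"
    by (simp add: fun_eq_iff distrib_right)
  ultimately have d: "((\<lambda>t. F t t) has_real_derivative G 0 * b T + integral {0..T} (\<lambda>s. G' (T - s) * b s)) (at T within {0..})"
    using at_within_Ici_eq[of T ?B] T by (simp add: has_field_derivative_def)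
  have "F t t = integral {0..t} (\<lambda>s. g (t - s) * a s)" for t
    unfolding F_def by (rule Henstock_Kurzweil_Integration.integral_cong) (auto simp: G_def b_def)
  moreover have "integral {0..T} (\<lambda>s. G' (T - s) * b s) = integral {0..T} (\<lambda>s. g' (T - s) * a s)"
    by (rule Henstock_Kurzweil_Integration.integral_cong) (auto simp: G'_def b_def)
  ultimately show ?thesis using d T by (simp add: G_def b_def)
qed

section \<open>Limits of averaged time difference quotients\<close>

lemma continuous_on_compose_pair:
  fixes W :: "real \<Rightarrow> real \<Rightarrow> real"
  assumes "continuous_on ({0..} \<times> {0..}) (\<lambda>(s, t). W s t)" "continuous_on S f" "continuous_on S h"
    and "\<And>x. x \<in> S \<Longrightarrow> 0 \<le> f x" "\<And>x. x \<in> S \<Longrightarrow> 0 \<le> h x"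
  shows "continuous_on S (\<lambda>x. W (f x) (h x))"
proof -
  have "continuous_on S (\<lambda>x. (f x, h x))" using assms(2,3) by (rule continuous_on_Pair)
  from continuous_on_compose2[OF assms(1) this] assms(4,5) show ?thesis by auto
qed

text \<open>The shift turns the integral into the mean of w over [b, b+h] minus its mean over
  [0, h], so continuity of w is enough.\<close>

lemma tendsto_integral_difference_quotient:
  fixes w :: "real \<Rightarrow> real"
  assumes w: "continuous_on {0..} w" and b: "0 \<le> b"
  shows "((\<lambda>h. integral {0..b} (\<lambda>t. (w (t + h) - w t) / h)) \<longlongrightarrow> w b - w 0) (at_right 0)"
proof -
  let ?I = "\<lambda>x. integral {0..x} w"
  have i: "w integrable_on {x..y}" if "0 \<le> x" for x y
    by (rule integrable_continuous_real, rule continuous_on_subset[OF w]) (use that in auto)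
  have d: "((\<lambda>h. (?I (x + h) - ?I x) / h) \<longlongrightarrow> w x) (at_right 0)" if "0 \<le> x" for x
  proof -
    have "((\<lambda>y. integral {x..y} w) has_real_derivative w x) (at x within {x..x+1})"
      by (rule integral_has_real_derivative) (use that in \<open>auto intro: continuous_on_subset[OF w]\<close>)
    then have "((\<lambda>y. (integral {x..y} w - integral {x..x} w) / (y - x)) \<longlongrightarrow> w x) (at_right x)"
      using at_within_Icc_at_right[of x "x + 1"] by (simp add: has_field_derivative_iff)
    then have "((\<lambda>h. integral {x..x + h} w / h) \<longlongrightarrow> w x) (at_right 0)"
      by (subst (asm) at_right_to_0) (simp add: filterlim_filtermap add.commute)
    then show ?thesis
    proof (rule Lim_transform_eventually)
      show "\<forall>\<^sub>F h in at_right 0. integral {x..x + h} w / h = (?I (x + h) - ?I x) / h"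
        unfolding eventually_at_filter
      proof (intro always_eventually allI impI)
        fix h :: real assume "h \<noteq> 0" "h \<in> {0<..}"
        then have "?I x + integral {x..x + h} w = ?I (x + h)"
          using that by (intro Henstock_Kurzweil_Integration.integral_combine i) auto
        then show "integral {x..x + h} w / h = (?I (x + h) - ?I x) / h" by (metis add_diff_cancel_left')
      qed
    qed
  qed
  have "((\<lambda>h. (?I (b + h) - ?I b) / h - (?I (0 + h) - ?I 0) / h) \<longlongrightarrow> w b - w 0) (at_right 0)"
    using b by (intro tendsto_diff d) auto
  then show ?thesis
  proof (rule Lim_transform_eventually)
    show "\<forall>\<^sub>F h in at_right 0. (?I (b + h) - ?I b) / h - (?I (0 + h) - ?I 0) / h
        = integral {0..b} (\<lambda>t. (w (t + h) - w t) / h)"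
      unfolding eventually_at_filter
    proof (intro always_eventually allI impI)
      fix h :: real assume h: "h \<noteq> 0" "h \<in> {0<..}"
      then have "?I h + integral {h..b + h} w = ?I (b + h)"
        using b by (intro Henstock_Kurzweil_Integration.integral_combine i) auto
      moreover have "integral {h..b + h} w = integral {0..b} (\<lambda>t. w (t + h))"
        using integral_shift_real_ivl[of h h "b + h" w] by simp
      moreover have "(\<lambda>t. w (t + h)) integrable_on {0..b}"
        by (intro integrable_continuous_real continuous_on_compose2[OF w]) (use h in \<open>auto intro!: continuous_intros\<close>)
      ultimately show "(?I (b + h) - ?I b) / h - (?I (0 + h) - ?I 0) / h
        = integral {0..b} (\<lambda>t. (w (t + h) - w t) / h)"
        using i[of 0 b] h by (simp add: Henstock_Kurzweil_Integration.integral_diff diff_divide_distrib[symmetric])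
    qed
  qed
qed

text \<open>By the mean value theorem the quotient is W2 at a point within distance 2 h of (t, t),
  and W2 is uniformly continuous on a compact square. The parameter q selects the first argument at
  which the increment is taken: t for q = 0, t + h for q = 1.\<close>

lemma tendsto_integral_partial_quotient:
  fixes W W2 :: "real \<Rightarrow> real \<Rightarrow> real"
  assumes W: "continuous_on ({0..} \<times> {0..}) (\<lambda>(s, t). W s t)"
    and W2: "\<And>s t. 0 \<le> s \<Longrightarrow> 0 \<le> t \<Longrightarrow> ((\<lambda>t. W s t) has_real_derivative W2 s t) (at t within {0..})"
    and c2: "continuous_on ({0..} \<times> {0..}) (\<lambda>(s, t). W2 s t)"
    and b: "0 \<le> b" and q: "0 \<le> q" "q \<le> 1"
  shows "((\<lambda>h. integral {0..b} (\<lambda>t. (W (t + q * h) (t + h) - W (t + q * h) t) / h)) \<longlongrightarrow>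
    integral {0..b} (\<lambda>t. W2 t t)) (at_right 0)"
proof (rule tendstoI)
  fix e :: real assume e: "0 < e"
  define \<epsilon> where "\<epsilon> = e / (2 * (b + 1))"
  have \<epsilon>: "0 < \<epsilon>" using e b by (simp add: \<epsilon>_def)
  let ?Q = "{0..b+1} \<times> {0..b+1}"
  have "uniformly_continuous_on ?Q (\<lambda>(s, t). W2 s t)"
    by (intro compact_uniformly_continuous continuous_on_subset[OF c2] compact_Times) auto
  then obtain d where d: "0 < d" "\<And>x y. x \<in> ?Q \<Longrightarrow> y \<in> ?Q \<Longrightarrow> dist y x < d \<Longrightarrow>
      dist (case y of (s, t) \<Rightarrow> W2 s t) (case x of (s, t) \<Rightarrow> W2 s t) < \<epsilon>"
    using \<epsilon> unfolding uniformly_continuous_on_def by metis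
  have cd: "continuous_on {0..} (\<lambda>t. W (t + c) (t + c'))" if "0 \<le> c" "0 \<le> c'" for c c'
    using that by (intro continuous_on_compose_pair[OF W] continuous_intros) auto
  have main: "dist (integral {0..b} (\<lambda>t. (W (t + q * h) (t + h) - W (t + q * h) t) / h)) (integral {0..b} (\<lambda>t. W2 t t)) < e"
    if h: "0 < h" "h < min 1 (d / 2)" for h
  proof -
    have qh: "0 \<le> q * h" "q * h \<le> h" using q h by (auto simp: mult_left_le_one_le)
    have i1: "(\<lambda>t. (W (t + q * h) (t + h) - W (t + q * h) t) / h) integrable_on {0..b}"
      using cd[of "q * h" h] cd[of "q * h" 0] qh h
      by (intro integrable_continuous_real continuous_intros) (auto intro: continuous_on_subset)
    have i2: "(\<lambda>t. W2 t t) integrable_on {0..b}"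
      by (intro integrable_continuous_real continuous_on_compose_pair[OF c2] continuous_intros) auto
    have pt: "\<bar>(W (t + q * h) (t + h) - W (t + q * h) t) / h - W2 t t\<bar> \<le> \<epsilon>" if t: "t \<in> {0..b}" for t
    proof -
      let ?s = "t + q * h"
      have "\<exists>\<xi>. t < \<xi> \<and> \<xi> < t + h \<and> W ?s (t + h) - W ?s t = (t + h - t) * W2 ?s \<xi>"
      proof -
        have "\<exists>z\<in>{t<..<t + h}. W ?s (t + h) - W ?s t = W2 ?s z * (t + h - t)"
        proof (rule mvt_simple)
          fix x assume "t \<le> x" "x \<le> t + h"
          then show "((\<lambda>t. W ?s t) has_derivative (*) (W2 ?s x)) (at x within {t..t + h})"
            using W2[of ?s x] t qh unfolding has_field_derivative_def
            by (auto intro: has_derivative_subset)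
        qed (use h in auto)
        then show ?thesis by (auto simp: mult.commute)
      qed
      then obtain \<xi> where \<xi>: "t < \<xi>" "\<xi> < t + h" "W ?s (t + h) - W ?s t = h * W2 ?s \<xi>" by auto
      have "dist (?s, \<xi>) (t, t) \<le> dist ?s t + dist \<xi> t"
        unfolding dist_prod_def by (simp add: sqrt_sum_squares_le_sum)
      also have "\<dots> < d"
      proof -
        have "dist ?s t = q * h" "dist \<xi> t = \<xi> - t" "h < d / 2"
          using \<xi> qh h by (auto simp: dist_real_def)
        then show ?thesis using \<xi>(2) qh(2) by linarith
      qed
      finally have dd: "dist (?s, \<xi>) (t, t) < d" .
      have "dist (W2 ?s \<xi>) (W2 t t) < \<epsilon>"
      proof -
        have "0 \<le> t" "t \<le> b" "h < 1" using t h by auto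
        then have "?s \<in> {0..b+1}" "\<xi> \<in> {0..b+1}" "t \<in> {0..b+1}"
          unfolding atLeastAtMost_iff using qh \<xi>(1,2) by (intro conjI; linarith)+
        then show ?thesis using dd d(2)[of "(t, t)" "(?s, \<xi>)"] by auto
      qed
      then show ?thesis using \<xi>(3) h by (simp add: dist_real_def)
    qed
    have "norm (integral {0..b} (\<lambda>t. (W (t + q * h) (t + h) - W (t + q * h) t) / h - W2 t t)) \<le> integral {0..b} (\<lambda>t. \<epsilon>)"
      by (rule integral_norm_bound_integral) (use pt i1 i2 in \<open>auto intro!: integrable_diff\<close>)
    also have "\<dots> = b * \<epsilon>" using b by simp
    also have "\<dots> < e" using b e by (simp add: \<epsilon>_def field_simps add_nonneg_pos)
    finally show ?thesis using i1 i2 by (simp add: dist_norm Henstock_Kurzweil_Integration.integral_diff)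
  qed
  show "\<forall>\<^sub>F h in at_right 0. dist (integral {0..b} (\<lambda>t. (W (t + q * h) (t + h) - W (t + q * h) t) / h)) (integral {0..b} (\<lambda>t. W2 t t)) < e"
    unfolding eventually_at_right_field
    by (rule exI[of _ "min 1 (d / 2)"]) (use main d in auto)
qed

text \<open>W(t,t+h) - W(t+h,t) is the sum of W(t,t+h) - W(t,t) and W(t+h,t+h) - W(t+h,t), minus
  W(t+h,t+h) - W(t,t). The first two are increments in the second argument, where W has a
  derivative; the last is an increment along the diagonal, where continuity suffices.\<close>

lemma tendsto_integral_antisym_quotient:
  fixes W W2 :: "real \<Rightarrow> real \<Rightarrow> real"
  assumes W: "continuous_on ({0..} \<times> {0..}) (\<lambda>(s, t). W s t)"
    and W2: "\<And>s t. 0 \<le> s \<Longrightarrow> 0 \<le> t \<Longrightarrow> ((\<lambda>t. W s t) has_real_derivative W2 s t) (at t within {0..})"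
    and c2: "continuous_on ({0..} \<times> {0..}) (\<lambda>(s, t). W2 s t)"
    and b: "0 \<le> b"
  shows "((\<lambda>h. integral {0..b} (\<lambda>t. (W t (t + h) - W (t + h) t) / h)) \<longlongrightarrow>
    2 * integral {0..b} (\<lambda>t. W2 t t) - (W b b - W 0 0)) (at_right 0)"
proof -
  have cw: "continuous_on {0..} (\<lambda>t. W (t + c) (t + c'))" if "0 \<le> c" "0 \<le> c'" for c c'
    using that by (intro continuous_on_compose_pair[OF W] continuous_intros) auto
  have i: "(\<lambda>t. (W (t + c) (t + c') - W (t + r) (t + r')) / h) integrable_on {0..b}"
    if "0 \<le> c" "0 \<le> c'" "0 \<le> r" "0 \<le> r'" for c c' r r' h
    unfolding divide_inverse
    by (intro integrable_continuous_real continuous_intros continuous_on_subset[OF cw]) (use that in auto)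
  let ?X = "\<lambda>q h. integral {0..b} (\<lambda>t. (W (t + q * h) (t + h) - W (t + q * h) t) / h)"
  let ?Y = "\<lambda>h. integral {0..b} (\<lambda>t. (W (t + h) (t + h) - W t t) / h)"
  have "((\<lambda>h. ?X 0 h + ?X 1 h - ?Y h) \<longlongrightarrow>
    integral {0..b} (\<lambda>t. W2 t t) + integral {0..b} (\<lambda>t. W2 t t) - (W b b - W 0 0)) (at_right 0)"
    using cw[of 0 0] tendsto_integral_difference_quotient[of "\<lambda>t. W t t" b] b
    by (intro tendsto_diff tendsto_add tendsto_integral_partial_quotient W W2 c2) auto
  then have "((\<lambda>h. ?X 0 h + ?X 1 h - ?Y h) \<longlongrightarrow>
    2 * integral {0..b} (\<lambda>t. W2 t t) - (W b b - W 0 0)) (at_right 0)" by simp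
  then show ?thesis
  proof (rule Lim_transform_eventually)
    show "\<forall>\<^sub>F h in at_right 0. ?X 0 h + ?X 1 h - ?Y h = integral {0..b} (\<lambda>t. (W t (t + h) - W (t + h) t) / h)"
      unfolding eventually_at_filter
    proof (intro always_eventually allI impI)
      fix h :: real assume h: "h \<noteq> 0" "h \<in> {0<..}"
      then have i3: "(\<lambda>t. (W t (t + h) - W t t) / h) integrable_on {0..b}"
        "(\<lambda>t. (W (t + h) (t + h) - W (t + h) t) / h) integrable_on {0..b}"
        "(\<lambda>t. (W (t + h) (t + h) - W t t) / h) integrable_on {0..b}"
        using i[of 0 h 0 0 h] i[of h h h 0 h] i[of h h 0 0 h] by simp_all
      have "?X 0 h + ?X 1 h - ?Y h = integral {0..b} (\<lambda>t. (W t (t + h) - W t t) / h +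
          (W (t + h) (t + h) - W (t + h) t) / h - (W (t + h) (t + h) - W t t) / h)"
        using i3 by (simp only: mult_zero_left add_0_right mult_1 Henstock_Kurzweil_Integration.integral_add
            Henstock_Kurzweil_Integration.integral_diff integrable_add)
      also have "(\<lambda>t. (W t (t + h) - W t t) / h + (W (t + h) (t + h) - W (t + h) t) / h - (W (t + h) (t + h) - W t t) / h)
          = (\<lambda>t. (W t (t + h) - W (t + h) t) / h)"
        by (auto simp: diff_divide_distrib)
      finally show "?X 0 h + ?X 1 h - ?Y h = integral {0..b} (\<lambda>t. (W t (t + h) - W (t + h) t) / h)" .
    qed
  qed
qed

text \<open>The energy identity of an abstract second-order equation, whose solution is only \<open>C\<^sup>1\<close> in time with
  values in the weaker space: \<open>\<phi>\<^sub>h(t) = U(t, t+h) - U(t+h, t)\<close> is differentiable with derivative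
  \<open>R(t, t+h) - R(t+h, t)\<close>, from which the elliptic part \<open>A\<close> cancels by symmetry.  Dividing by \<open>h\<close> and
  letting \<open>h \<rightarrow> 0\<close> gives the identity without regularising the solution.\<close>

lemma two_time_energy_identity:
  fixes A M U P P1 F S R :: "real \<Rightarrow> real \<Rightarrow> real"
  assumes R: "\<And>s t. 0 \<le> s \<Longrightarrow> 0 \<le> t \<Longrightarrow> R s t = - A s t + P s t - U s t + \<alpha> * F s t"
    and U1: "\<And>s t. 0 \<le> s \<Longrightarrow> 0 \<le> t \<Longrightarrow> ((\<lambda>s. U s t) has_real_derivative R s t) (at s within {0..})"
    and U2: "\<And>s t. 0 \<le> s \<Longrightarrow> 0 \<le> t \<Longrightarrow> ((\<lambda>t. U s t) has_real_derivative M s t) (at t within {0..})"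
    and P1: "\<And>s t. 0 \<le> s \<Longrightarrow> 0 \<le> t \<Longrightarrow> ((\<lambda>s. P s t) has_real_derivative P1 s t) (at s within {0..})"
    and F2: "\<And>s t. 0 \<le> s \<Longrightarrow> 0 \<le> t \<Longrightarrow> ((\<lambda>t. F s t) has_real_derivative S s t) (at t within {0..})"
    and A: "\<And>s t. A s t = A t s" and M: "\<And>s t. M s t = M t s"
    and cM: "continuous_on ({0..} \<times> {0..}) (\<lambda>(s, t). M s t)"
    and cU: "continuous_on ({0..} \<times> {0..}) (\<lambda>(s, t). U s t)"
    and cP: "continuous_on ({0..} \<times> {0..}) (\<lambda>(s, t). P s t)"
    and cP1: "continuous_on ({0..} \<times> {0..}) (\<lambda>(s, t). P1 s t)"
    and cF: "continuous_on ({0..} \<times> {0..}) (\<lambda>(s, t). F s t)"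
    and cS: "continuous_on ({0..} \<times> {0..}) (\<lambda>(s, t). S s t)"
    and b: "0 \<le> b"
  shows "(M b b + A b b - 2 * P b b) - (M 0 0 + A 0 0 - 2 * P 0 0)
    = - 2 * integral {0..b} (\<lambda>t. P1 t t) - 2 * integral {0..b} (\<lambda>t. M t t) + 2 * \<alpha> * integral {0..b} (\<lambda>t. S t t)"
proof -
  let ?I = "\<lambda>W h. integral {0..b} (\<lambda>t. (W t (t + h) - W (t + h) t) / h)"
  have sw: "continuous_on ({0..} \<times> {0..}) (\<lambda>(s, t). W t s)"
    if "continuous_on ({0..} \<times> {0..}) (\<lambda>(s, t). W s t)" for W :: "real \<Rightarrow> real \<Rightarrow> real"
    unfolding split_beta by (intro continuous_on_compose_pair[OF that] continuous_intros) auto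
  \<comment> \<open>P has its derivative in the first argument, so the transposed function is used;
    this accounts for the opposite sign of P below.\<close>
  have lP: "((\<lambda>h. ?I (\<lambda>s t. P t s) h) \<longlongrightarrow> 2 * integral {0..b} (\<lambda>t. P1 t t) - (P b b - P 0 0)) (at_right 0)"
    by (rule tendsto_integral_antisym_quotient[OF sw[OF cP] _ sw[OF cP1] b]) (use P1 in auto)
  have lU: "((\<lambda>h. ?I U h) \<longlongrightarrow> 2 * integral {0..b} (\<lambda>t. M t t) - (U b b - U 0 0)) (at_right 0)"
    by (rule tendsto_integral_antisym_quotient[OF cU U2 cM b])
  have lF: "((\<lambda>h. ?I F h) \<longlongrightarrow> 2 * integral {0..b} (\<lambda>t. S t t) - (F b b - F 0 0)) (at_right 0)"
    by (rule tendsto_integral_antisym_quotient[OF cF F2 cS b])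
  have lim1: "((\<lambda>h. - ?I (\<lambda>s t. P t s) h - ?I U h + \<alpha> * ?I F h) \<longlongrightarrow>
      - (2 * integral {0..b} (\<lambda>t. P1 t t) - (P b b - P 0 0)) - (2 * integral {0..b} (\<lambda>t. M t t) - (U b b - U 0 0))
      + \<alpha> * (2 * integral {0..b} (\<lambda>t. S t t) - (F b b - F 0 0))) (at_right 0)"
    by (intro tendsto_intros lP lU lF)
  define \<phi> where "\<phi> h t = U t (t + h) - U (t + h) t" for h t
  have lphi: "((\<lambda>h. \<phi> h t / h) \<longlongrightarrow> M t t - R t t) (at_right 0)" if t: "0 \<le> t" for t
  proof -
    have q: "((\<lambda>h. (f (t + h) - f t) / h) \<longlongrightarrow> D) (at_right 0)"
      if "(f has_real_derivative D) (at t within {0..})" for f D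
    proof -
      have "(f has_real_derivative D) (at t within {t..})"
        by (rule has_field_derivative_subset[OF that]) (use t in auto)
      then have "((\<lambda>y. (f y - f t) / (y - t)) \<longlongrightarrow> D) (at_right t)"
        by (simp add: has_field_derivative_iff at_within_Ici_at_right)
      then show ?thesis
        by (subst (asm) at_right_to_0) (simp add: filterlim_filtermap add.commute)
    qed
    have "((\<lambda>h. (U t (t + h) - U t t) / h - (U (t + h) t - U t t) / h) \<longlongrightarrow> M t t - R t t) (at_right 0)"
      by (intro tendsto_diff q U1 U2 t)
    then show ?thesis by (simp add: \<phi>_def diff_divide_distrib[symmetric])
  qed
  have lim2: "((\<lambda>h. \<phi> h b / h - \<phi> h 0 / h) \<longlongrightarrow> (M b b - R b b) - (M 0 0 - R 0 0)) (at_right 0)"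
    by (intro tendsto_diff lphi b) simp
  have eq: "\<phi> h b / h - \<phi> h 0 / h = - ?I (\<lambda>s t. P t s) h - ?I U h + \<alpha> * ?I F h" if h: "0 < h" for h
  proof -
    \<comment> \<open>The derivatives in the second slots contribute M(t, t+h) and M(t+h, t), which
      cancel by symmetry.\<close>
    have d: "(\<phi> h has_real_derivative R t (t + h) - R (t + h) t) (at t within {0..b})" if t: "t \<in> {0..b}" for t
    proof -
      have "(\<phi> h has_real_derivative (R (t + 0) (t + h) + M (t + 0) (t + h)) - (R (t + h) (t + 0) + M (t + h) (t + 0)))
          (at t within {0..})"
        unfolding \<phi>_def
        using has_derivative_diag[OF U1 U2 cM, of 0 h t] has_derivative_diag[OF U1 U2 cM, of h 0 t] h t
        by (intro DERIV_diff) auto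
      then have "(\<phi> h has_real_derivative R t (t + h) - R (t + h) t) (at t within {0..})"
        using M[of t "t + h"] by simp
      then show ?thesis by (rule has_field_derivative_subset) auto
    qed
    have "((\<lambda>t. R t (t + h) - R (t + h) t) has_integral \<phi> h b - \<phi> h 0) {0..b}"
      by (rule fundamental_theorem_of_calculus[OF b])
        (use d in \<open>simp add: has_real_derivative_iff_has_vector_derivative\<close>)
    then have "((\<lambda>t. (R t (t + h) - R (t + h) t) / h) has_integral (\<phi> h b - \<phi> h 0) / h) {0..b}"
      by (rule has_integral_divide)
    then have e: "\<phi> h b / h - \<phi> h 0 / h = integral {0..b} (\<lambda>t. (R t (t + h) - R (t + h) t) / h)"
      by (simp add: integral_unique diff_divide_distrib)
    have iW: "(\<lambda>t. (W t (t + h) - W (t + h) t) / h) integrable_on {0..b}"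
      if "continuous_on ({0..} \<times> {0..}) (\<lambda>(s, t). W s t)" for W :: "real \<Rightarrow> real \<Rightarrow> real"
    proof -
      have "continuous_on {0..b} (\<lambda>t. W t (t + h))"
        using h by (intro continuous_on_compose_pair[OF that] continuous_intros) auto
      moreover have "continuous_on {0..b} (\<lambda>t. W (t + h) t)"
        using h by (intro continuous_on_compose_pair[OF that] continuous_intros) auto
      ultimately show ?thesis using h by (intro integrable_continuous_real continuous_intros) auto
    qed
    have "((\<lambda>t. - ((P (t + h) t - P t (t + h)) / h) - (U t (t + h) - U (t + h) t) / h
        + \<alpha> * ((F t (t + h) - F (t + h) t) / h)) has_integral - ?I (\<lambda>s t. P t s) h - ?I U h + \<alpha> * ?I F h) {0..b}"
      using iW[OF sw[OF cP]] iW[OF cU] iW[OF cF]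
      by (intro has_integral_add has_integral_diff has_integral_neg has_integral_mult_right integrable_integral)
    then have "((\<lambda>t. (R t (t + h) - R (t + h) t) / h) has_integral - ?I (\<lambda>s t. P t s) h - ?I U h + \<alpha> * ?I F h) {0..b}"
    proof (rule has_integral_eq[rotated])
      fix t assume t: "t \<in> {0..b}"
      have Rd: "R t (t + h) - R (t + h) t = - (P (t + h) t - P t (t + h)) - (U t (t + h) - U (t + h) t) + \<alpha> * (F t (t + h) - F (t + h) t)"
        using R[of t "t + h"] R[of "t + h" t] A[of t "t + h"] t h by (simp add: algebra_simps)
      show "- ((P (t + h) t - P t (t + h)) / h) - (U t (t + h) - U (t + h) t) / h
        + \<alpha> * ((F t (t + h) - F (t + h) t) / h) = (R t (t + h) - R (t + h) t) / h"
        unfolding Rd by (simp add: add_divide_distrib diff_divide_distrib right_diff_distrib)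
    qed
    from integral_unique[OF this] e show ?thesis by (simp only:)
  qed
  have "((\<lambda>h. \<phi> h b / h - \<phi> h 0 / h) \<longlongrightarrow>
      - (2 * integral {0..b} (\<lambda>t. P1 t t) - (P b b - P 0 0)) - (2 * integral {0..b} (\<lambda>t. M t t) - (U b b - U 0 0))
      + \<alpha> * (2 * integral {0..b} (\<lambda>t. S t t) - (F b b - F 0 0))) (at_right 0)"
    by (rule Lim_transform_eventually[OF lim1])
      (use eq in \<open>auto simp: eventually_at_filter intro!: always_eventually\<close>)
  \<comment> \<open>The two limits are compared and R is expanded at both endpoints: the boundary
    terms of U and F cancel, those of P double.\<close>
  from tendsto_unique[OF _ this lim2] R[of b b] R[of 0 0] b show ?thesis
    by (simp add: algebra_simps)
qed

section \<open>The logarithmic source\<close>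

definition logpow :: "real \<Rightarrow> real \<Rightarrow> real" where
  "logpow q y = \<bar>y\<bar> powr (q - 2) * y * ln \<bar>y\<bar>"

text \<open>The antiderivative of \<open>logpow q\<close> that vanishes at 0. Integrated over
  \<Omega> and multiplied by -\<alpha>, it gives the last two terms of the energy.\<close>

definition logpow_int :: "real \<Rightarrow> real \<Rightarrow> real" where
  "logpow_int q y = \<bar>y\<bar> powr q * ln \<bar>y\<bar> / q - \<bar>y\<bar> powr q / q\<^sup>2"

definition logpow_deriv :: "real \<Rightarrow> real \<Rightarrow> real" where
  "logpow_deriv q y = \<bar>y\<bar> powr (q - 2) * ((q - 1) * ln \<bar>y\<bar> + 1)"

text \<open>The inequality ln z \<le> z^c / c in two regimes: for |y| \<le> 1 it is applied to 1/|y|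
  with c = p1 - 2, for |y| > 1 with c = m - (p2 - 2). The constant is thereby the same for all
  exponents q in the range.\<close>

lemma powr_ln_bound:
  fixes p1 p2 q m y :: real
  assumes "2 < p1" "p1 \<le> q" "q \<le> p2" "p2 - 2 < m"
  shows "\<bar>y\<bar> powr (q - 2) * \<bar>ln \<bar>y\<bar>\<bar> \<le> (1 / (p1 - 2) + 1 / (m - (p2 - 2))) * (1 + \<bar>y\<bar> powr m)"
proof -
  let ?z = "\<bar>y\<bar>" and ?c = "p1 - 2" and ?\<epsilon> = "m - (p2 - 2)"
  have ce: "0 < ?c" "0 < ?\<epsilon>" using assms by auto
  consider "?z = 0" | "0 < ?z" "?z \<le> 1" | "1 < ?z" by linarith
  then show ?thesis
  proof cases
    case 1
    then show ?thesis using ce by (simp add: add_nonneg_nonneg)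
  next
    case 2
    have "ln (1 / ?z) \<le> (1 / ?z) powr ?c / ?c" using 2 ce by (intro ln_powr_bound) auto
    moreover have "(1 / ?z) powr ?c = ?z powr (- ?c)" by (simp only: powr_divide powr_minus_divide powr_one_eq_one)
    moreover have "\<bar>ln ?z\<bar> = ln (1 / ?z)" using 2 by (simp add: ln_div)
    ultimately have "\<bar>ln ?z\<bar> \<le> ?z powr (- ?c) / ?c" by (simp only:)
    then have "?z powr (q - 2) * \<bar>ln ?z\<bar> \<le> ?z powr ?c * (?z powr (- ?c) / ?c)"
      using 2 assms by (intro mult_mono powr_mono') auto
    also have "\<dots> = (?z powr ?c * ?z powr (- ?c)) / ?c" by (simp only: times_divide_eq_right)
    also have "?z powr ?c * ?z powr (- ?c) = 1" by (subst powr_add[symmetric]) (use 2 in simp)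
    also have "1 / ?c = 1 / ?c * 1" by simp
    also have "\<dots> \<le> (1 / ?c + 1 / ?\<epsilon>) * (1 + ?z powr m)"
      using ce by (intro mult_mono) auto
    finally show ?thesis .
  next
    case 3
    have "?z powr (q - 2) * \<bar>ln ?z\<bar> \<le> ?z powr (p2 - 2) * (?z powr ?\<epsilon> / ?\<epsilon>)"
      using 3 assms ln_powr_bound[of ?z ?\<epsilon>] ce by (intro mult_mono powr_mono) auto
    also have "\<dots> = 1 / ?\<epsilon> * ?z powr m" using 3 by (simp add: powr_add[symmetric])
    also have "\<dots> \<le> (1 / ?c + 1 / ?\<epsilon>) * (1 + ?z powr m)"
      using ce by (intro mult_mono) auto
    finally show ?thesis .
  qed
qed

lemma powr_le_1_plus_powr: "0 \<le> a \<Longrightarrow> a \<le> b \<Longrightarrow> \<bar>y\<bar> powr a \<le> 1 + \<bar>y\<bar> powr b" for y :: real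
proof (cases "\<bar>y\<bar> \<le> 1")
  case True
  assume "0 \<le> a"
  then have "\<bar>y\<bar> powr a \<le> 1" using True by (intro powr_le1) auto
  then show ?thesis by (smt (verit) powr_ge_zero)
next
  case False
  assume "a \<le> b"
  then have "\<bar>y\<bar> powr a \<le> \<bar>y\<bar> powr b" using False by (intro powr_mono) auto
  then show ?thesis by simp
qed

lemma DERIV_at_0I:
  fixes f :: "real \<Rightarrow> real"
  assumes "f 0 = 0" "\<And>h. \<bar>f h\<bar> \<le> \<bar>h\<bar> * b h" "(b \<longlongrightarrow> 0) (at 0)"
  shows "(f has_real_derivative 0) (at 0)"
  unfolding DERIV_def
proof (rule Lim_null_comparison[OF _ assms(3)])
  have "norm (f h / h) \<le> b h" if "h \<noteq> 0" for h
    using assms(2)[of h] that by (simp add: abs_divide divide_le_eq mult.commute)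
  then show "\<forall>\<^sub>F h in at 0. norm ((f (0 + h) - f 0) / h) \<le> b h"
    using assms(1) by (auto simp: eventually_at_filter)
qed

text \<open>Away from 0 this is calculus on the positive half-line and parity. At 0 the claimed
  derivatives are 0 because a power of 0 is 0, and a growth bound confirms them.\<close>

lemma logpow_has_derivative:
  assumes q: "2 < q"
  shows "(logpow q has_real_derivative logpow_deriv q y) (at y)"
    and "(logpow_int q has_real_derivative logpow q y) (at y)"
proof -
  have pos: "(logpow q has_real_derivative logpow_deriv q y) (at y) \<and>
      (logpow_int q has_real_derivative logpow q y) (at y)" if y: "0 < y" for y
  proof
    have y1: "y powr (q - 2) * y = y powr (q - 1)" "y powr (q - 1) * y = y powr q"
      "y powr (q - 2 - 1) * y = y powr (q - 2)" "y powr (q - 1) = y powr q / y"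
      using y powr_mult_base[of y "q - 2"] powr_mult_base[of y "q - 1"] powr_mult_base[of y "q - 2 - 1"]
      by (auto simp: mult.commute field_simps)
    have "((\<lambda>y. y powr (q - 2) * y * ln y) has_real_derivative
        y powr (q - 2) * ((q - 1) * ln y + 1)) (at y)"
    proof -
      have "((\<lambda>y. y powr (q - 2) * y * ln y) has_real_derivative
        (((q - 2) * y powr (q - 2 - 1)) * y + 1 * y powr (q - 2)) * ln y + inverse y * (y powr (q - 2) * y)) (at y)"
        by (intro DERIV_mult has_real_derivative_powr DERIV_ident DERIV_ln y)
      also have "(((q - 2) * y powr (q - 2 - 1)) * y + 1 * y powr (q - 2)) * ln y + inverse y * (y powr (q - 2) * y)
          = y powr (q - 2) * ((q - 1) * ln y + 1)"
      proof -
        have a: "((q - 2) * y powr (q - 2 - 1)) * y = (q - 2) * y powr (q - 2)"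
          using y1(3) by (simp only: mult.assoc)
        have b: "inverse y * (y powr (q - 2) * y) = y powr (q - 2)" using y by simp
        show ?thesis unfolding a b by (simp add: algebra_simps)
      qed
      finally show ?thesis .
    qed
    then have "(logpow q has_real_derivative y powr (q - 2) * ((q - 1) * ln y + 1)) (at y)"
      by (rule has_field_derivative_transform_within_open[of _ _ _ "{0<..}"]) (use y in \<open>auto simp: logpow_def\<close>)
    then show "(logpow q has_real_derivative logpow_deriv q y) (at y)"
      using y by (simp add: logpow_deriv_def)
    have "((\<lambda>y. y powr q * ln y / q - y powr q / q\<^sup>2) has_real_derivative y powr (q - 2) * y * ln y) (at y)"
    proof -
      have "((\<lambda>y. y powr q * ln y / q - y powr q / q\<^sup>2) has_real_derivative
        ((q * y powr (q - 1)) * ln y + inverse y * y powr q) / q - (q * y powr (q - 1)) / q\<^sup>2) (at y)"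
        by (intro DERIV_diff DERIV_cdivide DERIV_mult has_real_derivative_powr DERIV_ln y)
      also have "((q * y powr (q - 1)) * ln y + inverse y * y powr q) / q - (q * y powr (q - 1)) / q\<^sup>2
          = y powr (q - 2) * y * ln y"
        using y q unfolding y1(1) by (simp add: y1(4) power2_eq_square field_simps)
      finally show ?thesis .
    qed
    then show "(logpow_int q has_real_derivative logpow q y) (at y)"
      unfolding logpow_def
      by (rule has_field_derivative_transform_within_open[of _ _ _ "{0<..}", THEN DERIV_cong])
        (use y in \<open>auto simp: logpow_int_def\<close>)
  qed
  have odd: "logpow q (- y) = - logpow q y" "logpow_int q (- y) = logpow_int q y"
    "logpow_deriv q (- y) = logpow_deriv q y" for y
    by (simp_all add: logpow_def logpow_int_def logpow_deriv_def)
  have "(logpow q has_real_derivative logpow_deriv q y) (at y) \<and>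
      (logpow_int q has_real_derivative logpow q y) (at y)"
  proof (cases y "0 :: real" rule: linorder_cases)
    case greater
    then show ?thesis by (rule pos)
  next
    case less
    then have p: "(logpow q has_real_derivative logpow_deriv q (- y)) (at (- y))"
      "(logpow_int q has_real_derivative logpow q (- y)) (at (- y))" using pos[of "- y"] by auto
    have "((\<lambda>y. - logpow q (- y)) has_real_derivative - (- logpow_deriv q (- y))) (at y)"
      using p(1) unfolding DERIV_mirror by (rule DERIV_minus)
    moreover have "((\<lambda>y. logpow_int q (- y)) has_real_derivative - logpow q (- y)) (at y)"
      using p(2) unfolding DERIV_mirror .
    ultimately show ?thesis by (simp add: odd)
  next
    case equal
    \<comment> \<open>Half of the surplus exponent: 2 (\<open>?q\<close> - 2) = q - 2. One half
      absorbs the logarithm, the other tends to 0 with h.\<close>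
    let ?q = "(q + 2) / 2"
    let ?C = "1 / (?q - 2) + 1 / (q - (?q - 2))"
    have lb: "\<bar>h\<bar> powr (?q - 2) * \<bar>ln \<bar>h\<bar>\<bar> \<le> ?C * (1 + \<bar>h\<bar> powr q)" for h
      using q by (intro powr_ln_bound) auto
    have C0: "0 \<le> ?C" using q by (intro add_nonneg_nonneg divide_nonneg_nonneg) auto
    have b1: "\<bar>h\<bar> powr (q - 2) * \<bar>ln \<bar>h\<bar>\<bar> \<le> \<bar>h\<bar> powr (?q - 2) * (?C * (1 + \<bar>h\<bar> powr q))" for h
    proof -
      have "\<bar>h\<bar> powr (q - 2) * \<bar>ln \<bar>h\<bar>\<bar> = \<bar>h\<bar> powr (?q - 2) * (\<bar>h\<bar> powr (?q - 2) * \<bar>ln \<bar>h\<bar>\<bar>)"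
      proof -
        have s: "(?q - 2) + (?q - 2) = q - 2" by (simp add: field_simps)
        show ?thesis using powr_add[of "\<bar>h\<bar>" "?q - 2" "?q - 2"] unfolding s by (simp only: mult.assoc)
      qed
      also have "\<dots> \<le> \<bar>h\<bar> powr (?q - 2) * (?C * (1 + \<bar>h\<bar> powr q))"
        using lb by (intro mult_left_mono) auto
      finally show ?thesis .
    qed
    have z: "((\<lambda>h::real. \<bar>h\<bar> powr a) \<longlongrightarrow> 0) (at 0)" if "0 < a" for a
    proof -
      have "((\<lambda>h::real. \<bar>h\<bar> powr a) \<longlongrightarrow> \<bar>0\<bar> powr a) (at 0)"
        by (rule tendsto_powr2) (use that in \<open>auto intro!: tendsto_eq_intros\<close>)
      then show ?thesis by simp
    qed
    have lim: "((\<lambda>h::real. \<bar>h\<bar> powr (?q - 2) * (?C * (1 + \<bar>h\<bar> powr q))) \<longlongrightarrow> 0 * (?C * (1 + 0))) (at 0)"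
      using q by (intro tendsto_mult tendsto_add tendsto_const z) auto
    then have "(logpow q has_real_derivative 0) (at 0)"
    proof (intro DERIV_at_0I[where b="\<lambda>h. \<bar>h\<bar> powr (?q - 2) * (?C * (1 + \<bar>h\<bar> powr q))"])
      fix h
      have "\<bar>logpow q h\<bar> = \<bar>h\<bar> * (\<bar>h\<bar> powr (q - 2) * \<bar>ln \<bar>h\<bar>\<bar>)" by (simp add: logpow_def abs_mult)
      also have "\<dots> \<le> \<bar>h\<bar> * (\<bar>h\<bar> powr (?q - 2) * (?C * (1 + \<bar>h\<bar> powr q)))"
        by (intro mult_left_mono b1) auto
      finally show "\<bar>logpow q h\<bar> \<le> \<dots>" .
    qed (simp_all add: logpow_def)
    moreover have "(logpow_int q has_real_derivative 0) (at 0)"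
    proof (intro DERIV_at_0I[where b="\<lambda>h. \<bar>h\<bar> * (\<bar>h\<bar> powr (?q - 2) * (?C * (1 + \<bar>h\<bar> powr q))) + \<bar>h\<bar> powr (q - 1)"])
      have "((\<lambda>h::real. \<bar>h\<bar> * (\<bar>h\<bar> powr (?q - 2) * (?C * (1 + \<bar>h\<bar> powr q))) + \<bar>h\<bar> powr (q - 1)) \<longlongrightarrow>
          \<bar>0\<bar> * (0 * (?C * (1 + 0))) + 0) (at 0)"
        using q by (intro tendsto_mult tendsto_add lim z tendsto_rabs tendsto_ident_at) auto
      then show "((\<lambda>h::real. \<bar>h\<bar> * (\<bar>h\<bar> powr (?q - 2) * (?C * (1 + \<bar>h\<bar> powr q))) + \<bar>h\<bar> powr (q - 1)) \<longlongrightarrow> 0) (at 0)"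
        by simp
      fix h
      have e: "\<bar>h\<bar> powr q = \<bar>h\<bar> * (\<bar>h\<bar> * \<bar>h\<bar> powr (q - 2))" "\<bar>h\<bar> powr q = \<bar>h\<bar> * \<bar>h\<bar> powr (q - 1)"
        using powr_mult_base[of "\<bar>h\<bar>" "q - 2"] powr_mult_base[of "\<bar>h\<bar>" "q - 1"] q
        by (cases "h = 0"; simp)+
      have "\<bar>logpow_int q h\<bar> \<le> \<bar>h\<bar> powr q * \<bar>ln \<bar>h\<bar>\<bar> / q + \<bar>h\<bar> powr q / q\<^sup>2"
        unfolding logpow_int_def using q
        by (intro order_trans[OF abs_triangle_ineq4]) (simp add: abs_mult)
      also have "\<dots> \<le> \<bar>h\<bar> powr q * \<bar>ln \<bar>h\<bar>\<bar> / 1 + \<bar>h\<bar> powr q / 1"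
        using q one_le_power[of q 2] by (intro add_mono divide_left_mono) auto
      also have "\<dots> = \<bar>h\<bar> * (\<bar>h\<bar> * (\<bar>h\<bar> powr (q - 2) * \<bar>ln \<bar>h\<bar>\<bar>)) + \<bar>h\<bar> * \<bar>h\<bar> powr (q - 1)"
      proof -
        have "\<bar>h\<bar> powr q * \<bar>ln \<bar>h\<bar>\<bar> = \<bar>h\<bar> * (\<bar>h\<bar> * (\<bar>h\<bar> powr (q - 2) * \<bar>ln \<bar>h\<bar>\<bar>))"
          unfolding e(1) by (simp only: mult.assoc)
        then show ?thesis using e(2) by simp
      qed
      also have "\<dots> \<le> \<bar>h\<bar> * (\<bar>h\<bar> * (\<bar>h\<bar> powr (?q - 2) * (?C * (1 + \<bar>h\<bar> powr q)))) + \<bar>h\<bar> * \<bar>h\<bar> powr (q - 1)"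
        by (intro add_mono mult_left_mono b1) auto
      finally show "\<bar>logpow_int q h\<bar> \<le> \<bar>h\<bar> * (\<bar>h\<bar> * (\<bar>h\<bar> powr (?q - 2) * (?C * (1 + \<bar>h\<bar> powr q))) + \<bar>h\<bar> powr (q - 1))"
        by (simp add: distrib_left)
    qed (use q in \<open>simp add: logpow_int_def\<close>)
    ultimately show ?thesis using equal by (simp add: logpow_deriv_def logpow_def)
  qed
  then show "(logpow q has_real_derivative logpow_deriv q y) (at y)"
    and "(logpow_int q has_real_derivative logpow q y) (at y)" by auto
qed

text \<open>The mean value theorem for \<open>logpow q\<close>, then for \<open>logpow_int q\<close>
  minus its linearisation at b; the constant is uniform in q because that of
  \<open>powr_ln_bound\<close> is. The first estimate makes the source Lipschitz, the second serves
  to differentiate its potential.\<close>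

lemma logpow_growth:
  assumes p: "2 < p1" "p1 \<le> p2" "p2 - 2 < m"
  shows "\<exists>L\<ge>0. \<forall>q\<in>{p1..p2}. \<forall>a b. \<bar>logpow q a - logpow q b\<bar> \<le> L * (1 + \<bar>a\<bar> powr m + \<bar>b\<bar> powr m) * \<bar>a - b\<bar> \<and>
    \<bar>logpow_int q a - logpow_int q b - logpow q b * (a - b)\<bar> \<le> L * (1 + \<bar>a\<bar> powr m + \<bar>b\<bar> powr m) * \<bar>a - b\<bar>\<^sup>2"
proof -
  define C where "C = 1 / (p1 - 2) + 1 / (m - (p2 - 2))"
  \<comment> \<open>From |logpow_deriv q z| \<le> (q - 1) |z|^(q-2) |ln |z|| + |z|^(q-2). The final
    constant is 2 L, since for z between a and b the weight of z and b is at most twice that of a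
    and b.\<close>
  define L where "L = p2 * C + 1"
  have C0: "0 \<le> C" using p by (simp add: C_def)
  have L0: "0 \<le> L" using C0 p by (simp add: L_def)
  have m0: "0 < m" using p by simp
  let ?w = "\<lambda>a b. 1 + \<bar>a\<bar> powr m + \<bar>b\<bar> powr m"
  have seg: "\<bar>z\<bar> powr m \<le> \<bar>a\<bar> powr m + \<bar>b\<bar> powr m" if "z \<in> closed_segment a b" for z a b :: real
  proof -
    have "\<bar>z\<bar> \<le> max \<bar>a\<bar> \<bar>b\<bar>" using that by (auto simp: closed_segment_eq_real_ivl split: if_splits)
    then have "\<bar>z\<bar> powr m \<le> (max \<bar>a\<bar> \<bar>b\<bar>) powr m" using m0 by (intro powr_mono2) auto
    also have "\<dots> \<le> \<bar>a\<bar> powr m + \<bar>b\<bar> powr m" by (simp add: max_def)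
    finally show ?thesis .
  qed
  have lip: "\<bar>logpow q a - logpow q b\<bar> \<le> L * ?w a b * \<bar>a - b\<bar>" if q: "q \<in> {p1..p2}" for q a b
  proof -
    have D: "\<bar>logpow_deriv q z\<bar> \<le> L * (1 + \<bar>z\<bar> powr m)" for z
    proof -
      have "\<bar>logpow_deriv q z\<bar> \<le> (q - 1) * (\<bar>z\<bar> powr (q - 2) * \<bar>ln \<bar>z\<bar>\<bar>) + \<bar>z\<bar> powr (q - 2)"
      proof -
        have "\<bar>(q - 1) * ln \<bar>z\<bar> + 1\<bar> \<le> (q - 1) * \<bar>ln \<bar>z\<bar>\<bar> + 1"
          using q p abs_triangle_ineq[of "(q - 1) * ln \<bar>z\<bar>" 1] by (simp add: abs_mult)
        then have "\<bar>z\<bar> powr (q - 2) * \<bar>(q - 1) * ln \<bar>z\<bar> + 1\<bar> \<le> \<bar>z\<bar> powr (q - 2) * ((q - 1) * \<bar>ln \<bar>z\<bar>\<bar> + 1)"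
          by (intro mult_left_mono) auto
        moreover have "\<bar>logpow_deriv q z\<bar> = \<bar>z\<bar> powr (q - 2) * \<bar>(q - 1) * ln \<bar>z\<bar> + 1\<bar>"
          by (simp add: logpow_deriv_def abs_mult)
        moreover have "\<bar>z\<bar> powr (q - 2) * ((q - 1) * \<bar>ln \<bar>z\<bar>\<bar> + 1)
            = (q - 1) * (\<bar>z\<bar> powr (q - 2) * \<bar>ln \<bar>z\<bar>\<bar>) + \<bar>z\<bar> powr (q - 2)"
          by (simp add: algebra_simps)
        ultimately show ?thesis by simp
      qed
      also have "\<dots> \<le> p2 * (C * (1 + \<bar>z\<bar> powr m)) + (1 + \<bar>z\<bar> powr m)"
        using q p C0 powr_ln_bound[of p1 q p2 m z] unfolding C_def[symmetric]
        by (intro add_mono[OF mult_mono powr_le_1_plus_powr]) auto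
      finally show ?thesis by (simp add: L_def algebra_simps)
    qed
    have "norm (logpow q a - logpow q b) \<le> L * ?w a b * norm (a - b)"
    proof (rule field_differentiable_bound[of "closed_segment a b" _ "logpow_deriv q"])
      fix z assume z: "z \<in> closed_segment a b"
      show "(logpow q has_real_derivative logpow_deriv q z) (at z within closed_segment a b)"
        using logpow_has_derivative(1)[of q z] q p by (simp add: has_field_derivative_at_within)
      have "\<bar>logpow_deriv q z\<bar> \<le> L * (1 + \<bar>z\<bar> powr m)" by (rule D)
      also have "\<dots> \<le> L * ?w a b" using seg[OF z] L0 by (intro mult_left_mono) auto
      finally show "norm (logpow_deriv q z) \<le> L * ?w a b" by simp
    qed auto
    then show ?thesis by simp
  qed
  have "\<bar>logpow_int q a - logpow_int q b - logpow q b * (a - b)\<bar> \<le> 2 * L * ?w a b * \<bar>a - b\<bar>\<^sup>2"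
    if q: "q \<in> {p1..p2}" for q a b
  proof -
    let ?h = "\<lambda>y. logpow_int q y - logpow q b * y"
    have "norm (?h a - ?h b) \<le> (2 * L * ?w a b * \<bar>a - b\<bar>) * norm (a - b)"
    proof (rule field_differentiable_bound[of "closed_segment a b" _ "\<lambda>z. logpow q z - logpow q b"])
      fix z assume z: "z \<in> closed_segment a b"
      have "(?h has_real_derivative logpow q z - logpow q b * 1) (at z)"
        using logpow_has_derivative(2)[of q z] q p by (intro DERIV_diff DERIV_cmult DERIV_ident) auto
      then show "(?h has_real_derivative logpow q z - logpow q b) (at z within closed_segment a b)"
        by (simp add: has_field_derivative_at_within)
      have "\<bar>logpow q z - logpow q b\<bar> \<le> L * ?w z b * \<bar>z - b\<bar>" by (rule lip[OF q])
      also have "\<dots> \<le> L * (2 * ?w a b) * \<bar>a - b\<bar>"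
      proof (intro mult_mono mult_left_mono L0)
        show "?w z b \<le> 2 * ?w a b"
          using seg[OF z] powr_ge_zero[of "\<bar>a\<bar>" m] by argo
        show "\<bar>z - b\<bar> \<le> \<bar>a - b\<bar>" using z by (auto simp: closed_segment_eq_real_ivl split: if_splits)
      qed (use L0 in \<open>auto intro!: mult_nonneg_nonneg add_nonneg_nonneg\<close>)
      also have "L * (2 * ?w a b) * \<bar>a - b\<bar> = 2 * L * ?w a b * \<bar>a - b\<bar>" by (simp only: mult.assoc mult.left_commute)
      finally show "norm (logpow q z - logpow q b) \<le> 2 * L * ?w a b * \<bar>a - b\<bar>" by simp
    qed auto
    moreover have "?h a - ?h b = logpow_int q a - logpow_int q b - logpow q b * (a - b)"
      by (simp add: algebra_simps)
    moreover have "(2 * L * ?w a b * \<bar>a - b\<bar>) * norm (a - b) = 2 * L * ?w a b * \<bar>a - b\<bar>\<^sup>2"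
      by (simp only: power2_eq_square mult.assoc real_norm_def)
    ultimately show ?thesis by (simp only: real_norm_def)
  qed
  moreover have "\<bar>logpow q a - logpow q b\<bar> \<le> 2 * L * ?w a b * \<bar>a - b\<bar>" if "q \<in> {p1..p2}" for q a b
  proof (rule order_trans[OF lip[OF that]])
    have "0 \<le> L * ?w a b * \<bar>a - b\<bar>" using L0 by (intro mult_nonneg_nonneg add_nonneg_nonneg) auto
    moreover have "2 * L * ?w a b * \<bar>a - b\<bar> = L * ?w a b * \<bar>a - b\<bar> + L * ?w a b * \<bar>a - b\<bar>"
      by (simp only: mult_2[symmetric] mult.assoc)
    ultimately show "L * ?w a b * \<bar>a - b\<bar> \<le> 2 * L * ?w a b * \<bar>a - b\<bar>"
      by (simp only: le_add_same_cancel1)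
  qed
  ultimately show ?thesis using L0 by (intro exI[of _ "2 * L"]) auto
qed

section \<open>The source as a map from H^1_0 to L2\<close>

lemma L2_I:
  fixes f :: "real^'n::finite \<Rightarrow> real"
  assumes "f \<in> borel_measurable (lebesgue_on \<Omega>)" "integrable (lebesgue_on \<Omega>) (\<lambda>x. (f x)\<^sup>2)"
  shows "f \<in> L2 \<Omega>"
  using assms by (simp add: L2_def)

lemma L2_dominated:
  fixes f h :: "real^'n::finite \<Rightarrow> real"
  assumes f: "f \<in> borel_measurable (lebesgue_on \<Omega>)" and h: "h \<in> L2 \<Omega>" and c: "0 \<le> c"
    and le: "AE x in lebesgue_on \<Omega>. \<bar>f x\<bar> \<le> c * \<bar>h x\<bar>"
  shows "f \<in> L2 \<Omega>" "Lnorm \<Omega> 2 f \<le> c * Lnorm \<Omega> 2 h"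
proof -
  have sq: "AE x in lebesgue_on \<Omega>. (f x)\<^sup>2 \<le> c\<^sup>2 * (h x)\<^sup>2"
    using le
  proof eventually_elim
    fix x assume "\<bar>f x\<bar> \<le> c * \<bar>h x\<bar>"
    then have "\<bar>f x\<bar>\<^sup>2 \<le> (c * \<bar>h x\<bar>)\<^sup>2" by (intro power_mono) auto
    then show "(f x)\<^sup>2 \<le> c\<^sup>2 * (h x)\<^sup>2" by (simp add: power_mult_distrib)
  qed
  have ih: "integrable (lebesgue_on \<Omega>) (\<lambda>x. c\<^sup>2 * (h x)\<^sup>2)" using L2_integrable[OF h] by simp
  have i: "integrable (lebesgue_on \<Omega>) (\<lambda>x. (f x)\<^sup>2)"
  proof (rule Bochner_Integration.integrable_bound[OF ih borel_measurable_power[OF f]])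
    show "AE x in lebesgue_on \<Omega>. norm ((f x)\<^sup>2) \<le> norm (c\<^sup>2 * (h x)\<^sup>2)"
      using sq by eventually_elim simp
  qed
  show "f \<in> L2 \<Omega>" by (rule L2_I[OF f i])
  have "(LINT x|lebesgue_on \<Omega>. (f x)\<^sup>2) \<le> (LINT x|lebesgue_on \<Omega>. c\<^sup>2 * (h x)\<^sup>2)"
    by (rule integral_mono_AE[OF i ih sq])
  then have "(Lnorm \<Omega> 2 f)\<^sup>2 \<le> (c * Lnorm \<Omega> 2 h)\<^sup>2"
    by (simp add: power_mult_distrib Lnorm_2_sq L2_inner_self)
  then show "Lnorm \<Omega> 2 f \<le> c * Lnorm \<Omega> 2 h"
    by (rule power2_le_imp_le) (simp add: c Lnorm_nonneg)
qed

text \<open>Hoelder with weights 2m/(2m+2) and 2/(2m+2) splits |v|^(2m) |d|^2 into two integrals of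
  (2m+2)-th powers, which the subcritical Sobolev inequality bounds.\<close>

lemma weighted_L2_bound:
  fixes \<Omega> :: "(real^'n::finite) set"
  assumes O: "open \<Omega>" "bounded \<Omega>" and m: "0 < m" "real CARD('n) * (1/2 - 1/(2 * m + 2)) < 1"
  shows "\<exists>K\<ge>0. \<forall>v\<in>H10 \<Omega>. \<forall>w\<in>H10 \<Omega>. \<forall>d\<in>H10 \<Omega>.
    (\<lambda>x. (1 + \<bar>v x\<bar> powr m + \<bar>w x\<bar> powr m) * d x) \<in> L2 \<Omega> \<and>
    Lnorm \<Omega> 2 (\<lambda>x. (1 + \<bar>v x\<bar> powr m + \<bar>w x\<bar> powr m) * d x) \<le>
      K * sqrt (1 + Lnorm \<Omega> 2 (wgrad \<Omega> v) powr (2 * m) + Lnorm \<Omega> 2 (wgrad \<Omega> w) powr (2 * m)) * Lnorm \<Omega> 2 (wgrad \<Omega> d)"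
proof -
  let ?r = "2 * m + 2" and ?\<theta> = "2 * m / (2 * m + 2)"
  let ?g = "\<lambda>v. Lnorm \<Omega> 2 (wgrad \<Omega> v)"
  have r: "2 \<le> ?r" using m by simp
  obtain c where c: "0 \<le> c" and ci: "\<And>v. v \<in> H10 \<Omega> \<Longrightarrow> integrable (lebesgue_on \<Omega>) (\<lambda>x. \<bar>v x\<bar> powr ?r)"
    and cb: "\<And>v. v \<in> H10 \<Omega> \<Longrightarrow> (LINT x|lebesgue_on \<Omega>. \<bar>v x\<bar> powr ?r) \<le> c * ?g v powr ?r"
    using H10_Sobolev[OF O r m(2)] by blast
  obtain c2 where c2: "0 \<le> c2" "\<And>v. v \<in> H10 \<Omega> \<Longrightarrow> (Lnorm \<Omega> 2 v)\<^sup>2 \<le> c2 * (?g v)\<^sup>2"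
    using H10_Poincare[OF O] by blast
  have th: "0 < ?\<theta>" "?\<theta> < 1" "1 - ?\<theta> = 2 / ?r" using m by (auto simp: field_simps)
  have hol: "integrable (lebesgue_on \<Omega>) (\<lambda>x. (\<bar>v x\<bar> powr m * d x)\<^sup>2) \<and>
      (LINT x|lebesgue_on \<Omega>. (\<bar>v x\<bar> powr m * d x)\<^sup>2) \<le> c * (?g v powr (2 * m) * (?g d)\<^sup>2)"
    if v: "v \<in> H10 \<Omega>" and d: "d \<in> H10 \<Omega>" for v d
  proof -
    have e: "(\<bar>v x\<bar> powr ?r) powr ?\<theta> * (\<bar>d x\<bar> powr ?r) powr (1 - ?\<theta>) = (\<bar>v x\<bar> powr m * d x)\<^sup>2" for x
    proof -
      have 1: "?r * ?\<theta> = m * 2" "?r * (2 / ?r) = 2" using m by (simp_all add: field_simps)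
      have "(\<bar>v x\<bar> powr ?r) powr ?\<theta> = (\<bar>v x\<bar> powr m) powr 2" unfolding powr_powr 1(1) ..
      also have "\<dots> = (\<bar>v x\<bar> powr m)\<^sup>2" by simp
      finally have a: "(\<bar>v x\<bar> powr ?r) powr ?\<theta> = (\<bar>v x\<bar> powr m)\<^sup>2" .
      have "(\<bar>d x\<bar> powr ?r) powr (1 - ?\<theta>) = \<bar>d x\<bar> powr 2" unfolding powr_powr th(3) 1(2) ..
      also have "\<dots> = (d x)\<^sup>2" by simp
      finally show ?thesis unfolding a by (simp add: power_mult_distrib)
    qed
    note H = Hoelder_integral[OF ci[OF v] ci[OF d] powr_ge_zero powr_ge_zero th(1,2), unfolded e]
    have "(LINT x|lebesgue_on \<Omega>. (\<bar>v x\<bar> powr m * d x)\<^sup>2)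
        \<le> (c * ?g v powr ?r) powr ?\<theta> * (c * ?g d powr ?r) powr (1 - ?\<theta>)"
      using th c m by (intro order_trans[OF H(2)] mult_mono powr_mono2 cb v d) auto
    also have "\<dots> = (c powr ?\<theta> * c powr (1 - ?\<theta>)) * (?g v powr (2 * m) * (?g d)\<^sup>2)"
    proof -
      have 1: "?r * ?\<theta> = 2 * m" "?r * (2 / ?r) = 2" using m by (simp_all add: field_simps)
      have "(c * ?g v powr ?r) powr ?\<theta> = c powr ?\<theta> * ?g v powr (2 * m)"
        unfolding powr_mult powr_powr 1(1) ..
      moreover have "(c * ?g d powr ?r) powr (1 - ?\<theta>) = c powr (1 - ?\<theta>) * ?g d powr 2"
        unfolding powr_mult powr_powr th(3) 1(2) ..
      ultimately show ?thesis using Lnorm_nonneg[of \<Omega> 2 "wgrad \<Omega> d"] by (simp add: mult.assoc mult.left_commute)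
    qed
    also have "c powr ?\<theta> * c powr (1 - ?\<theta>) = c" using c by (simp add: powr_add[symmetric])
    finally show ?thesis using H(1) by simp
  qed
  \<comment> \<open>The 3 is from the square of a sum of three terms, \<open>c2\<close> from
    Poincare for the summand 1 of the weight, \<open>c\<close> from Sobolev for the other two
    summands.\<close>
  let ?K = "sqrt (3 * (c2 + c))"
  show ?thesis
  proof (intro exI[of _ ?K] conjI ballI)
    show "0 \<le> ?K" using c c2 by simp
    fix v w d assume v: "v \<in> H10 \<Omega>" and w: "w \<in> H10 \<Omega>" and d: "d \<in> H10 \<Omega>"
    let ?f = "\<lambda>x. (1 + \<bar>v x\<bar> powr m + \<bar>w x\<bar> powr m) * d x"
    let ?b = "\<lambda>x. 3 * ((d x)\<^sup>2 + (\<bar>v x\<bar> powr m * d x)\<^sup>2 + (\<bar>w x\<bar> powr m * d x)\<^sup>2)"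
    have [measurable]: "v \<in> borel_measurable (lebesgue_on \<Omega>)" "w \<in> borel_measurable (lebesgue_on \<Omega>)"
      "d \<in> borel_measurable (lebesgue_on \<Omega>)"
      using H10_L2 L2_measurable v w d by blast+
    have fm: "?f \<in> borel_measurable (lebesgue_on \<Omega>)" by measurable
    have three: "(a + b + e)\<^sup>2 \<le> 3 * (a\<^sup>2 + b\<^sup>2 + e\<^sup>2)" for a b e :: real
      using zero_le_power2[of "a - b"] zero_le_power2[of "a - e"] zero_le_power2[of "b - e"]
      by (simp add: power2_eq_square algebra_simps)
    have le: "(?f x)\<^sup>2 \<le> ?b x" for x
      using three[of "d x" "\<bar>v x\<bar> powr m * d x" "\<bar>w x\<bar> powr m * d x"] by (simp add: distrib_right)
    have id: "integrable (lebesgue_on \<Omega>) (\<lambda>x. (d x)\<^sup>2)" using L2_integrable[OF H10_L2(1)[OF d]] by simp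
    have ib: "integrable (lebesgue_on \<Omega>) ?b"
      using id hol[OF v d] hol[OF w d] by (intro integrable_mult_right Bochner_Integration.integrable_add) auto
    have i: "integrable (lebesgue_on \<Omega>) (\<lambda>x. (?f x)\<^sup>2)"
      by (rule Bochner_Integration.integrable_bound[OF ib])
        (use le in \<open>auto intro!: AE_I2 order_trans[OF le]\<close>)
    show f: "?f \<in> L2 \<Omega>" by (rule L2_I[OF fm i])
    have "(Lnorm \<Omega> 2 ?f)\<^sup>2 \<le> (LINT x|lebesgue_on \<Omega>. ?b x)"
      unfolding Lnorm_2_sq L2_inner_self real_norm_def power2_abs by (intro integral_mono i ib le)
    also have "\<dots> = 3 * ((LINT x|lebesgue_on \<Omega>. (d x)\<^sup>2) + (LINT x|lebesgue_on \<Omega>. (\<bar>v x\<bar> powr m * d x)\<^sup>2)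
        + (LINT x|lebesgue_on \<Omega>. (\<bar>w x\<bar> powr m * d x)\<^sup>2))"
      using id hol[OF v d] hol[OF w d] by simp
    also have "\<dots> \<le> 3 * (c2 * (?g d)\<^sup>2 + c * (?g v powr (2 * m) * (?g d)\<^sup>2) + c * (?g w powr (2 * m) * (?g d)\<^sup>2))"
      using c2(2)[OF d] hol[OF v d] hol[OF w d] unfolding Lnorm_2_sq[of \<Omega> d] L2_inner_self real_norm_def power2_abs
      by (intro mult_left_mono add_mono) auto
    also have "\<dots> \<le> 3 * (c2 + c) * (1 + ?g v powr (2 * m) + ?g w powr (2 * m)) * (?g d)\<^sup>2"
    proof -
      have "c2 * G + c * (A * G) + c * (B * G) \<le> (c2 + c) * (1 + A + B) * G" if "0 \<le> A" "0 \<le> B" "0 \<le> G" for A B G :: real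
      proof -
        have "(c2 + c) * (1 + A + B) * G - (c2 * G + c * (A * G) + c * (B * G)) = c2 * (A * G) + c2 * (B * G) + c * G"
          by (simp add: algebra_simps)
        moreover have "0 \<le> c2 * (A * G) + c2 * (B * G) + c * G"
          using that c c2(1) by (intro add_nonneg_nonneg mult_nonneg_nonneg) auto
        ultimately show ?thesis by linarith
      qed
      from this[of "?g v powr (2 * m)" "?g w powr (2 * m)" "(?g d)\<^sup>2"]
      have "3 * (c2 * (?g d)\<^sup>2 + c * (?g v powr (2 * m) * (?g d)\<^sup>2) + c * (?g w powr (2 * m) * (?g d)\<^sup>2))
          \<le> 3 * ((c2 + c) * (1 + ?g v powr (2 * m) + ?g w powr (2 * m)) * (?g d)\<^sup>2)"
        by (intro mult_left_mono) auto
      then show ?thesis by (simp only: mult.assoc)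
    qed
    also have "\<dots> = (?K * sqrt (1 + ?g v powr (2 * m) + ?g w powr (2 * m)) * ?g d)\<^sup>2"
      using c c2(1) by (simp add: power_mult_distrib add_nonneg_nonneg)
    finally show "Lnorm \<Omega> 2 ?f \<le> ?K * sqrt (1 + ?g v powr (2 * m) + ?g w powr (2 * m)) * ?g d"
      using c c2(1) by (rule_tac power2_le_imp_le) (auto intro!: mult_nonneg_nonneg add_nonneg_nonneg simp: Lnorm_nonneg)
  qed
qed

lemma log_source_eq: "log_source p v x = logpow (p x) (v x)"
  by (simp add: log_source_def logpow_def)

text \<open>The remainder of the potential carries one difference in the gradient norm and one in
  the L2 norm. This matches a curve that is continuous in the first norm and differentiable only in
  the second: after division by the time step a factor tending to 0 is left.\<close>

lemma log_source_L2_bounds: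
  fixes \<Omega> :: "(real^'n::finite) set"
  assumes O: "open \<Omega>" "bounded \<Omega>" and pm: "p \<in> borel_measurable (lebesgue_on \<Omega>)"
    and pae: "AE x in lebesgue_on \<Omega>. p x \<in> {p1..p2}" and p: "2 < p1" "p1 \<le> p2" "p2 - 2 < m"
    and m: "real CARD('n) * (1/2 - 1/(2 * m + 2)) < 1"
  shows "\<exists>K\<ge>0. \<forall>v\<in>H10 \<Omega>. \<forall>w\<in>H10 \<Omega>.
    log_source p v \<in> L2 \<Omega> \<and> integrable (lebesgue_on \<Omega>) (\<lambda>x. logpow_int (p x) (v x)) \<and>
    Lnorm \<Omega> 2 (\<lambda>x. log_source p v x - log_source p w x) \<le>
      K * sqrt (1 + Lnorm \<Omega> 2 (wgrad \<Omega> v) powr (2 * m) + Lnorm \<Omega> 2 (wgrad \<Omega> w) powr (2 * m))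
        * Lnorm \<Omega> 2 (\<lambda>x. wgrad \<Omega> v x - wgrad \<Omega> w x) \<and>
    \<bar>(LINT x|lebesgue_on \<Omega>. logpow_int (p x) (v x)) - (LINT x|lebesgue_on \<Omega>. logpow_int (p x) (w x))
        - L2_inner \<Omega> (log_source p w) (\<lambda>x. v x - w x)\<bar> \<le>
      K * sqrt (1 + Lnorm \<Omega> 2 (wgrad \<Omega> v) powr (2 * m) + Lnorm \<Omega> 2 (wgrad \<Omega> w) powr (2 * m))
        * Lnorm \<Omega> 2 (\<lambda>x. wgrad \<Omega> v x - wgrad \<Omega> w x) * Lnorm \<Omega> 2 (\<lambda>x. v x - w x)"
proof -
  have m0: "0 < m" using p by simp
  obtain K where K: "0 \<le> K" and KL: "\<And>v w d. v \<in> H10 \<Omega> \<Longrightarrow> w \<in> H10 \<Omega> \<Longrightarrow> d \<in> H10 \<Omega> \<Longrightarrow>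
      (\<lambda>x. (1 + \<bar>v x\<bar> powr m + \<bar>w x\<bar> powr m) * d x) \<in> L2 \<Omega>"
    and KB: "\<And>v w d. v \<in> H10 \<Omega> \<Longrightarrow> w \<in> H10 \<Omega> \<Longrightarrow> d \<in> H10 \<Omega> \<Longrightarrow>
      Lnorm \<Omega> 2 (\<lambda>x. (1 + \<bar>v x\<bar> powr m + \<bar>w x\<bar> powr m) * d x) \<le>
      K * sqrt (1 + Lnorm \<Omega> 2 (wgrad \<Omega> v) powr (2 * m) + Lnorm \<Omega> 2 (wgrad \<Omega> w) powr (2 * m)) * Lnorm \<Omega> 2 (wgrad \<Omega> d)"
    using weighted_L2_bound[OF O m0 m] by blast
  obtain L where L: "0 \<le> L" and lip: "\<And>q a b. q \<in> {p1..p2} \<Longrightarrow> \<bar>logpow q a - logpow q b\<bar> \<le> L * (1 + \<bar>a\<bar> powr m + \<bar>b\<bar> powr m) * \<bar>a - b\<bar>"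
    and tay: "\<And>q a b. q \<in> {p1..p2} \<Longrightarrow> \<bar>logpow_int q a - logpow_int q b - logpow q b * (a - b)\<bar> \<le> L * (1 + \<bar>a\<bar> powr m + \<bar>b\<bar> powr m) * \<bar>a - b\<bar>\<^sup>2"
    using logpow_growth[OF p] by blast
  have ms: "log_source p v \<in> borel_measurable (lebesgue_on \<Omega>)"
    and mi: "(\<lambda>x. logpow_int (p x) (v x)) \<in> borel_measurable (lebesgue_on \<Omega>)" if "v \<in> H10 \<Omega>" for v
  proof -
    have [measurable]: "v \<in> borel_measurable (lebesgue_on \<Omega>)" using H10_L2 L2_measurable that by blast
    note pm[measurable]
    show "log_source p v \<in> borel_measurable (lebesgue_on \<Omega>)" unfolding log_source_def by measurable
    show "(\<lambda>x. logpow_int (p x) (v x)) \<in> borel_measurable (lebesgue_on \<Omega>)" unfolding logpow_int_def by measurable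
  qed
  have one: "log_source p v \<in> L2 \<Omega> \<and> integrable (lebesgue_on \<Omega>) (\<lambda>x. logpow_int (p x) (v x))"
    if v: "v \<in> H10 \<Omega>" for v
  proof
    let ?h = "\<lambda>x. (1 + \<bar>v x\<bar> powr m + \<bar>v x\<bar> powr m) * v x"
    have h: "?h \<in> L2 \<Omega>" by (rule KL[OF v v v])
    have w: "1 + \<bar>a\<bar> powr m + \<bar>0\<bar> powr m \<le> 1 + \<bar>a\<bar> powr m + \<bar>a\<bar> powr m" for a :: real by simp
    have "AE x in lebesgue_on \<Omega>. \<bar>log_source p v x\<bar> \<le> L * \<bar>?h x\<bar>"
      using pae
    proof eventually_elim
      fix x assume "p x \<in> {p1..p2}"
      from lip[OF this, of "v x" 0]
      have "\<bar>log_source p v x\<bar> \<le> L * (1 + \<bar>v x\<bar> powr m + \<bar>0\<bar> powr m) * \<bar>v x\<bar>"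
        by (simp add: log_source_eq logpow_def)
      also have "\<dots> \<le> L * (1 + \<bar>v x\<bar> powr m + \<bar>v x\<bar> powr m) * \<bar>v x\<bar>"
        using L w by (intro mult_right_mono mult_left_mono) auto
      also have "\<dots> = L * \<bar>?h x\<bar>" by (simp add: abs_mult mult.assoc)
      finally show "\<bar>log_source p v x\<bar> \<le> L * \<bar>?h x\<bar>" .
    qed
    then show "log_source p v \<in> L2 \<Omega>" by (intro L2_dominated(1)[OF ms[OF v] h L])
    have ih: "integrable (lebesgue_on \<Omega>) (\<lambda>x. L * (?h x * v x))"
      using L2_inner_integrable[OF h H10_L2(1)[OF v]] by simp
    show "integrable (lebesgue_on \<Omega>) (\<lambda>x. logpow_int (p x) (v x))"
    proof (rule Bochner_Integration.integrable_bound[OF ih mi[OF v]])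
      show "AE x in lebesgue_on \<Omega>. norm (logpow_int (p x) (v x)) \<le> norm (L * (?h x * v x))"
        using pae
      proof eventually_elim
        fix x assume "p x \<in> {p1..p2}"
        then have "p x \<noteq> 0" using p by auto
        with tay[OF \<open>p x \<in> {p1..p2}\<close>, of "v x" 0]
        have "\<bar>logpow_int (p x) (v x)\<bar> \<le> L * (1 + \<bar>v x\<bar> powr m + \<bar>0\<bar> powr m) * \<bar>v x\<bar>\<^sup>2"
          by (simp add: logpow_int_def logpow_def)
        also have "\<dots> \<le> L * (1 + \<bar>v x\<bar> powr m + \<bar>v x\<bar> powr m) * \<bar>v x\<bar>\<^sup>2"
          using L w by (intro mult_right_mono mult_left_mono) auto
        also have "\<dots> = norm (L * (?h x * v x))"
          using L by (simp add: abs_mult power2_eq_square mult.assoc)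
        finally show "norm (logpow_int (p x) (v x)) \<le> norm (L * (?h x * v x))" by simp
      qed
    qed
  qed
  show ?thesis
  proof (intro exI[of _ "L * K"] ballI conjI)
    show "0 \<le> L * K" using L K by simp
    fix v w assume v: "v \<in> H10 \<Omega>" and w: "w \<in> H10 \<Omega>"
    show "log_source p v \<in> L2 \<Omega>" "integrable (lebesgue_on \<Omega>) (\<lambda>x. logpow_int (p x) (v x))"
      using one[OF v] by auto
    let ?d = "\<lambda>x. v x - w x"
    let ?h = "\<lambda>x. (1 + \<bar>v x\<bar> powr m + \<bar>w x\<bar> powr m) * ?d x"
    let ?B = "sqrt (1 + Lnorm \<Omega> 2 (wgrad \<Omega> v) powr (2 * m) + Lnorm \<Omega> 2 (wgrad \<Omega> w) powr (2 * m))
        * Lnorm \<Omega> 2 (\<lambda>x. wgrad \<Omega> v x - wgrad \<Omega> w x)"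
    have d: "?d \<in> H10 \<Omega>" by (rule H10_diff[OF O v w])
    have h: "?h \<in> L2 \<Omega>" by (rule KL[OF v w d])
    have hB: "Lnorm \<Omega> 2 ?h \<le> K * ?B"
      using KB[OF v w d] by (simp add: Lnorm_wgrad_diff[OF O H10_H1[OF v] H10_H1[OF w]] mult.assoc)
    have "Lnorm \<Omega> 2 (\<lambda>x. log_source p v x - log_source p w x) \<le> L * Lnorm \<Omega> 2 ?h"
    proof (rule L2_dominated(2)[OF _ h L])
      show "(\<lambda>x. log_source p v x - log_source p w x) \<in> borel_measurable (lebesgue_on \<Omega>)"
        using ms v w by simp
      show "AE x in lebesgue_on \<Omega>. \<bar>log_source p v x - log_source p w x\<bar> \<le> L * \<bar>?h x\<bar>"
        using pae
      proof eventually_elim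
        fix x assume "p x \<in> {p1..p2}"
        from lip[OF this, of "v x" "w x"]
        show "\<bar>log_source p v x - log_source p w x\<bar> \<le> L * \<bar>?h x\<bar>"
          by (simp add: log_source_eq abs_mult mult.assoc)
      qed
    qed
    also have "\<dots> \<le> L * (K * ?B)" using hB L by (rule mult_left_mono)
    finally show "Lnorm \<Omega> 2 (\<lambda>x. log_source p v x - log_source p w x) \<le> L * K * sqrt (1 + Lnorm \<Omega> 2 (wgrad \<Omega> v) powr (2 * m) + Lnorm \<Omega> 2 (wgrad \<Omega> w) powr (2 * m))
        * Lnorm \<Omega> 2 (\<lambda>x. wgrad \<Omega> v x - wgrad \<Omega> w x)" by (simp add: mult.assoc)
    have dL: "?d \<in> L2 \<Omega>" by (rule H10_L2[OF d])
    have absL: "(\<lambda>x. \<bar>f x\<bar>) \<in> L2 \<Omega>" "Lnorm \<Omega> 2 (\<lambda>x. \<bar>f x\<bar>) = Lnorm \<Omega> 2 f" if "f \<in> L2 \<Omega>" for f :: "real^'n \<Rightarrow> real"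
      using that by (auto simp: L2_def Lnorm_2 L2_inner_self)
    let ?t = "\<lambda>x. logpow_int (p x) (v x) - logpow_int (p x) (w x) - log_source p w x * ?d x"
    have isrc: "integrable (lebesgue_on \<Omega>) (\<lambda>x. log_source p w x * ?d x)"
      using L2_inner_integrable[OF conjunct1[OF one[OF w]] dL] by simp
    have it: "integrable (lebesgue_on \<Omega>) ?t"
      using one[OF v] one[OF w] isrc by (intro Bochner_Integration.integrable_diff) auto
    have ih: "integrable (lebesgue_on \<Omega>) (\<lambda>x. \<bar>?h x\<bar> * \<bar>?d x\<bar>)"
      using L2_inner_integrable[OF absL(1)[OF h] absL(1)[OF dL]] by simp
    have "\<bar>LINT x|lebesgue_on \<Omega>. ?t x\<bar> \<le> (LINT x|lebesgue_on \<Omega>. \<bar>?t x\<bar>)"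
      by (rule integral_abs_bound)
    also have "\<dots> \<le> (LINT x|lebesgue_on \<Omega>. L * (\<bar>?h x\<bar> * \<bar>?d x\<bar>))"
    proof (rule integral_mono_AE)
      show "AE x in lebesgue_on \<Omega>. \<bar>?t x\<bar> \<le> L * (\<bar>?h x\<bar> * \<bar>?d x\<bar>)"
        using pae
      proof eventually_elim
        fix x assume "p x \<in> {p1..p2}"
        from tay[OF this, of "v x" "w x"]
        show "\<bar>?t x\<bar> \<le> L * (\<bar>?h x\<bar> * \<bar>?d x\<bar>)"
          by (simp add: log_source_eq abs_mult mult.assoc power2_eq_square)
      qed
    qed (use it ih in auto)
    also have "\<dots> = L * L2_inner \<Omega> (\<lambda>x. \<bar>?h x\<bar>) (\<lambda>x. \<bar>?d x\<bar>)" by (simp add: L2_inner_def)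
    also have "\<dots> \<le> L * (Lnorm \<Omega> 2 ?h * Lnorm \<Omega> 2 ?d)"
      using L2_inner_Cauchy_Schwarz[OF absL(1)[OF h] absL(1)[OF dL]] absL(2)[OF h] absL(2)[OF dL] L
      by (intro mult_left_mono) auto
    also have "\<dots> \<le> L * (K * ?B * Lnorm \<Omega> 2 ?d)"
      using hB L by (intro mult_left_mono mult_right_mono Lnorm_nonneg)
    finally have "\<bar>LINT x|lebesgue_on \<Omega>. ?t x\<bar> \<le> L * (K * ?B * Lnorm \<Omega> 2 ?d)" .
    moreover have "(LINT x|lebesgue_on \<Omega>. ?t x) = (LINT x|lebesgue_on \<Omega>. logpow_int (p x) (v x))
        - (LINT x|lebesgue_on \<Omega>. logpow_int (p x) (w x)) - L2_inner \<Omega> (log_source p w) ?d"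
      using one[OF v] one[OF w] isrc by (simp add: L2_inner_def)
    ultimately show "\<bar>(LINT x|lebesgue_on \<Omega>. logpow_int (p x) (v x)) - (LINT x|lebesgue_on \<Omega>. logpow_int (p x) (w x))
        - L2_inner \<Omega> (log_source p w) (\<lambda>x. v x - w x)\<bar> \<le>
      L * K * sqrt (1 + Lnorm \<Omega> 2 (wgrad \<Omega> v) powr (2 * m) + Lnorm \<Omega> 2 (wgrad \<Omega> w) powr (2 * m))
        * Lnorm \<Omega> 2 (\<lambda>x. wgrad \<Omega> v x - wgrad \<Omega> w x) * Lnorm \<Omega> 2 (\<lambda>x. v x - w x)" by (simp add: mult.assoc)
  qed
qed

section \<open>Weak solutions\<close>

lemma antimono_has_nonpos_derivative:
  fixes g :: "real \<Rightarrow> real"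
  assumes "antimono_on {0..} g" "(g has_real_derivative D) (at t within {0..})" "0 \<le> t"
  shows "D \<le> 0"
proof (rule tendsto_upperbound)
  show "((\<lambda>y. (g y - g t) / (y - t)) \<longlongrightarrow> D) (at_right t)"
    using has_field_derivative_subset[OF assms(2), of "{t..}"] assms(3)
    by (auto simp: has_field_derivative_iff at_within_Ici_at_right)
  show "\<forall>\<^sub>F y in at_right t. (g y - g t) / (y - t) \<le> 0"
    unfolding eventually_at_filter
    using assms(1,3) by (auto simp: monotone_on_def divide_le_0_iff intro!: always_eventually)
qed simp

lemma integral_reflect_Icc:
  fixes f :: "real \<Rightarrow> real"
  assumes "continuous_on {0..t} f" "0 \<le> t"
  shows "integral {0..t} (\<lambda>s. f (t - s)) = integral {0..t} f"
proof -
  have "(f has_integral integral {0..t} f) {0..t}"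
    using assms by (intro integrable_integral integrable_continuous_real)
  then have "((\<lambda>x. f (- x)) has_integral integral {0..t} f) {- t..- 0}"
    by (simp only: has_integral_reflect_real)
  from has_integral_shift_real_ivl[OF this, of "- t"]
  show ?thesis by (simp add: integral_unique)
qed

text \<open>Continuity of each curve in its own time gives continuity in both times jointly, as the
  two-time arguments require.\<close>

lemma L2_inner_continuous:
  fixes f h :: "real \<Rightarrow> real^'n::finite \<Rightarrow> 'b::euclidean_space"
  assumes f: "\<And>s. 0 \<le> s \<Longrightarrow> f s \<in> L2 \<Omega>" and h: "\<And>s. 0 \<le> s \<Longrightarrow> h s \<in> L2 \<Omega>"
    and lf: "\<And>t. 0 \<le> t \<Longrightarrow> ((\<lambda>s. Lnorm \<Omega> 2 (\<lambda>x. f s x - f t x)) \<longlongrightarrow> 0) (at t within {0..})"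
    and lh: "\<And>t. 0 \<le> t \<Longrightarrow> ((\<lambda>s. Lnorm \<Omega> 2 (\<lambda>x. h s x - h t x)) \<longlongrightarrow> 0) (at t within {0..})"
  shows "continuous_on ({0..} \<times> {0..}) (\<lambda>(s, t). L2_inner \<Omega> (f s) (h t))"
  unfolding continuous_on_def
proof
  fix z :: "real \<times> real" assume z: "z \<in> {0..} \<times> {0..}"
  obtain s t where st: "z = (s, t)" "0 \<le> s" "0 \<le> t" using z by auto
  let ?F = "at z within {0..} \<times> {0..}"
  have zero: "Lnorm \<Omega> 2 (\<lambda>x. 0 :: 'b) = 0" by (simp add: Lnorm_2 L2_inner_self)
  have 1: "((\<lambda>z. Lnorm \<Omega> 2 (\<lambda>x. f (fst z) x - f s x)) \<longlongrightarrow> 0) ?F"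
  proof -
    have "continuous (at s within {0..}) (\<lambda>s'. Lnorm \<Omega> 2 (\<lambda>x. f s' x - f s x))"
      using lf[OF st(2)] by (simp add: continuous_within zero)
    then have c2: "continuous (at (fst z) within fst ` ({0..} \<times> {0::real..})) (\<lambda>s'. Lnorm \<Omega> 2 (\<lambda>x. f s' x - f s x))"
      using st by (auto intro: continuous_within_subset)
    have c1: "continuous ?F fst" by (intro continuous_intros)
    show ?thesis using continuous_within_compose2[OF c1 c2] st by (simp add: continuous_within zero)
  qed
  have 2: "((\<lambda>z. Lnorm \<Omega> 2 (\<lambda>x. h (snd z) x - h t x)) \<longlongrightarrow> 0) ?F"
  proof -
    have "continuous (at t within {0..}) (\<lambda>s'. Lnorm \<Omega> 2 (\<lambda>x. h s' x - h t x))"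
      using lh[OF st(3)] by (simp add: continuous_within zero)
    then have c2: "continuous (at (snd z) within snd ` ({0::real..} \<times> {0..})) (\<lambda>s'. Lnorm \<Omega> 2 (\<lambda>x. h s' x - h t x))"
      using st by (auto intro: continuous_within_subset)
    have c1: "continuous ?F snd" by (intro continuous_intros)
    show ?thesis using continuous_within_compose2[OF c1 c2] st by (simp add: continuous_within zero)
  qed
  have "((\<lambda>z. L2_inner \<Omega> (f (fst z)) (h (snd z))) \<longlongrightarrow> L2_inner \<Omega> (f s) (h t)) ?F"
    by (rule L2_inner_tendsto[of "{0..} \<times> {0..}", OF _ _ _ _ _ 1 2])
      (use st f h in \<open>auto simp: eventually_at_filter\<close>)
  then show "((\<lambda>(s, t). L2_inner \<Omega> (f s) (h t)) \<longlongrightarrow> (case z of (s, t) \<Rightarrow> L2_inner \<Omega> (f s) (h t))) ?F"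
    using st by (simp add: case_prod_unfold)
qed

section \<open>Two-time pairings of a fixed weak solution\<close>

locale damped_wave =
  fixes \<Omega> :: "(real^'n::finite) set" and p u0 u1 :: "real^'n \<Rightarrow> real" and g g' :: "real \<Rightarrow> real"
    and \<alpha> p1 p2 m :: real and u ut :: "real \<Rightarrow> real^'n \<Rightarrow> real"
  assumes O: "open \<Omega>" "bounded \<Omega>"
    and pm: "p \<in> borel_measurable (lebesgue_on \<Omega>)" and pae: "AE x in lebesgue_on \<Omega>. p x \<in> {p1..p2}"
    and p12: "2 < p1" "p1 \<le> p2" "p2 - 2 < m" and m: "real CARD('n) * (1/2 - 1/(2 * m + 2)) < 1"
    and g: "\<And>t. 0 \<le> t \<Longrightarrow> (g has_real_derivative g' t) (at t within {0..})"
    and g': "continuous_on {0..} g'" and gpos: "\<And>t. 0 \<le> t \<Longrightarrow> 0 < g t" and gmono: "antimono_on {0..} g"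
    and sol: "weak_solution \<Omega> \<alpha> p g u0 u1 u ut"
begin

text \<open>Each pairing combines one state at time s with one at time t. With the other state
  frozen, the weak equation and the L2-derivative of u supply partial derivatives that are not
  directly accessible for the quadratic expressions on the diagonal.\<close>

definition "A s t = L2_inner \<Omega> (wgrad \<Omega> (u s)) (wgrad \<Omega> (u t))"
definition "M s t = L2_inner \<Omega> (ut s) (ut t)"
definition "U s t = L2_inner \<Omega> (ut s) (u t)"
definition "N s t = L2_inner \<Omega> (u s) (u t)"
definition "F s t = L2_inner \<Omega> (log_source p (u s)) (u t)"
definition "S s t = L2_inner \<Omega> (log_source p (u s)) (ut t)"
text \<open>The memory force at time s tested with \<open>u t\<close>; \<open>P1\<close> is its
  derivative in s. On the diagonal, \<open>P\<close> together with the convolution \<open>Q\<close>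
  of g with the squared gradient norm recovers the memory functional by expanding its
  square.\<close>

definition "P s t = integral {0..s} (\<lambda>r. g (s - r) * A r t)"
definition "P1 s t = g 0 * A s t + integral {0..s} (\<lambda>r. g' (s - r) * A r t)"
definition "\<Phi> t = (LINT x|lebesgue_on \<Omega>. logpow_int (p x) (u t x))"
definition "R s t = - A s t + P s t - U s t + \<alpha> * F s t"
definition "Q t = integral {0..t} (\<lambda>r. g (t - r) * A r r)"
definition "Q1 t = g 0 * A t t + integral {0..t} (\<lambda>r. g' (t - r) * A r r)"
definition "G t = integral {0..t} g"

lemma u_H10: "0 \<le> t \<Longrightarrow> u t \<in> H10 \<Omega>"
  using sol by (simp add: weak_solution_def C0_H10_def)

lemma in_L2:
  assumes "0 \<le> t"
  shows "u t \<in> L2 \<Omega>" "wgrad \<Omega> (u t) \<in> L2 \<Omega>" "ut t \<in> L2 \<Omega>"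
  using assms H10_L2[OF u_H10[OF assms]] sol by (auto simp: weak_solution_def C1_L2_def)

lemma u_continuous:
  assumes t: "0 \<le> t"
  shows "((\<lambda>s. Lnorm \<Omega> 2 (\<lambda>x. u s x - u t x)) \<longlongrightarrow> 0) (at t within {0..})"
    and "((\<lambda>s. Lnorm \<Omega> 2 (\<lambda>x. wgrad \<Omega> (u s) x - wgrad \<Omega> (u t) x)) \<longlongrightarrow> 0) (at t within {0..})"
proof -
  have "((\<lambda>s. H1_norm \<Omega> (\<lambda>x. u s x - u t x)) \<longlongrightarrow> 0) (at t within {0..})"
    using sol t by (simp add: weak_solution_def C0_H10_def)
  then have l: "((\<lambda>s. Lnorm \<Omega> 2 (\<lambda>x. u s x - u t x)) \<longlongrightarrow> 0) (at t within {0..})"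
    "((\<lambda>s. Lnorm \<Omega> 2 (wgrad \<Omega> (\<lambda>x. u s x - u t x))) \<longlongrightarrow> 0) (at t within {0..})"
    unfolding H1_norm_tendsto_0_iff by auto
  show "((\<lambda>s. Lnorm \<Omega> 2 (\<lambda>x. u s x - u t x)) \<longlongrightarrow> 0) (at t within {0..})" by (rule l)
  show "((\<lambda>s. Lnorm \<Omega> 2 (\<lambda>x. wgrad \<Omega> (u s) x - wgrad \<Omega> (u t) x)) \<longlongrightarrow> 0) (at t within {0..})"
  proof (rule Lim_transform_eventually[OF l(2)])
    have "Lnorm \<Omega> 2 (wgrad \<Omega> (\<lambda>x. u s x - u t x)) = Lnorm \<Omega> 2 (\<lambda>x. wgrad \<Omega> (u s) x - wgrad \<Omega> (u t) x)"
      if "0 \<le> s" for s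
      by (rule Lnorm_wgrad_diff[OF O]) (use that t u_H10 H10_H1 in auto)
    then show "\<forall>\<^sub>F s in at t within {0..}. Lnorm \<Omega> 2 (wgrad \<Omega> (\<lambda>x. u s x - u t x)) =
        Lnorm \<Omega> 2 (\<lambda>x. wgrad \<Omega> (u s) x - wgrad \<Omega> (u t) x)"
      by (simp add: eventually_at_filter)
  qed
qed

lemma ut_continuous:
  "0 \<le> t \<Longrightarrow> ((\<lambda>s. Lnorm \<Omega> 2 (\<lambda>x. ut s x - ut t x)) \<longlongrightarrow> 0) (at t within {0..})"
  using sol by (simp add: weak_solution_def C1_L2_def)

lemma u_quotient:
  "0 \<le> t \<Longrightarrow> ((\<lambda>s. Lnorm \<Omega> 2 (\<lambda>x. (u s x - u t x) / (s - t) - ut t x)) \<longlongrightarrow> 0) (at t within {0..})"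
  using sol by (simp add: weak_solution_def C1_L2_def)

lemma source_bounds:
  "\<exists>K\<ge>0. \<forall>s\<ge>0. \<forall>t\<ge>0.
    log_source p (u s) \<in> L2 \<Omega> \<and> integrable (lebesgue_on \<Omega>) (\<lambda>x. logpow_int (p x) (u s x)) \<and>
    Lnorm \<Omega> 2 (\<lambda>x. log_source p (u s) x - log_source p (u t) x) \<le>
      K * sqrt (1 + Lnorm \<Omega> 2 (wgrad \<Omega> (u s)) powr (2 * m) + Lnorm \<Omega> 2 (wgrad \<Omega> (u t)) powr (2 * m))
        * Lnorm \<Omega> 2 (\<lambda>x. wgrad \<Omega> (u s) x - wgrad \<Omega> (u t) x) \<and>
    \<bar>\<Phi> s - \<Phi> t - L2_inner \<Omega> (log_source p (u t)) (\<lambda>x. u s x - u t x)\<bar> \<le>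
      K * sqrt (1 + Lnorm \<Omega> 2 (wgrad \<Omega> (u s)) powr (2 * m) + Lnorm \<Omega> 2 (wgrad \<Omega> (u t)) powr (2 * m))
        * Lnorm \<Omega> 2 (\<lambda>x. wgrad \<Omega> (u s) x - wgrad \<Omega> (u t) x) * Lnorm \<Omega> 2 (\<lambda>x. u s x - u t x)"
proof -
  from log_source_L2_bounds[OF O pm pae p12 m] obtain K where K: "0 \<le> K" and b: "\<forall>v\<in>H10 \<Omega>. \<forall>w\<in>H10 \<Omega>.
    log_source p v \<in> L2 \<Omega> \<and> integrable (lebesgue_on \<Omega>) (\<lambda>x. logpow_int (p x) (v x)) \<and>
    Lnorm \<Omega> 2 (\<lambda>x. log_source p v x - log_source p w x) \<le>
      K * sqrt (1 + Lnorm \<Omega> 2 (wgrad \<Omega> v) powr (2 * m) + Lnorm \<Omega> 2 (wgrad \<Omega> w) powr (2 * m))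
        * Lnorm \<Omega> 2 (\<lambda>x. wgrad \<Omega> v x - wgrad \<Omega> w x) \<and>
    \<bar>(LINT x|lebesgue_on \<Omega>. logpow_int (p x) (v x)) - (LINT x|lebesgue_on \<Omega>. logpow_int (p x) (w x))
        - L2_inner \<Omega> (log_source p w) (\<lambda>x. v x - w x)\<bar> \<le>
      K * sqrt (1 + Lnorm \<Omega> 2 (wgrad \<Omega> v) powr (2 * m) + Lnorm \<Omega> 2 (wgrad \<Omega> w) powr (2 * m))
        * Lnorm \<Omega> 2 (\<lambda>x. wgrad \<Omega> v x - wgrad \<Omega> w x) * Lnorm \<Omega> 2 (\<lambda>x. v x - w x)" by blast
  show ?thesis
    by (intro exI[of _ K] conjI[OF K] allI impI, unfold \<Phi>_def)
      (rule b[rule_format, OF u_H10 u_H10])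
qed

lemma source_L2: "0 \<le> t \<Longrightarrow> log_source p (u t) \<in> L2 \<Omega>"
  and logpow_int_integrable: "0 \<le> t \<Longrightarrow> integrable (lebesgue_on \<Omega>) (\<lambda>x. logpow_int (p x) (u t x))"
  using source_bounds by blast+

lemma grad_norm_continuous:
  assumes "0 \<le> t"
  shows "((\<lambda>s. Lnorm \<Omega> 2 (wgrad \<Omega> (u s))) \<longlongrightarrow> Lnorm \<Omega> 2 (wgrad \<Omega> (u t))) (at t within {0..})"
proof -
  have "((\<lambda>s. Lnorm \<Omega> 2 (wgrad \<Omega> (u s)) - Lnorm \<Omega> 2 (wgrad \<Omega> (u t))) \<longlongrightarrow> 0) (at t within {0..})"
  proof (rule Lim_null_comparison[OF _ u_continuous(2)[OF assms]])
    show "\<forall>\<^sub>F s in at t within {0..}. norm (Lnorm \<Omega> 2 (wgrad \<Omega> (u s)) - Lnorm \<Omega> 2 (wgrad \<Omega> (u t)))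
        \<le> Lnorm \<Omega> 2 (\<lambda>x. wgrad \<Omega> (u s) x - wgrad \<Omega> (u t) x)"
      using Lnorm_2_diff_bound[OF in_L2(2) in_L2(2)[OF assms]] by (simp add: eventually_at_filter)
  qed
  then show ?thesis by (simp add: LIM_zero_iff)
qed

lemma source_factor_tendsto:
  assumes "0 \<le> t"
  shows "((\<lambda>s. K * sqrt (1 + Lnorm \<Omega> 2 (wgrad \<Omega> (u s)) powr (2 * m) + Lnorm \<Omega> 2 (wgrad \<Omega> (u t)) powr (2 * m))
        * Lnorm \<Omega> 2 (\<lambda>x. wgrad \<Omega> (u s) x - wgrad \<Omega> (u t) x)) \<longlongrightarrow> 0) (at t within {0..})"
proof -
  have m0: "0 < 2 * m" using p12 by simp
  have "((\<lambda>s. K * sqrt (1 + Lnorm \<Omega> 2 (wgrad \<Omega> (u s)) powr (2 * m) + Lnorm \<Omega> 2 (wgrad \<Omega> (u t)) powr (2 * m))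
        * Lnorm \<Omega> 2 (\<lambda>x. wgrad \<Omega> (u s) x - wgrad \<Omega> (u t) x)) \<longlongrightarrow>
      K * sqrt (1 + Lnorm \<Omega> 2 (wgrad \<Omega> (u t)) powr (2 * m) + Lnorm \<Omega> 2 (wgrad \<Omega> (u t)) powr (2 * m)) * 0) (at t within {0..})"
    using m0 by (intro tendsto_mult tendsto_const tendsto_real_sqrt tendsto_add tendsto_powr2
        grad_norm_continuous u_continuous assms) (auto simp: Lnorm_nonneg)
  then show ?thesis by simp
qed

lemma source_continuous:
  assumes t: "0 \<le> t"
  shows "((\<lambda>s. Lnorm \<Omega> 2 (\<lambda>x. log_source p (u s) x - log_source p (u t) x)) \<longlongrightarrow> 0) (at t within {0..})"
proof -
  obtain K where "\<And>s t. 0 \<le> s \<Longrightarrow> 0 \<le> t \<Longrightarrow> Lnorm \<Omega> 2 (\<lambda>x. log_source p (u s) x - log_source p (u t) x) \<le>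
      K * sqrt (1 + Lnorm \<Omega> 2 (wgrad \<Omega> (u s)) powr (2 * m) + Lnorm \<Omega> 2 (wgrad \<Omega> (u t)) powr (2 * m))
        * Lnorm \<Omega> 2 (\<lambda>x. wgrad \<Omega> (u s) x - wgrad \<Omega> (u t) x)"
    using source_bounds by blast
  then show ?thesis
    by (intro Lim_null_comparison[OF _ source_factor_tendsto[OF t, of K]])
      (auto simp: eventually_at_filter Lnorm_nonneg t)
qed

lemma continuous_A: "continuous_on ({0..} \<times> {0..}) (\<lambda>(s, t). A s t)"
  and continuous_M: "continuous_on ({0..} \<times> {0..}) (\<lambda>(s, t). M s t)"
  and continuous_U: "continuous_on ({0..} \<times> {0..}) (\<lambda>(s, t). U s t)"
  and continuous_F: "continuous_on ({0..} \<times> {0..}) (\<lambda>(s, t). F s t)"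
  and continuous_S: "continuous_on ({0..} \<times> {0..}) (\<lambda>(s, t). S s t)"
  unfolding A_def M_def U_def F_def S_def
  by (rule L2_inner_continuous; simp add: in_L2 source_L2 u_continuous ut_continuous source_continuous)+

lemma continuous_g: "continuous_on {0..} g"
  by (rule DERIV_continuous_on) (use g in auto)

lemma continuous_P: "continuous_on ({0..} \<times> {0..}) (\<lambda>(s, t). P s t)"
  unfolding P_def by (rule continuous_on_convolution[OF continuous_g continuous_A])

lemma continuous_P1: "continuous_on ({0..} \<times> {0..}) (\<lambda>(s, t). P1 s t)"
  using continuous_on_convolution[OF g' continuous_A] continuous_A
  unfolding P1_def split_beta by (intro continuous_intros)

lemma continuous_R: "continuous_on ({0..} \<times> {0..}) (\<lambda>(s, t). R s t)"
  using continuous_A continuous_P continuous_U continuous_F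
  unfolding R_def split_beta by (intro continuous_intros)

lemma continuous_A_diag: "continuous_on {0..} (\<lambda>t. A t t)"
  by (rule continuous_on_compose_pair[OF continuous_A]) (auto intro!: continuous_intros)

lemma P_has_derivative:
  "0 \<le> s \<Longrightarrow> 0 \<le> t \<Longrightarrow> ((\<lambda>s. P s t) has_real_derivative P1 s t) (at s within {0..})"
  unfolding P_def P1_def
  by (rule convolution_has_derivative[OF g g' continuous_on_pair_fst[OF continuous_A]]) auto

lemma Q_has_derivative: "0 \<le> t \<Longrightarrow> (Q has_real_derivative Q1 t) (at t within {0..})"
  unfolding Q_def Q1_def by (rule convolution_has_derivative[OF g g' continuous_A_diag])

lemma L2_inner_u_has_derivative:
  assumes h: "h \<in> L2 \<Omega>" and t: "0 \<le> t"
  shows "((\<lambda>t. L2_inner \<Omega> h (u t)) has_real_derivative L2_inner \<Omega> h (ut t)) (at t within {0..})"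
proof -
  let ?q = "\<lambda>s. (L2_inner \<Omega> h (u s) - L2_inner \<Omega> h (u t)) / (s - t)"
  let ?d = "\<lambda>s x. (u s x - u t x) / (s - t) - ut t x"
  have b: "\<bar>?q s - L2_inner \<Omega> h (ut t)\<bar> \<le> Lnorm \<Omega> 2 h * Lnorm \<Omega> 2 (?d s)" if s: "0 \<le> s" "s \<noteq> t" for s
  proof -
    have l: "(\<lambda>x. u s x - u t x) \<in> L2 \<Omega>" using in_L2 s t by (intro L2_diff)
    have l': "(\<lambda>x. (u s x - u t x) / (s - t)) \<in> L2 \<Omega>"
      using L2_scale[OF l, of "inverse (s - t)"] by (simp add: divide_inverse mult.commute)
    have e: "L2_inner \<Omega> h (\<lambda>x. (u s x - u t x) / (s - t)) = L2_inner \<Omega> h (\<lambda>x. u s x - u t x) / (s - t)"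
      using L2_inner_scale_left[of \<Omega> "inverse (s - t)" "\<lambda>x. u s x - u t x" h]
      by (simp add: L2_inner_commute[of \<Omega> h] divide_inverse mult.commute)
    have "L2_inner \<Omega> h (?d s) = ?q s - L2_inner \<Omega> h (ut t)"
      using L2_inner_diff_right[OF l' in_L2(3)[OF t] h] L2_inner_diff_right[OF in_L2(1)[OF s(1)] in_L2(1)[OF t] h] e
      by simp
    then show ?thesis
      using L2_inner_Cauchy_Schwarz[OF h L2_diff[OF l' in_L2(3)[OF t]]] by simp
  qed
  have "((\<lambda>s. Lnorm \<Omega> 2 h * Lnorm \<Omega> 2 (?d s)) \<longlongrightarrow> 0) (at t within {0..})"
    by (rule tendsto_mult_right_zero[OF u_quotient[OF t]])
  then have "((\<lambda>s. ?q s - L2_inner \<Omega> h (ut t)) \<longlongrightarrow> 0) (at t within {0..})"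
    by (rule Lim_null_comparison[rotated]) (use b in \<open>auto simp: eventually_at_filter\<close>)
  then show ?thesis by (simp add: has_field_derivative_iff LIM_zero_iff)
qed

lemma U_has_derivative_2:
  "0 \<le> s \<Longrightarrow> 0 \<le> t \<Longrightarrow> ((\<lambda>t. U s t) has_real_derivative M s t) (at t within {0..})"
  unfolding U_def M_def by (rule L2_inner_u_has_derivative[OF in_L2(3)])

lemma F_has_derivative_2:
  "0 \<le> s \<Longrightarrow> 0 \<le> t \<Longrightarrow> ((\<lambda>t. F s t) has_real_derivative S s t) (at t within {0..})"
  unfolding F_def S_def by (rule L2_inner_u_has_derivative[OF source_L2])

text \<open>The weak equation is integrated in time with a fixed test function, here
  \<open>u t\<close>. Its integrand \<open>R\<close> is continuous in time, so the fundamental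
  theorem of calculus turns the integral form into a derivative.\<close>

lemma U_has_derivative_1:
  assumes s: "0 \<le> s" and t: "0 \<le> t"
  shows "((\<lambda>s. U s t) has_real_derivative R s t) (at s within {0..})"
proof -
  have i: "((\<lambda>\<tau>. R \<tau> t) has_integral U r t - L2_inner \<Omega> u1 (u t)) {0..r}" if "0 \<le> r" for r
    using sol u_H10[OF t] that unfolding weak_solution_def R_def A_def P_def U_def F_def by simp
  have cR: "continuous_on {0..s+1} (\<lambda>\<tau>. R \<tau> t)"
    by (rule continuous_on_subset[OF continuous_on_pair_fst[OF continuous_R]]) (use t in auto)
  have "((\<lambda>r. integral {0..r} (\<lambda>\<tau>. R \<tau> t)) has_real_derivative R s t) (at s within {0..s+1})"
    by (rule integral_has_real_derivative[OF cR]) (use s in auto)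
  then have "((\<lambda>r. integral {0..r} (\<lambda>\<tau>. R \<tau> t) + L2_inner \<Omega> u1 (u t)) has_real_derivative R s t + 0) (at s within {0..s+1})"
    by (intro DERIV_add DERIV_const)
  then have "((\<lambda>r. integral {0..r} (\<lambda>\<tau>. R \<tau> t) + L2_inner \<Omega> u1 (u t)) has_real_derivative R s t) (at s within {0..s+1})"
    by simp
  then have "((\<lambda>s. U s t) has_real_derivative R s t) (at s within {0..s+1})"
  proof (rule has_field_derivative_transform_within)
    show "0 < (1::real)" "s \<in> {0..s + 1}" using s by auto
    show "integral {0..r} (\<lambda>\<tau>. R \<tau> t) + L2_inner \<Omega> u1 (u t) = U r t" if "r \<in> {0..s + 1}" for r
      using integral_unique[OF i, of r] that by simp
  qed
  then show ?thesis using at_within_Ici_eq[of s "s + 1"] s by simp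
qed

text \<open>The difference quotient of \<Phi> is compared with that of \<open>F t\<close>, whose
  limit is known. The remainder, divided by |s - t|, is a term tending to 0 with the gradient
  difference times a difference quotient bounded in L2.\<close>

lemma \<Phi>_has_derivative:
  assumes t: "0 \<le> t"
  shows "(\<Phi> has_real_derivative S t t) (at t within {0..})"
proof -
  let ?w = "\<lambda>K s. K * sqrt (1 + Lnorm \<Omega> 2 (wgrad \<Omega> (u s)) powr (2 * m) + Lnorm \<Omega> 2 (wgrad \<Omega> (u t)) powr (2 * m))
        * Lnorm \<Omega> 2 (\<lambda>x. wgrad \<Omega> (u s) x - wgrad \<Omega> (u t) x)"
  obtain K where K: "0 \<le> K" "\<And>s. 0 \<le> s \<Longrightarrow> \<bar>\<Phi> s - \<Phi> t - L2_inner \<Omega> (log_source p (u t)) (\<lambda>x. u s x - u t x)\<bar>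
      \<le> ?w K s * Lnorm \<Omega> 2 (\<lambda>x. u s x - u t x)"
    using source_bounds t by blast
  let ?L = "\<lambda>s. (F t s - F t t) / (s - t)"
  let ?d = "\<lambda>s. Lnorm \<Omega> 2 (\<lambda>x. (u s x - u t x) / (s - t) - ut t x)"
  have L: "(?L \<longlongrightarrow> S t t) (at t within {0..})"
    using F_has_derivative_2[OF t t] by (simp add: has_field_derivative_iff)
  have w0: "0 \<le> ?w K s" for s
    using K(1) by (intro mult_nonneg_nonneg) (auto intro!: add_nonneg_nonneg simp: Lnorm_nonneg)
  have b: "norm ((\<Phi> s - \<Phi> t) / (s - t) - ?L s) \<le> ?w K s * (?d s + Lnorm \<Omega> 2 (ut t))" if s: "0 \<le> s" "s \<noteq> t" for s
  proof -
    have l: "(\<lambda>x. u s x - u t x) \<in> L2 \<Omega>" using in_L2 s t by (intro L2_diff)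
    have l': "(\<lambda>x. (u s x - u t x) / (s - t)) \<in> L2 \<Omega>"
      using L2_scale[OF l, of "inverse (s - t)"] by (simp add: divide_inverse mult.commute)
    have n: "Lnorm \<Omega> 2 (\<lambda>x. u s x - u t x) / \<bar>s - t\<bar> = Lnorm \<Omega> 2 (\<lambda>x. (u s x - u t x) / (s - t))"
      using Lnorm_2_scale[of \<Omega> "inverse (s - t)" "\<lambda>x. u s x - u t x"] by (simp add: divide_inverse mult.commute)
    have "L2_inner \<Omega> (log_source p (u t)) (\<lambda>x. u s x - u t x) = F t s - F t t"
      unfolding F_def using in_L2 s t source_L2 by (intro L2_inner_diff_right)
    then have "norm ((\<Phi> s - \<Phi> t) / (s - t) - ?L s) = \<bar>\<Phi> s - \<Phi> t - L2_inner \<Omega> (log_source p (u t)) (\<lambda>x. u s x - u t x)\<bar> / \<bar>s - t\<bar>"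
      by (simp add: diff_divide_distrib[symmetric] abs_divide)
    also have "\<dots> \<le> ?w K s * Lnorm \<Omega> 2 (\<lambda>x. u s x - u t x) / \<bar>s - t\<bar>"
      using K(2)[OF s(1)] by (intro divide_right_mono) auto
    also have "\<dots> = ?w K s * Lnorm \<Omega> 2 (\<lambda>x. (u s x - u t x) / (s - t))" by (simp add: n[symmetric])
    also have "\<dots> \<le> ?w K s * (?d s + Lnorm \<Omega> 2 (ut t))"
      using Lnorm_2_triangle[OF L2_diff[OF l' in_L2(3)[OF t]] in_L2(3)[OF t]] w0 by (intro mult_left_mono) auto
    finally show ?thesis .
  qed
  have "((\<lambda>s. ?w K s * (?d s + Lnorm \<Omega> 2 (ut t))) \<longlongrightarrow> 0 * (0 + Lnorm \<Omega> 2 (ut t))) (at t within {0..})"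
    by (intro tendsto_mult tendsto_add tendsto_const source_factor_tendsto u_quotient t)
  then have "((\<lambda>s. ?w K s * (?d s + Lnorm \<Omega> 2 (ut t))) \<longlongrightarrow> 0) (at t within {0..})" by simp
  then have "((\<lambda>s. (\<Phi> s - \<Phi> t) / (s - t) - ?L s) \<longlongrightarrow> 0) (at t within {0..})"
    by (rule Lim_null_comparison[rotated]) (use b in \<open>auto simp: eventually_at_filter\<close>)
  from tendsto_add[OF this L] show ?thesis by (simp add: has_field_derivative_iff)
qed

lemma N_has_derivative:
  assumes t: "0 \<le> t"
  shows "((\<lambda>t. N t t) has_real_derivative 2 * U t t) (at t within {0..})"
proof -
  have cN: "continuous_on ({0..} \<times> {0..}) (\<lambda>(s, t). U t s)"
    using continuous_U unfolding split_beta
    by (intro continuous_on_compose_pair[OF continuous_U] continuous_intros) auto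
  have d2: "((\<lambda>t. N s t) has_real_derivative U t s) (at t within {0..})" if "0 \<le> s" "0 \<le> t" for s t
    using L2_inner_u_has_derivative[OF in_L2(1)[OF that(1)] that(2)]
    by (simp add: N_def U_def L2_inner_commute[of \<Omega> "u s"])
  have d1: "((\<lambda>s. N s t) has_real_derivative U s t) (at s within {0..})" if "0 \<le> s" "0 \<le> t" for s t
    using d2[OF that(2,1)] by (simp add: N_def L2_inner_commute[of \<Omega> "u t"])
  show ?thesis using has_derivative_diag[OF d1 d2 cN, of 0 0 t] t by simp
qed

lemma U_diag_has_derivative:
  assumes t: "0 \<le> t"
  shows "((\<lambda>t. U t t) has_real_derivative R t t + M t t) (at t within {0..})"
  using has_derivative_diag[OF U_has_derivative_1 U_has_derivative_2 continuous_M, of 0 0 t] t by simp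

end

section \<open>Energy identity, dissipation and multiplier identity\<close>

context damped_wave
begin

text \<open>The energy with the square in the memory functional expanded. That functional is
  \<open>mem\<close>, and its term G A cancels the one in the coefficient of the gradient, leaving
  the combination M + A - 2 P that \<open>two_time_energy_identity\<close> handles.\<close>

definition "En t = M t t / 2 + A t t / 2 - P t t + Q t / 2 - \<alpha> * \<Phi> t"
definition "mem t = G t * A t t + Q t - 2 * P t t"

lemma A_sym: "A s t = A t s" and M_sym: "M s t = M t s"
  by (simp_all add: A_def M_def L2_inner_commute)

lemma A_nonneg: "0 \<le> A t t" and M_nonneg: "0 \<le> M t t" and N_nonneg: "0 \<le> N t t"
  by (simp_all add: A_def M_def N_def L2_inner_self_nonneg)

lemma continuous_diag:
  "continuous_on ({0..} \<times> {0..}) (\<lambda>(s, t). W s t) \<Longrightarrow> continuous_on {0..} (\<lambda>t. W t t)" for W :: "real \<Rightarrow> real \<Rightarrow> real"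
  by (erule continuous_on_compose_pair) (auto intro!: continuous_intros)

lemma continuous_Q: "continuous_on {0..} Q"
  by (rule DERIV_continuous_on) (use Q_has_derivative in auto)

lemma continuous_\<Phi>: "continuous_on {0..} \<Phi>"
  by (rule DERIV_continuous_on) (use \<Phi>_has_derivative in auto)

lemma conv_continuous:
  fixes h k :: "real \<Rightarrow> real"
  assumes "continuous_on {0..} h" "continuous_on {0..} k" "0 \<le> t"
  shows "continuous_on {0..t} (\<lambda>r. h (t - r) * k r)"
  by (intro continuous_intros continuous_on_compose2[OF assms(1)] continuous_on_subset[OF assms(2)])
    (use assms(3) in auto)

lemma conv_integrable:
  "continuous_on {0..} h \<Longrightarrow> continuous_on {0..} k \<Longrightarrow> 0 \<le> t \<Longrightarrow> (\<lambda>r. h (t - r) * k r) integrable_on {0..t}"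
  for h k :: "real \<Rightarrow> real"
  by (intro integrable_continuous_real conv_continuous)

lemma continuous_A1: "0 \<le> t \<Longrightarrow> continuous_on {0..} (\<lambda>r. A r t)"
  by (rule continuous_on_pair_fst[OF continuous_A]) auto

lemma G_has_derivative: "0 \<le> t \<Longrightarrow> (G has_real_derivative g t) (at t within {0..})"
proof -
  assume t: "0 \<le> t"
  have "((\<lambda>x. integral {0..x} g) has_real_derivative g t) (at t within {0..t+1})"
    by (rule integral_has_real_derivative) (use t in \<open>auto intro: continuous_on_subset[OF continuous_g]\<close>)
  then show ?thesis using at_within_Ici_eq[of t "t + 1"] t unfolding G_def by simp
qed

lemma continuous_G: "continuous_on {0..} G"
  by (rule DERIV_continuous_on) (use G_has_derivative in auto)

text \<open>The two-time argument gives M + A - 2 P in integrated form, whence the statement as an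
  integral over time; Q and \<Phi> have derivatives of their own and are added by the fundamental
  theorem.\<close>

lemma energy_identity:
  assumes b: "0 \<le> b"
  shows "((\<lambda>t. Q1 t / 2 - P1 t t - M t t) has_integral En b - En 0) {0..b}"
proof -
  have i: "(\<lambda>t. W t t) integrable_on {0..b}" if "continuous_on ({0..} \<times> {0..}) (\<lambda>(s, t). W s t)" for W :: "real \<Rightarrow> real \<Rightarrow> real"
    by (rule integrable_continuous_real, rule continuous_on_subset[OF continuous_diag[OF that]]) auto
  have ftc: "(f' has_integral f b - f 0) {0..b}"
    if "\<And>t. 0 \<le> t \<Longrightarrow> (f has_real_derivative f' t) (at t within {0..})" for f f'
  proof (rule fundamental_theorem_of_calculus[OF b])
    fix t assume "t \<in> {0..b}"
    then have "(f has_real_derivative f' t) (at t within {0..b})"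
      by (intro has_field_derivative_subset[OF that]) auto
    then show "(f has_vector_derivative f' t) (at t within {0..b})"
      by (simp add: has_real_derivative_iff_has_vector_derivative)
  qed
  have S: "integral {0..b} (\<lambda>t. S t t) = \<Phi> b - \<Phi> 0"
    by (rule integral_unique[OF ftc[OF \<Phi>_has_derivative]])
  have "(M b b + A b b - 2 * P b b) - (M 0 0 + A 0 0 - 2 * P 0 0)
    = - 2 * integral {0..b} (\<lambda>t. P1 t t) - 2 * integral {0..b} (\<lambda>t. M t t) + 2 * \<alpha> * integral {0..b} (\<lambda>t. S t t)"
    by (rule two_time_energy_identity[OF R_def U_has_derivative_1 U_has_derivative_2 P_has_derivative
        F_has_derivative_2 A_sym M_sym continuous_M continuous_U continuous_P continuous_P1 continuous_F continuous_S b])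
  then have "(Q b - Q 0) / 2 - integral {0..b} (\<lambda>t. P1 t t) - integral {0..b} (\<lambda>t. M t t) = En b - En 0"
    unfolding S En_def by (simp add: field_simps)
  moreover have "((\<lambda>t. Q1 t / 2 - P1 t t - M t t) has_integral
      (Q b - Q 0) / 2 - integral {0..b} (\<lambda>t. P1 t t) - integral {0..b} (\<lambda>t. M t t)) {0..b}"
    by (intro has_integral_diff has_integral_divide ftc[OF Q_has_derivative] integrable_integral i
        continuous_P1 continuous_M)
  ultimately show ?thesis by simp
qed

lemma cross_bound: "0 \<le> s \<Longrightarrow> 0 \<le> t \<Longrightarrow> \<bar>2 * A s t\<bar> \<le> A s s + A t t"
proof -
  assume st: "0 \<le> s" "0 \<le> t"
  let ?x = "Lnorm \<Omega> 2 (wgrad \<Omega> (u s))" and ?y = "Lnorm \<Omega> 2 (wgrad \<Omega> (u t))"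
  have "\<bar>A s t\<bar> \<le> ?x * ?y" unfolding A_def using st by (intro L2_inner_Cauchy_Schwarz in_L2)
  moreover have "A s s = ?x\<^sup>2" "A t t = ?y\<^sup>2" by (simp_all add: A_def Lnorm_2_sq)
  ultimately show ?thesis using sum_squares_bound[of ?x ?y] by simp
qed

text \<open>Completing the square under the kernel g'(t - r) gives g' times half of |grad u(r) -
  grad u(t)|^2, minus g' times A t t / 2. The first part is nonpositive. The second integrates to
  -(g t - g 0) A t t / 2 and combines with -g 0 A t t / 2 to -g t A t t / 2.\<close>

lemma dissipation:
  assumes t: "0 \<le> t"
  shows "Q1 t / 2 - P1 t t \<le> 0"
proof -
  have g'neg: "g' s \<le> 0" if "0 \<le> s" for s
    using antimono_has_nonpos_derivative[OF gmono g[OF that] that] .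
  have i: "((\<lambda>r. g' (t - r) * A r r / 2 - g' (t - r) * A r t) has_integral
      integral {0..t} (\<lambda>r. g' (t - r) * A r r) / 2 - integral {0..t} (\<lambda>r. g' (t - r) * A r t)) {0..t}"
    by (intro has_integral_diff has_integral_divide integrable_integral conv_integrable g' continuous_A_diag continuous_A1 t)
  have i2: "((\<lambda>r. g' (t - r) * (- (A t t / 2))) has_integral ((g t - g 0) * (- (A t t / 2)))) {0..t}"
  proof (rule has_integral_mult_left)
    have "((\<lambda>r. g' (t - r)) has_integral (- g (t - t) - (- g (t - 0)))) {0..t}"
    proof (rule fundamental_theorem_of_calculus[OF t])
      fix r assume r: "r \<in> {0..t}"
      have "((\<lambda>r. g (t - r)) has_real_derivative g' (t - r) * (- 1)) (at r within {0..t})"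
      proof (rule DERIV_image_chain[where f=g and g="\<lambda>r. t - r", unfolded o_def])
        show "(g has_real_derivative g' (t - r)) (at (t - r) within (\<lambda>r. t - r) ` {0..t})"
          by (rule has_field_derivative_subset[OF g]) (use r in auto)
        show "((\<lambda>r. t - r) has_real_derivative - 1) (at r within {0..t})"
          by (auto intro!: derivative_eq_intros)
      qed
      from DERIV_minus[OF this] show "((\<lambda>r. - g (t - r)) has_vector_derivative g' (t - r)) (at r within {0..t})"
        by (simp add: has_real_derivative_iff_has_vector_derivative)
    qed
    then show "((\<lambda>r. g' (t - r)) has_integral (g t - g 0)) {0..t}" by simp
  qed
  have "integral {0..t} (\<lambda>r. g' (t - r) * A r r) / 2 - integral {0..t} (\<lambda>r. g' (t - r) * A r t)
      \<le> (g t - g 0) * (- (A t t / 2))"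
  proof -
    have "g' (t - r) * A r r / 2 - g' (t - r) * A r t \<le> g' (t - r) * (- (A t t / 2))" if r: "r \<in> {0..t}" for r
    proof -
      have "0 \<le> A r r / 2 - A r t + A t t / 2" using cross_bound[of r t] r t by (simp add: field_simps abs_le_iff)
      then have "g' (t - r) * (A r r / 2 - A r t + A t t / 2) \<le> 0"
        using g'neg[of "t - r"] r by (intro mult_nonpos_nonneg) auto
      then show ?thesis by (simp add: algebra_simps)
    qed
    then show ?thesis by (rule has_integral_le[OF i i2])
  qed
  then have "Q1 t / 2 - P1 t t \<le> - (g t * A t t / 2)"
    unfolding Q1_def P1_def by (simp add: field_simps)
  also have "\<dots> \<le> 0" using gpos[OF t] A_nonneg[of t] by simp
  finally show ?thesis .
qed

lemma energy_decrease:
  assumes ab: "0 \<le> a" "a \<le> b"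
  shows "En b + integral {a..b} (\<lambda>t. M t t) \<le> En a"
proof -
  let ?e = "\<lambda>t. Q1 t / 2 - P1 t t - M t t"
  have ea: "integral {0..a} ?e = En a - En 0" and eb: "integral {0..b} ?e = En b - En 0"
    using energy_identity ab by (auto intro: integral_unique)
  have ie: "?e integrable_on {0..b}" using energy_identity[of b] ab by auto
  have "integral {0..a} ?e + integral {a..b} ?e = integral {0..b} ?e"
    using ab ie by (intro Henstock_Kurzweil_Integration.integral_combine) auto
  then have "integral {a..b} ?e = En b - En a" using ea eb by simp
  moreover have "integral {a..b} ?e \<le> integral {a..b} (\<lambda>t. - M t t)"
  proof (rule integral_le)
    show "?e integrable_on {a..b}" by (rule integrable_on_subinterval[OF ie]) (use ab in auto)
    show "(\<lambda>t. - M t t) integrable_on {a..b}"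
      by (intro integrable_continuous_real continuous_intros continuous_on_subset[OF continuous_diag[OF continuous_M]])
        (use ab in auto)
    show "?e t \<le> - M t t" if "t \<in> {a..b}" for t using dissipation[of t] that ab by simp
  qed
  ultimately show ?thesis by simp
qed

lemma G_bounds: "0 \<le> t \<Longrightarrow> 0 \<le> G t"
  unfolding G_def
  by (intro integral_nonneg integrable_continuous_real continuous_on_subset[OF continuous_g])
    (auto simp: gpos less_imp_le)

lemma G_conv: "0 \<le> t \<Longrightarrow> ((\<lambda>r. g (t - r)) has_integral G t) {0..t}"
proof -
  assume t: "0 \<le> t"
  have "continuous_on {0..t} (\<lambda>r. g (t - r))"
    by (intro continuous_on_compose2[OF continuous_g] continuous_intros) auto
  then have "((\<lambda>r. g (t - r)) has_integral integral {0..t} (\<lambda>r. g (t - r))) {0..t}"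
    by (intro integrable_integral integrable_continuous_real)
  then show ?thesis
    unfolding G_def using integral_reflect_Icc[OF continuous_on_subset[OF continuous_g] t] by simp
qed

text \<open>2 |A r t| \<le> A r r + A t t, averaged with the weight g(t - r). The two signs bound
  the memory functional from below by 0 and from above by 2 (G A + Q).\<close>

lemma P_cross_bound:
  assumes t: "0 \<le> t"
  shows "\<bar>2 * P t t\<bar> \<le> G t * A t t + Q t"
proof -
  have iP: "((\<lambda>r. 2 * (g (t - r) * A r t)) has_integral 2 * P t t) {0..t}"
    unfolding P_def by (intro has_integral_mult_right integrable_integral conv_integrable continuous_g continuous_A1 t)
  have iG: "((\<lambda>r. g (t - r) * A t t + g (t - r) * A r r) has_integral G t * A t t + Q t) {0..t}"
    unfolding Q_def by (intro has_integral_add has_integral_mult_left G_conv integrable_integral conv_integrable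
        continuous_g continuous_A_diag t)
  have b: "\<bar>2 * (g (t - r) * A r t)\<bar> \<le> g (t - r) * A t t + g (t - r) * A r r" if r: "r \<in> {0..t}" for r
  proof -
    have "\<bar>2 * (g (t - r) * A r t)\<bar> = g (t - r) * \<bar>2 * A r t\<bar>"
      using gpos[of "t - r"] r by (simp add: abs_mult)
    also have "\<dots> \<le> g (t - r) * (A r r + A t t)"
      using gpos[of "t - r"] r cross_bound[of r t] t by (intro mult_left_mono) auto
    finally show ?thesis by (simp add: algebra_simps)
  qed
  have "2 * P t t \<le> G t * A t t + Q t" using b[THEN abs_le_D1] by (rule has_integral_le[OF iP iG])
  moreover have "- (2 * P t t) \<le> G t * A t t + Q t"
    using b[THEN abs_le_D2] by (rule has_integral_le[OF has_integral_neg[OF iP] iG])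
  ultimately show ?thesis by (simp add: abs_le_iff)
qed

lemma mem_bounds: "0 \<le> t \<Longrightarrow> 0 \<le> mem t" "0 \<le> t \<Longrightarrow> mem t \<le> 2 * (G t * A t t + Q t)"
  using P_cross_bound[of t] by (auto simp: mem_def abs_le_iff)

lemma memory_eq:
  assumes t: "0 \<le> t"
  shows "memory \<Omega> g u t = mem t"
proof -
  have e: "(Lnorm \<Omega> 2 (\<lambda>x. wgrad \<Omega> (u t) x - wgrad \<Omega> (u s) x))\<^sup>2 = A t t + A s s - 2 * A s t" if s: "0 \<le> s" for s
    unfolding Lnorm_2_sq A_def
    using in_L2(2)[OF t] in_L2(2)[OF s] L2_diff[OF in_L2(2)[OF t] in_L2(2)[OF s]]
    by (simp add: L2_inner_diff_left L2_inner_diff_right L2_inner_commute[of \<Omega> "wgrad \<Omega> (u t)" "wgrad \<Omega> (u s)"])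
  have "((\<lambda>r. g (t - r) * A t t + g (t - r) * A r r - 2 * (g (t - r) * A r t)) has_integral G t * A t t + Q t - 2 * P t t) {0..t}"
    unfolding Q_def P_def by (intro has_integral_add has_integral_diff has_integral_mult_left has_integral_mult_right G_conv
        integrable_integral conv_integrable continuous_g continuous_A_diag continuous_A1 t)
  then have "((\<lambda>s. g (t - s) * (Lnorm \<Omega> 2 (\<lambda>x. wgrad \<Omega> (u t) x - wgrad \<Omega> (u s) x))\<^sup>2) has_integral mem t) {0..t}"
    unfolding mem_def
    by (rule has_integral_eq[rotated]) (simp add: e algebra_simps)
  then show ?thesis unfolding memory_def by (rule integral_unique)
qed

lemma En_eq: "En t = M t t / 2 + (1 - G t) * A t t / 2 + mem t / 2 - \<alpha> * \<Phi> t"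
  by (simp add: En_def mem_def field_simps)

text \<open>Young's inequality for the convolution with g. An antiderivative takes the place of the
  exchange of integrals: since G vanishes at 0 and has derivative g, the convolution of G with A
  differentiates to \<open>Q\<close>.\<close>

lemma integral_Q_le:
  assumes T: "0 \<le> T" and c: "\<And>t. 0 \<le> t \<Longrightarrow> G t \<le> c"
  shows "integral {0..T} Q \<le> c * integral {0..T} (\<lambda>t. A t t)"
proof -
  let ?H = "\<lambda>T. integral {0..T} (\<lambda>s. G (T - s) * A s s)"
  have "(Q has_integral ?H T - ?H 0) {0..T}"
  proof (rule fundamental_theorem_of_calculus[OF T])
    fix t assume t: "t \<in> {0..T}"
    have "(?H has_real_derivative G 0 * A t t + integral {0..t} (\<lambda>s. g (t - s) * A s s)) (at t within {0..})"
      by (rule convolution_has_derivative[OF G_has_derivative continuous_g continuous_A_diag]) (use t in auto)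
    then have "(?H has_real_derivative G 0 * A t t + integral {0..t} (\<lambda>s. g (t - s) * A s s)) (at t within {0..T})"
      by (rule has_field_derivative_subset) auto
    moreover have "G 0 * A t t + integral {0..t} (\<lambda>s. g (t - s) * A s s) = Q t" by (simp add: Q_def G_def)
    ultimately have "(?H has_real_derivative Q t) (at t within {0..T})" by (simp only:)
    then show "(?H has_vector_derivative Q t) (at t within {0..T})"
      by (simp add: has_real_derivative_iff_has_vector_derivative)
  qed
  then have "integral {0..T} Q = ?H T" by (simp add: integral_unique)
  also have "\<dots> \<le> integral {0..T} (\<lambda>s. c * A s s)"
    by (intro integral_le conv_integrable continuous_G continuous_A_diag T integrable_continuous_real
        continuous_intros continuous_on_subset[OF continuous_A_diag])
      (use c A_nonneg in \<open>auto intro!: mult_right_mono\<close>)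
  also have "\<dots> = c * integral {0..T} (\<lambda>t. A t t)" by simp
  finally show ?thesis .
qed

text \<open>Differentiate U + N/2 along the diagonal: the damping term -U in R cancels against the
  derivative of N/2, so the friction contributes only boundary values.\<close>

lemma multiplier_identity:
  assumes T: "0 \<le> T"
  shows "integral {0..T} (\<lambda>t. A t t) - integral {0..T} (\<lambda>t. P t t) - \<alpha> * integral {0..T} (\<lambda>t. F t t)
    = integral {0..T} (\<lambda>t. M t t) - (U T T + N T T / 2 - (U 0 0 + N 0 0 / 2))"
proof -
  have i: "(\<lambda>t. W t t) integrable_on {0..T}" if "continuous_on ({0..} \<times> {0..}) (\<lambda>(s, t). W s t)" for W :: "real \<Rightarrow> real \<Rightarrow> real"
    by (rule integrable_continuous_real, rule continuous_on_subset[OF continuous_diag[OF that]]) auto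
  have h1: "((\<lambda>t. R t t + M t t + 2 * U t t / 2) has_integral (U T T + N T T / 2) - (U 0 0 + N 0 0 / 2)) {0..T}"
  proof (rule fundamental_theorem_of_calculus[OF T])
    fix t assume t: "t \<in> {0..T}"
    have "((\<lambda>t. U t t + N t t / 2) has_real_derivative R t t + M t t + 2 * U t t / 2) (at t within {0..})"
      using t by (intro DERIV_add DERIV_cdivide U_diag_has_derivative N_has_derivative) auto
    then have "((\<lambda>t. U t t + N t t / 2) has_real_derivative R t t + M t t + 2 * U t t / 2) (at t within {0..T})"
      by (rule has_field_derivative_subset) auto
    then show "((\<lambda>t. U t t + N t t / 2) has_vector_derivative R t t + M t t + 2 * U t t / 2) (at t within {0..T})"
      by (simp add: has_real_derivative_iff_has_vector_derivative)
  qed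
  have h2: "((\<lambda>t. - A t t + P t t + \<alpha> * F t t + M t t) has_integral
      - integral {0..T} (\<lambda>t. A t t) + integral {0..T} (\<lambda>t. P t t) + \<alpha> * integral {0..T} (\<lambda>t. F t t) + integral {0..T} (\<lambda>t. M t t)) {0..T}"
    by (intro has_integral_add has_integral_neg has_integral_mult_right integrable_integral i
        continuous_A continuous_P continuous_F continuous_M)
  have h3: "(\<lambda>t. R t t + M t t + 2 * U t t / 2) = (\<lambda>t. - A t t + P t t + \<alpha> * F t t + M t t)"
    by (simp add: R_def fun_eq_iff)
  show ?thesis using has_integral_unique[OF h1[unfolded h3] h2] by simp
qed

end

text \<open>The uniform bound over [0,T] passes to the half-line by monotone convergence, which also
  gives integrability. The constant 1 + C comes from adding E(t) \<le> E(0) to t E(t) \<le> C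
  E(0).\<close>

lemma nonneg_antimono_decay:
  fixes E :: "real \<Rightarrow> real"
  assumes cont: "continuous_on {0..} E" and nn: "\<And>t. 0 \<le> t \<Longrightarrow> 0 \<le> E t"
    and mono: "\<And>s t. 0 \<le> s \<Longrightarrow> s \<le> t \<Longrightarrow> E t \<le> E s"
    and bound: "\<And>T. 0 \<le> T \<Longrightarrow> integral {0..T} E \<le> C * E 0"
  shows "E absolutely_integrable_on {0..}" "integral {0..} E \<le> C * E 0"
    and "0 \<le> t \<Longrightarrow> E t \<le> (1 + C) * E 0 * inverse (1 + t)"
proof -
  have iT: "E integrable_on {0..T}" for T
    by (rule integrable_continuous_real, rule continuous_on_subset[OF cont]) auto
  let ?f = "\<lambda>(k::nat) t. if t \<in> {0..real k} then E t else 0"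
  have fi: "?f k integrable_on {0..}" and fI: "integral {0..} (?f k) = integral {0..real k} E" for k
  proof -
    have s: "{0..real k} \<inter> {0..} = {0..real k}" by auto
    show "?f k integrable_on {0..}" using iT[of "real k"] by (simp only: integrable_restrict_Int s)
    show "integral {0..} (?f k) = integral {0..real k} E" by (simp only: integral_restrict_Int s)
  qed
  have conv: "E integrable_on {0..} \<and> (\<lambda>k. integral {0..} (?f k)) \<longlonglongrightarrow> integral {0..} E"
  proof (rule monotone_convergence_increasing)
    show "?f k integrable_on {0..}" for k by (rule fi)
    show "?f k t \<le> ?f (Suc k) t" if "t \<in> {0..}" for k t using nn[of t] that by auto
    show "(\<lambda>k. ?f k t) \<longlonglongrightarrow> E t" if t: "t \<in> {0..}" for t
    proof (rule tendsto_eventually)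
      obtain k0 :: nat where "t \<le> real k0" using real_arch_simple by blast
      then show "\<forall>\<^sub>F k in sequentially. ?f k t = E t"
        using t by (auto simp: eventually_sequentially intro!: exI[of _ k0])
    qed
    show "bounded (range (\<lambda>k. integral {0..} (?f k)))"
      unfolding bounded_iff
    proof (intro exI[of _ "C * E 0"] ballI)
      fix y assume "y \<in> range (\<lambda>k. integral {0..} (?f k))"
      then obtain k where "y = integral {0..real k} E" using fI by auto
      moreover have "0 \<le> integral {0..real k} E" by (intro integral_nonneg iT) (use nn in auto)
      ultimately show "norm y \<le> C * E 0" using bound[of "real k"] by simp
    qed
  qed
  then show "E absolutely_integrable_on {0..}"
    using nn by (intro nonnegative_absolutely_integrable_1) auto
  show "integral {0..} E \<le> C * E 0"
    by (rule LIMSEQ_le_const2[OF conjunct2[OF conv]]) (use bound fI in auto)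
  assume t: "0 \<le> t"
  have "t * E t = integral {0..t} (\<lambda>s. E t)" using t by simp
  also have "\<dots> \<le> integral {0..t} E" by (intro integral_le iT) (use mono t in auto)
  also have "\<dots> \<le> C * E 0" by (rule bound[OF t])
  finally have "(1 + t) * E t \<le> (1 + C) * E 0" using mono[of 0 t] t by (simp add: algebra_simps)
  then show "E t \<le> (1 + C) * E 0 * inverse (1 + t)" using t by (simp add: field_simps)
qed

section \<open>The potential well and decay of the energy\<close>

text \<open>From exp 1 * x \<le> exp x at x = \<mu> ln |y|; this is the e \<mu> that appears in
  \<open>lam1\<close>. For |y| \<le> 1 the left-hand side is not positive.\<close>

lemma powr_ln_upper:
  fixes q p2 \<mu> y :: real
  assumes "q \<le> p2" "0 < \<mu>"
  shows "\<bar>y\<bar> powr q * ln \<bar>y\<bar> \<le> \<bar>y\<bar> powr (p2 + \<mu>) / (exp 1 * \<mu>)"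
proof (cases "\<bar>y\<bar> \<le> 1")
  case True
  then have "\<bar>y\<bar> powr q * ln \<bar>y\<bar> \<le> 0"
    by (cases "y = 0") (auto intro!: mult_nonneg_nonpos)
  also have "0 \<le> \<bar>y\<bar> powr (p2 + \<mu>) / (exp 1 * \<mu>)" using assms by simp
  finally show ?thesis .
next
  case False
  have e: "exp 1 * x \<le> exp x" for x :: real
  proof -
    have "exp 1 * x \<le> exp 1 * exp (x - 1)" using exp_ge_add_one_self[of "x - 1"] by (intro mult_left_mono) auto
    then show ?thesis by (simp add: exp_add[symmetric])
  qed
  have "exp 1 * (\<mu> * ln \<bar>y\<bar>) \<le> \<bar>y\<bar> powr \<mu>" using e[of "\<mu> * ln \<bar>y\<bar>"] False by (simp add: powr_def)
  then have "ln \<bar>y\<bar> \<le> \<bar>y\<bar> powr \<mu> / (exp 1 * \<mu>)" using assms by (simp add: pos_le_divide_eq mult_ac)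
  then have "\<bar>y\<bar> powr q * ln \<bar>y\<bar> \<le> \<bar>y\<bar> powr p2 * (\<bar>y\<bar> powr \<mu> / (exp 1 * \<mu>))"
    using False assms by (intro mult_mono powr_mono) auto
  then show ?thesis by (simp add: powr_add)
qed

lemma powr_eq_square_mult: "2 < q \<Longrightarrow> \<bar>y\<bar> powr q = y\<^sup>2 * \<bar>y\<bar> powr (q - 2)" for y q :: real
  using powr_add[of "\<bar>y\<bar>" 2 "q - 2"] by (cases "y = 0") auto

lemma logpow_mult: "2 < q \<Longrightarrow> logpow q y * y = \<bar>y\<bar> powr q * ln \<bar>y\<bar>"
  by (simp add: logpow_def powr_eq_square_mult power2_eq_square)

lemma powr_le_square_plus_powr:
  fixes q k y :: real
  assumes "2 < q" "q \<le> k"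
  shows "\<bar>y\<bar> powr q \<le> y\<^sup>2 + \<bar>y\<bar> powr k"
proof -
  have "y\<^sup>2 * \<bar>y\<bar> powr (q - 2) \<le> y\<^sup>2 * (1 + \<bar>y\<bar> powr (k - 2))"
    using assms by (intro mult_left_mono powr_le_1_plus_powr) auto
  then show ?thesis using assms by (simp add: powr_eq_square_mult distrib_left)
qed

lemma logpow_int_upper:
  fixes q p1 p2 \<mu> y :: real
  assumes "2 < p1" "p1 \<le> q" "q \<le> p2" "0 < \<mu>"
  shows "logpow_int q y \<le> \<bar>y\<bar> powr (p2 + \<mu>) / (exp 1 * \<mu>) / p1"
proof -
  have "logpow_int q y \<le> \<bar>y\<bar> powr q * ln \<bar>y\<bar> / q" by (simp add: logpow_int_def)
  also have "\<dots> \<le> \<bar>y\<bar> powr (p2 + \<mu>) / (exp 1 * \<mu>) / q"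
    using assms powr_ln_upper[of q p2 \<mu> y] by (intro divide_right_mono) auto
  also have "\<dots> \<le> \<bar>y\<bar> powr (p2 + \<mu>) / (exp 1 * \<mu>) / p1"
    using assms by (intro divide_left_mono) auto
  finally show ?thesis .
qed

text \<open>For an upper bound on the energy, the potential must also be controlled where the
  logarithm is negative. Near 0 its size is governed by |y|^q |ln |y||, which p1 > 2 puts below a
  multiple of y^2.\<close>

lemma logpow_int_lower:
  fixes q p1 p2 \<mu> y :: real
  assumes q: "2 < p1" "p1 \<le> q" "q \<le> p2" "0 < \<mu>"
  shows "- logpow_int q y \<le> (1 / (p1 - 2) + 1 / \<mu> + 1) * (y\<^sup>2 + \<bar>y\<bar> powr (p2 + \<mu>))"
proof -
  let ?k = "p2 + \<mu>" and ?C = "1 / (p1 - 2) + 1 / \<mu>"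
  have q0: "2 < q" "1 \<le> q" "1 \<le> q\<^sup>2" "2 < ?k" using q one_le_power[of q 2] by auto
  have "- (\<bar>y\<bar> powr q * ln \<bar>y\<bar> / q) \<le> \<bar>y\<bar> powr q * \<bar>ln \<bar>y\<bar>\<bar> / q"
  proof -
    have "- (\<bar>y\<bar> powr q * ln \<bar>y\<bar>) / q \<le> \<bar>y\<bar> powr q * \<bar>ln \<bar>y\<bar>\<bar> / q"
      unfolding mult_minus_right[symmetric] using q0 by (intro divide_right_mono mult_left_mono) auto
    then show ?thesis by (simp only: minus_divide_left)
  qed
  also have "\<dots> \<le> \<bar>y\<bar> powr q * \<bar>ln \<bar>y\<bar>\<bar> / 1"
    using q0 by (intro divide_left_mono) auto
  also have "\<dots> = y\<^sup>2 * (\<bar>y\<bar> powr (q - 2) * \<bar>ln \<bar>y\<bar>\<bar>)" using q0 by (simp add: powr_eq_square_mult)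
  also have "\<dots> \<le> y\<^sup>2 * (?C * (1 + \<bar>y\<bar> powr (?k - 2)))"
    using powr_ln_bound[of p1 q p2 "?k - 2" y] q by (intro mult_left_mono) auto
  also have "\<dots> = ?C * (y\<^sup>2 + \<bar>y\<bar> powr ?k)" using q0 by (simp add: powr_eq_square_mult algebra_simps)
  finally have 1: "- (\<bar>y\<bar> powr q * ln \<bar>y\<bar> / q) \<le> ?C * (y\<^sup>2 + \<bar>y\<bar> powr ?k)" .
  have "\<bar>y\<bar> powr q / q\<^sup>2 \<le> \<bar>y\<bar> powr q / 1" using q0 by (intro divide_left_mono) auto
  also have "\<dots> \<le> y\<^sup>2 + \<bar>y\<bar> powr ?k" using powr_le_square_plus_powr[of q ?k y] q by simp
  finally have 2: "\<bar>y\<bar> powr q / q\<^sup>2 \<le> y\<^sup>2 + \<bar>y\<bar> powr ?k" .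
  show ?thesis using add_mono[OF 1 2] by (simp add: logpow_int_def distrib_right)
qed

section \<open>The potential well along a solution\<close>

locale potential_well = damped_wave \<Omega> p u0 u1 g g' \<alpha> p1 p2 m u ut
  for \<Omega> :: "(real^'n::finite) set" and p u0 u1 g g' \<alpha> p1 p2 m u ut +
  fixes \<mu> :: real
  assumes \<mu>: "0 < \<mu>" and \<kappa>_cond: "real CARD('n) * (1/2 - 1/(p2 + \<mu>)) < 1"
    and \<alpha>: "0 < \<alpha>" and p1_eq: "p1 = exp_inf \<Omega> p" and p2_eq: "p2 = exp_sup \<Omega> p"
    and g_int: "g integrable_on {0..}" and ell: "0 < ell g"
    and E0: "energy \<Omega> \<alpha> p g u ut 0 < E1 \<Omega> \<alpha> p g \<mu>"
    and lam0: "lam \<Omega> g u 0 < lam1 \<Omega> \<alpha> p g \<mu>"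
begin

definition "\<kappa> = p2 + \<mu>"
definition "V t = (LINT x|lebesgue_on \<Omega>. \<bar>u t x\<bar> powr \<kappa>)"
definition "l1 = lam1 \<Omega> \<alpha> p g \<mu>"
text \<open>The gradient part of \<open>lam\<close>; the source is bounded by this part alone,
  without the memory.\<close>

definition "\<sigma> t = sqrt (ell g * A t t)"

lemma \<kappa>2: "2 < \<kappa>" "p1 < \<kappa>" using p12 \<mu> by (auto simp: \<kappa>_def)

lemma V_integrable: "0 \<le> t \<Longrightarrow> integrable (lebesgue_on \<Omega>) (\<lambda>x. \<bar>u t x\<bar> powr \<kappa>)"
  using H10_Sobolev[OF O _ \<kappa>_cond] \<kappa>2 u_H10 unfolding \<kappa>_def by fastforce

lemma u_integrable: "0 \<le> t \<Longrightarrow> integrable (lebesgue_on \<Omega>) (\<lambda>x. (u t x)\<^sup>2)"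
  using L2_integrable[OF in_L2(1)] by simp

lemma sobolev_nonneg: "0 \<le> sobolev_const \<Omega> \<kappa>"
  using sobolev_const_bound(1)[OF O _ \<kappa>_cond] \<kappa>2 unfolding \<kappa>_def by simp

lemma V_le: "0 \<le> t \<Longrightarrow> V t \<le> sobolev_const \<Omega> \<kappa> * sqrt (A t t) powr \<kappa>"
  using sobolev_const_bound(2)[OF O _ \<kappa>_cond u_H10] \<kappa>2 unfolding \<kappa>_def V_def A_def Lnorm_2 by simp

lemma F_upper:
  assumes t: "0 \<le> t"
  shows "F t t \<le> V t / (exp 1 * \<mu>)"
proof -
  have "F t t \<le> (LINT x|lebesgue_on \<Omega>. \<bar>u t x\<bar> powr \<kappa> / (exp 1 * \<mu>))"
    unfolding F_def L2_inner_def
  proof (rule integral_mono_AE[OF L2_inner_integrable[OF source_L2[OF t] in_L2(1)[OF t]]])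
    show "integrable (lebesgue_on \<Omega>) (\<lambda>x. \<bar>u t x\<bar> powr \<kappa> / (exp 1 * \<mu>))" using V_integrable[OF t] by simp
    show "AE x in lebesgue_on \<Omega>. log_source p (u t) x \<bullet> u t x \<le> \<bar>u t x\<bar> powr \<kappa> / (exp 1 * \<mu>)"
      using pae
    proof eventually_elim
      fix x assume "p x \<in> {p1..p2}"
      then show "log_source p (u t) x \<bullet> u t x \<le> \<bar>u t x\<bar> powr \<kappa> / (exp 1 * \<mu>)"
        using powr_ln_upper[of "p x" p2 \<mu> "u t x"] \<mu> p12 by (simp add: log_source_eq logpow_mult \<kappa>_def)
    qed
  qed
  then show ?thesis by (simp add: V_def)
qed

lemma \<Phi>_upper:
  assumes t: "0 \<le> t"
  shows "\<Phi> t \<le> V t / (exp 1 * \<mu>) / p1"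
proof -
  have "\<Phi> t \<le> (LINT x|lebesgue_on \<Omega>. \<bar>u t x\<bar> powr \<kappa> / (exp 1 * \<mu>) / p1)"
    unfolding \<Phi>_def
  proof (rule integral_mono_AE[OF logpow_int_integrable[OF t]])
    show "integrable (lebesgue_on \<Omega>) (\<lambda>x. \<bar>u t x\<bar> powr \<kappa> / (exp 1 * \<mu>) / p1)" using V_integrable[OF t] by simp
    show "AE x in lebesgue_on \<Omega>. logpow_int (p x) (u t x) \<le> \<bar>u t x\<bar> powr \<kappa> / (exp 1 * \<mu>) / p1"
      using pae
    proof eventually_elim
      fix x assume "p x \<in> {p1..p2}"
      then show "logpow_int (p x) (u t x) \<le> \<bar>u t x\<bar> powr \<kappa> / (exp 1 * \<mu>) / p1"
        using logpow_int_upper[of p1 "p x" p2 \<mu> "u t x"] \<mu> p12 by (simp add: \<kappa>_def)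
    qed
  qed
  then show ?thesis by (simp add: V_def)
qed

lemma \<Phi>_lower:
  assumes t: "0 \<le> t"
  shows "- \<Phi> t \<le> (1 / (p1 - 2) + 1 / \<mu> + 1) * (N t t + V t)"
proof -
  let ?C = "1 / (p1 - 2) + 1 / \<mu> + 1"
  have "(LINT x|lebesgue_on \<Omega>. - logpow_int (p x) (u t x)) \<le> (LINT x|lebesgue_on \<Omega>. ?C * ((u t x)\<^sup>2 + \<bar>u t x\<bar> powr \<kappa>))"
  proof (rule integral_mono_AE)
    show "integrable (lebesgue_on \<Omega>) (\<lambda>x. - logpow_int (p x) (u t x))" using logpow_int_integrable[OF t] by simp
    show "integrable (lebesgue_on \<Omega>) (\<lambda>x. ?C * ((u t x)\<^sup>2 + \<bar>u t x\<bar> powr \<kappa>))"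
      using V_integrable[OF t] u_integrable[OF t] by (intro integrable_mult_right Bochner_Integration.integrable_add)
    show "AE x in lebesgue_on \<Omega>. - logpow_int (p x) (u t x) \<le> ?C * ((u t x)\<^sup>2 + \<bar>u t x\<bar> powr \<kappa>)"
      using pae
    proof eventually_elim
      fix x assume "p x \<in> {p1..p2}"
      then show "- logpow_int (p x) (u t x) \<le> ?C * ((u t x)\<^sup>2 + \<bar>u t x\<bar> powr \<kappa>)"
        using logpow_int_lower[of p1 "p x" p2 \<mu> "u t x"] \<mu> p12 by (simp add: \<kappa>_def)
    qed
  qed
  also have "\<dots> = ?C * (N t t + V t)"
    using V_integrable[OF t] u_integrable[OF t] by (simp add: N_def V_def L2_inner_self)
  finally show ?thesis by (simp add: \<Phi>_def)
qed

lemma energy_eq: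
  assumes t: "0 \<le> t"
  shows "energy \<Omega> \<alpha> p g u ut t = En t"
proof -
  let ?Y = "\<lambda>x. \<bar>u t x\<bar> powr p x / (p x)\<^sup>2"
  have [measurable]: "u t \<in> borel_measurable (lebesgue_on \<Omega>)" using L2_measurable[OF in_L2(1)[OF t]] .
  note pm[measurable]
  have iY: "integrable (lebesgue_on \<Omega>) ?Y"
  proof (rule Bochner_Integration.integrable_bound)
    show "integrable (lebesgue_on \<Omega>) (\<lambda>x. (u t x)\<^sup>2 + \<bar>u t x\<bar> powr \<kappa>)"
      using V_integrable[OF t] u_integrable[OF t] by (intro Bochner_Integration.integrable_add)
    show "?Y \<in> borel_measurable (lebesgue_on \<Omega>)" by measurable
    show "AE x in lebesgue_on \<Omega>. norm (?Y x) \<le> norm ((u t x)\<^sup>2 + \<bar>u t x\<bar> powr \<kappa>)"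
      using pae
    proof eventually_elim
      fix x assume px: "p x \<in> {p1..p2}"
      have "1 \<le> (p x)\<^sup>2" using px p12 by (intro one_le_power) auto
      then have "?Y x \<le> \<bar>u t x\<bar> powr p x / 1" by (intro divide_left_mono) auto
      also have "\<dots> \<le> (u t x)\<^sup>2 + \<bar>u t x\<bar> powr \<kappa>"
        using powr_le_square_plus_powr[of "p x" \<kappa> "u t x"] px p12 \<mu> by (simp add: \<kappa>_def)
      finally show "norm (?Y x) \<le> norm ((u t x)\<^sup>2 + \<bar>u t x\<bar> powr \<kappa>)" by simp
    qed
  qed
  have "(LINT x|lebesgue_on \<Omega>. \<bar>u t x\<bar> powr p x * ln \<bar>u t x\<bar> / p x)
      = (LINT x|lebesgue_on \<Omega>. logpow_int (p x) (u t x) + ?Y x)"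
    by (simp add: logpow_int_def)
  also have "\<dots> = \<Phi> t + (LINT x|lebesgue_on \<Omega>. ?Y x)"
    unfolding \<Phi>_def by (rule Bochner_Integration.integral_add[OF logpow_int_integrable[OF t] iY])
  finally have e: "(LINT x|lebesgue_on \<Omega>. \<bar>u t x\<bar> powr p x * ln \<bar>u t x\<bar> / p x) = \<Phi> t + (LINT x|lebesgue_on \<Omega>. ?Y x)" .
  show ?thesis
    unfolding energy_def e memory_eq[OF t] En_eq Lnorm_2_sq M_def A_def G_def by (simp add: field_simps)
qed

lemma lam_eq: "0 \<le> t \<Longrightarrow> lam \<Omega> g u t = sqrt (ell g * A t t + mem t)"
  by (simp add: lam_def memory_eq Lnorm_2_sq A_def)

lemma G_le: "0 \<le> t \<Longrightarrow> G t \<le> 1 - ell g"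
  unfolding G_def ell_def using g_int
  by (auto intro!: integral_subset_le integrable_continuous_real continuous_on_subset[OF continuous_g] simp: gpos less_imp_le)

lemma \<sigma>_le_lam: "0 \<le> t \<Longrightarrow> 0 \<le> \<sigma> t" "0 \<le> t \<Longrightarrow> \<sigma> t \<le> lam \<Omega> g u t"
  using ell A_nonneg mem_bounds by (auto simp: \<sigma>_def lam_eq)

lemma lam_sq: "0 \<le> t \<Longrightarrow> (lam \<Omega> g u t)\<^sup>2 = ell g * A t t + mem t"
  using ell A_nonneg[of t] mem_bounds[of t] by (simp add: lam_eq)

lemma lam_nonneg: "0 \<le> t \<Longrightarrow> 0 \<le> lam \<Omega> g u t"
  using \<sigma>_le_lam[of t] by simp

lemma l1_pos: "0 < l1"
  using lam0 lam_nonneg[of 0] by (simp add: l1_def)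

text \<open>By its definition \<open>l1 powr (\<kappa> - 2)\<close> equals e \<mu> p1 / (\<alpha>
  \<kappa> B). The power of \<ell> in B turns the sqrt A of the Sobolev bound for V into \<sigma>,
  and eliminating B leaves this normalised form.\<close>

lemma source_le:
  assumes t: "0 \<le> t"
  shows "\<alpha> * (V t / (exp 1 * \<mu>)) \<le> p1 / \<kappa> * (\<sigma> t powr \<kappa> / l1 powr (\<kappa> - 2))"
proof -
  let ?B = "Bconst \<Omega> p g \<mu>"
  let ?x = "exp 1 * \<mu> * p1 / (\<alpha> * \<kappa> * ?B)"
  have B: "?B = sobolev_const \<Omega> \<kappa> * ell g powr (- \<kappa> / 2)" by (simp add: Bconst_def \<kappa>_def p2_eq[symmetric])
  have B0: "0 \<le> ?B" unfolding B using sobolev_nonneg by simp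
  have l: "l1 = ?x powr (1 / (\<kappa> - 2))" by (simp add: l1_def lam1_def \<kappa>_def p1_eq[symmetric] p2_eq[symmetric])
  \<comment> \<open>Positivity of \<open>l1\<close> rules out B = 0: division by 0 gives 0, and
    \<open>lam1\<close> would be 0 as well.\<close>
  have "?x \<noteq> 0" using l1_pos unfolding l by auto
  then have Bp: "0 < ?B" using B0 by (auto simp: less_le)
  then have x: "0 < ?x" using \<mu> p12 \<alpha> \<kappa>2 by (intro divide_pos_pos mult_pos_pos) auto
  have lx: "l1 powr (\<kappa> - 2) = ?x"
  proof -
    have "1 / (\<kappa> - 2) * (\<kappa> - 2) = 1" using \<kappa>2 by simp
    then show ?thesis unfolding l powr_powr using x by (simp only: powr_one_gt_zero_iff less_imp_le)
  qed
  have "V t \<le> sobolev_const \<Omega> \<kappa> * sqrt (A t t) powr \<kappa>" by (rule V_le[OF t])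
  also have "\<dots> = ?B * \<sigma> t powr \<kappa>"
  proof -
    have "\<sigma> t powr \<kappa> = sqrt (ell g) powr \<kappa> * sqrt (A t t) powr \<kappa>"
      by (simp add: \<sigma>_def real_sqrt_mult powr_mult)
    also have "sqrt (ell g) powr \<kappa> = ell g powr (\<kappa> / 2)"
      using ell by (simp add: powr_half_sqrt[symmetric] powr_powr)
    finally show ?thesis unfolding B using ell by (simp add: powr_minus field_simps)
  qed
  finally have "\<alpha> * (V t / (exp 1 * \<mu>)) \<le> \<alpha> * (?B * \<sigma> t powr \<kappa> / (exp 1 * \<mu>))"
    using \<alpha> \<mu> by (intro mult_left_mono divide_right_mono) auto
  also have "\<dots> = p1 / \<kappa> * (\<sigma> t powr \<kappa> / ?x)"
    using \<alpha> \<mu> p12 \<kappa>2 Bp by (simp add: field_simps)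
  finally show ?thesis unfolding lx .
qed

text \<open>The factor p1 of \<open>source_le\<close> cancels the 1/p1 of
  \<open>\<Phi>_upper\<close>, which leaves 1/\<kappa>. The coefficient 1 - G t of the gradient is
  replaced by its lower bound \<ell>.\<close>

lemma En_lower:
  assumes t: "0 \<le> t"
  shows "M t t / 2 + (lam \<Omega> g u t)\<^sup>2 / 2 - (\<sigma> t powr \<kappa> / l1 powr (\<kappa> - 2)) / \<kappa> \<le> En t"
proof -
  have "\<alpha> * \<Phi> t \<le> \<alpha> * (V t / (exp 1 * \<mu>) / p1)" using \<Phi>_upper[OF t] \<alpha> by (intro mult_left_mono) auto
  also have "\<dots> = \<alpha> * (V t / (exp 1 * \<mu>)) / p1" by simp
  also have "\<dots> \<le> p1 / \<kappa> * (\<sigma> t powr \<kappa> / l1 powr (\<kappa> - 2)) / p1"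
    using source_le[OF t] p12 by (intro divide_right_mono) auto
  also have "\<dots> = (\<sigma> t powr \<kappa> / l1 powr (\<kappa> - 2)) / \<kappa>" using p12 by simp
  finally have 1: "\<alpha> * \<Phi> t \<le> (\<sigma> t powr \<kappa> / l1 powr (\<kappa> - 2)) / \<kappa>" .
  have "ell g * A t t \<le> (1 - G t) * A t t" using G_le[OF t] A_nonneg by (intro mult_right_mono) auto
  then show ?thesis using 1 unfolding En_eq lam_sq[OF t] by argo
qed

lemma powr_\<kappa>_le_square:
  assumes "0 \<le> x" "x \<le> l1"
  shows "x powr \<kappa> / l1 powr (\<kappa> - 2) \<le> x\<^sup>2"
proof -
  have "x powr \<kappa> = x\<^sup>2 * x powr (\<kappa> - 2)" using powr_eq_square_mult[of \<kappa> x] \<kappa>2 assms by simp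
  also have "\<dots> \<le> x\<^sup>2 * l1 powr (\<kappa> - 2)" using assms \<kappa>2 by (intro mult_left_mono powr_mono2) auto
  finally show ?thesis using l1_pos by (simp add: pos_divide_le_eq)
qed

lemma continuous_lam: "continuous_on {0..} (\<lambda>t. lam \<Omega> g u t)"
proof -
  have "continuous_on {0..} (\<lambda>t. sqrt (ell g * A t t + mem t))"
    unfolding mem_def
    by (intro continuous_intros continuous_A_diag continuous_G continuous_Q continuous_diag[OF continuous_P])
  then show ?thesis by (rule continuous_on_eq) (simp add: lam_eq)
qed

lemma En_decreasing: "0 \<le> s \<Longrightarrow> s \<le> t \<Longrightarrow> En t \<le> En s"
proof -
  assume st: "0 \<le> s" "s \<le> t"
  have "0 \<le> integral {s..t} (\<lambda>t. M t t)"
    using st M_nonneg by (intro integral_nonneg integrable_continuous_real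
      continuous_on_subset[OF continuous_diag[OF continuous_M]]) auto
  then show ?thesis using energy_decrease[OF st] by simp
qed

lemma lam_less:
  assumes t: "0 \<le> t"
  shows "lam \<Omega> g u t < l1"
proof (rule ccontr)
  assume "\<not> lam \<Omega> g u t < l1"
  then have "\<exists>s. 0 \<le> s \<and> s \<le> t \<and> lam \<Omega> g u s = l1"
    using lam0 t by (intro IVT' continuous_on_subset[OF continuous_lam]) (auto simp: l1_def)
  then obtain s where s: "0 \<le> s" "lam \<Omega> g u s = l1" by blast
  \<comment> \<open>At a time where \<open>lam\<close> equals \<open>l1\<close> exactly,
    \<open>En_lower\<close> gives \<open>En s\<close> at least (1/2 - 1/\<kappa>) l1^2, which is
    \<open>E1\<close>. But \<open>En s\<close> is at most \<open>En 0\<close>, which is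
    smaller.\<close>
  have "\<sigma> s powr \<kappa> / l1 powr (\<kappa> - 2) \<le> l1 powr \<kappa> / l1 powr (\<kappa> - 2)"
    using \<sigma>_le_lam[OF s(1)] s(2) \<kappa>2 by (intro divide_right_mono powr_mono2) auto
  also have "\<dots> \<le> l1\<^sup>2" using l1_pos by (intro powr_\<kappa>_le_square) auto
  finally have "(\<sigma> s powr \<kappa> / l1 powr (\<kappa> - 2)) / \<kappa> \<le> l1\<^sup>2 / \<kappa>" using \<kappa>2 by (intro divide_right_mono) auto
  then have "l1\<^sup>2 / 2 - l1\<^sup>2 / \<kappa> \<le> En s" using En_lower[OF s(1)] M_nonneg[of s] s(2) by simp
  also have "En s \<le> En 0" using s(1) by (intro En_decreasing) auto
  also have "En 0 < (1/2 - 1 / \<kappa>) * l1\<^sup>2"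
    using E0 energy_eq[of 0] by (simp add: E1_def \<kappa>_def l1_def p2_eq[symmetric])
  finally show False by (simp add: algebra_simps)
qed

text \<open>Below \<open>l1\<close> the source term is at most \<sigma>^2, hence at most the square
  of \<open>lam\<close>. It takes away the fraction 1/\<kappa> of that square and leaves the
  positive coefficient 1/2 - 1/\<kappa>.\<close>

lemma En_coercive:
  assumes t: "0 \<le> t"
  shows "M t t / 2 + (1/2 - 1/\<kappa>) * (ell g * A t t + mem t) \<le> En t"
proof -
  have "\<sigma> t powr \<kappa> / l1 powr (\<kappa> - 2) \<le> (\<sigma> t)\<^sup>2"
    using \<sigma>_le_lam[OF t] lam_less[OF t] by (intro powr_\<kappa>_le_square) auto
  also have "\<dots> \<le> (lam \<Omega> g u t)\<^sup>2" using \<sigma>_le_lam[OF t] by (intro power_mono) auto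
  finally have "(\<sigma> t powr \<kappa> / l1 powr (\<kappa> - 2)) / \<kappa> \<le> (lam \<Omega> g u t)\<^sup>2 / \<kappa>"
    using \<kappa>2 by (intro divide_right_mono) auto
  moreover have "(1/2 - 1/\<kappa>) * (lam \<Omega> g u t)\<^sup>2 = (lam \<Omega> g u t)\<^sup>2 / 2 - (lam \<Omega> g u t)\<^sup>2 / \<kappa>"
    by (simp add: left_diff_distrib)
  ultimately show ?thesis using En_lower[OF t] unfolding lam_sq[OF t, symmetric] by argo
qed

text \<open>The tested source lacks the factor 1/p1 of the potential, so the p1 of
  \<open>source_le\<close> survives. Since p1 < \<kappa>, the bound is a proper fraction of \<ell> A
  and can be absorbed.\<close>

lemma F_le: "0 \<le> t \<Longrightarrow> \<alpha> * F t t \<le> p1 / \<kappa> * (ell g * A t t)"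
proof -
  assume t: "0 \<le> t"
  have "\<alpha> * F t t \<le> \<alpha> * (V t / (exp 1 * \<mu>))" using F_upper[OF t] \<alpha> by (intro mult_left_mono) auto
  also have "\<dots> \<le> p1 / \<kappa> * (\<sigma> t powr \<kappa> / l1 powr (\<kappa> - 2))" by (rule source_le[OF t])
  also have "\<dots> \<le> p1 / \<kappa> * (\<sigma> t)\<^sup>2"
    using \<sigma>_le_lam[OF t] lam_less[OF t] p12 \<kappa>2 by (intro mult_left_mono powr_\<kappa>_le_square) auto
  also have "(\<sigma> t)\<^sup>2 = ell g * A t t" using ell A_nonneg[of t] by (simp add: \<sigma>_def)
  finally show ?thesis .
qed

text \<open>Inside the well \<open>source_le\<close> yields a bound linear in A, although V is of
  degree \<kappa> in u. Together with Poincare this bounds the potential part of the energy from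
  above by a quadratic term.\<close>

lemma \<Phi>_lower_A: "\<exists>C\<ge>0. \<forall>t\<ge>0. - (\<alpha> * \<Phi> t) \<le> C * A t t"
proof -
  obtain c where c: "0 \<le> c" "\<And>v. v \<in> H10 \<Omega> \<Longrightarrow> (Lnorm \<Omega> 2 v)\<^sup>2 \<le> c * (Lnorm \<Omega> 2 (wgrad \<Omega> v))\<^sup>2"
    using H10_Poincare[OF O] by blast
  let ?C = "1 / (p1 - 2) + 1 / \<mu> + 1"
  \<comment> \<open>The factor in the bound of V by A, obtained by solving \<open>source_le\<close>
    for V inside the well.\<close>
  let ?a = "exp 1 * \<mu> * (p1 / \<kappa> * ell g) / \<alpha>"
  have C0: "0 \<le> ?C" using p12 \<mu> by simp
  have a0: "0 \<le> ?a" using \<mu> p12 \<kappa>2 ell \<alpha> by simp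
  show ?thesis
  proof (intro exI[of _ "\<alpha> * (?C * (c + ?a))"] conjI allI impI)
    show "0 \<le> \<alpha> * (?C * (c + ?a))" using C0 a0 c \<alpha> by simp
    fix t :: real assume t: "0 \<le> t"
    have N: "N t t \<le> c * A t t" using c(2)[OF u_H10[OF t]] by (simp add: N_def A_def Lnorm_2_sq)
    have "\<alpha> * (V t / (exp 1 * \<mu>)) \<le> p1 / \<kappa> * (\<sigma> t powr \<kappa> / l1 powr (\<kappa> - 2))" by (rule source_le[OF t])
    also have "\<dots> \<le> p1 / \<kappa> * (\<sigma> t)\<^sup>2"
      using \<sigma>_le_lam[OF t] lam_less[OF t] p12 \<kappa>2 by (intro mult_left_mono powr_\<kappa>_le_square) auto
    also have "(\<sigma> t)\<^sup>2 = ell g * A t t" using ell A_nonneg[of t] by (simp add: \<sigma>_def)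
    finally have "(exp 1 * \<mu> / \<alpha>) * (\<alpha> * (V t / (exp 1 * \<mu>))) \<le> (exp 1 * \<mu> / \<alpha>) * (p1 / \<kappa> * (ell g * A t t))"
      by (rule mult_left_mono) (use \<alpha> \<mu> in simp)
    then have "V t \<le> ?a * A t t" using \<alpha> \<mu> by (simp add: ac_simps)
    then have "?C * (N t t + V t) \<le> ?C * ((c + ?a) * A t t)"
      using N C0 by (intro mult_left_mono) (simp_all add: distrib_right)
    then have "- \<Phi> t \<le> ?C * ((c + ?a) * A t t)" using \<Phi>_lower[OF t] by simp
    then have "\<alpha> * (- \<Phi> t) \<le> \<alpha> * (?C * ((c + ?a) * A t t))" using \<alpha> by (intro mult_left_mono) auto
    then show "- (\<alpha> * \<Phi> t) \<le> \<alpha> * (?C * (c + ?a)) * A t t" by (simp only: mult.assoc mult_minus_right)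
  qed
qed

lemma En_nonneg: "0 \<le> t \<Longrightarrow> 0 \<le> En t"
proof -
  assume t: "0 \<le> t"
  have "0 \<le> (1/2 - 1/\<kappa>) * (ell g * A t t + mem t)"
    using \<kappa>2 ell A_nonneg mem_bounds[OF t] by (intro mult_nonneg_nonneg add_nonneg_nonneg) (auto simp: field_simps)
  then show ?thesis using En_coercive[OF t] M_nonneg[of t] by simp
qed

text \<open>Testing the equation with \<open>u\<close> itself.  The memory term is absorbed by Young's inequality for
  convolutions, which costs only \<open>\<integral> g = 1 - \<ell>\<close>, and the source by its bound inside the well, which costs
  \<open>\<ell> p\<^sub>1/\<kappa> < \<ell>\<close>; no decay of \<open>g\<close> beyond integrability enters.\<close>

lemma integral_En_bound: "\<exists>C\<ge>0. \<forall>T\<ge>0. integral {0..T} En \<le> C * En 0"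
proof -
  obtain c where c: "0 \<le> c" "\<And>v. v \<in> H10 \<Omega> \<Longrightarrow> (Lnorm \<Omega> 2 v)\<^sup>2 \<le> c * (Lnorm \<Omega> 2 (wgrad \<Omega> v))\<^sup>2"
    using H10_Poincare[OF O] by blast
  obtain C3 where C3: "0 \<le> C3" "\<And>t. 0 \<le> t \<Longrightarrow> - (\<alpha> * \<Phi> t) \<le> C3 * A t t" using \<Phi>_lower_A by blast
  \<comment> \<open>\<open>d\<close> is the coefficient of A in \<open>En_coercive\<close>.
    \<open>e\<close> is what remains of the coefficient 1 of A after the memory has taken 1 - \<ell>
    and the source \<ell> p1/\<kappa>.\<close>
  define d where "d = (1/2 - 1/\<kappa>) * ell g"
  define e where "e = ell g * (1 - p1 / \<kappa>)"
  have d: "0 < d" using \<kappa>2 ell by (simp add: d_def field_simps)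
  have e: "0 < e" using \<kappa>2 ell by (simp add: e_def field_simps)
  \<comment> \<open>From |U| + N/2 \<le> M/2 + N, with M/2 at most \<open>En 0\<close> and N at most
    c/d times \<open>En 0\<close>.\<close>
  define K where "K = 1 + c / d"
  have K: "0 \<le> K" using c d by (simp add: K_def)
  have ctl: "M t t \<le> 2 * En 0" "A t t \<le> En 0 / d" "N t t \<le> c / d * En 0" "\<bar>U t t\<bar> + N t t / 2 \<le> K * En 0"
    if t: "0 \<le> t" for t
  proof -
    have E: "En t \<le> En 0" using t by (intro En_decreasing) auto
    have dm: "0 \<le> (1/2 - 1/\<kappa>) * mem t" using \<kappa>2 mem_bounds(1)[OF t] by (intro mult_nonneg_nonneg) (auto simp: field_simps)
    have dA: "0 \<le> d * A t t" using d A_nonneg[of t] by simp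
    have "(1/2 - 1/\<kappa>) * (ell g * A t t + mem t) = d * A t t + (1/2 - 1/\<kappa>) * mem t"
      by (simp add: d_def algebra_simps)
    then have s: "M t t / 2 + d * A t t \<le> En 0" using En_coercive[OF t] E dm by simp
    then show M: "M t t \<le> 2 * En 0" using dA by simp
    have "d * A t t \<le> En 0" using s M_nonneg[of t] by simp
    then show A: "A t t \<le> En 0 / d" using d by (simp add: field_simps)
    have "N t t \<le> c * A t t" using c(2)[OF u_H10[OF t]] by (simp add: N_def A_def Lnorm_2_sq)
    also have "\<dots> \<le> c * (En 0 / d)" using A c by (intro mult_left_mono)
    finally show N: "N t t \<le> c / d * En 0" by simp
    let ?x = "Lnorm \<Omega> 2 (ut t)" and ?y = "Lnorm \<Omega> 2 (u t)"
    have "\<bar>U t t\<bar> \<le> ?x * ?y" unfolding U_def by (rule L2_inner_Cauchy_Schwarz[OF in_L2(3,1)[OF t]])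
    moreover have "M t t = ?x\<^sup>2" "N t t = ?y\<^sup>2" by (simp_all add: M_def N_def Lnorm_2_sq)
    ultimately have "\<bar>U t t\<bar> \<le> M t t / 2 + N t t / 2" using sum_squares_bound[of ?x ?y] by simp
    then show "\<bar>U t t\<bar> + N t t / 2 \<le> K * En 0" using M N by (simp add: K_def distrib_right)
  qed
  \<comment> \<open>1/2 belongs to the integral of M/2. The coefficient 3/2 + C3 multiplies A in the
    pointwise bound of \<open>En\<close>, a further 1 comes from the integral of Q, and (1 + 2 K)/e
    bounds the integral of A in terms of \<open>En 0\<close>.\<close>
  define C where "C = 1/2 + (1/2 + 2 + C3) * ((1 + 2 * K) / e)"
  show ?thesis
  proof (intro exI[of _ C] conjI allI impI)
    show "0 \<le> C" using C3 K e by (simp add: C_def)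
    fix T :: real assume T: "0 \<le> T"
    have i: "W integrable_on {0..T}" if "continuous_on {0..} W" for W :: "real \<Rightarrow> real"
      by (rule integrable_continuous_real, rule continuous_on_subset[OF that]) auto
    note iA = i[OF continuous_A_diag] and iM = i[OF continuous_diag[OF continuous_M]]
      and iP = i[OF continuous_diag[OF continuous_P]] and iF = i[OF continuous_diag[OF continuous_F]]
      and iQ = i[OF continuous_Q]
    let ?IA = "integral {0..T} (\<lambda>t. A t t)" and ?IM = "integral {0..T} (\<lambda>t. M t t)"
      and ?IP = "integral {0..T} (\<lambda>t. P t t)" and ?IF = "integral {0..T} (\<lambda>t. F t t)" and ?IQ = "integral {0..T} Q"
    have IA0: "0 \<le> ?IA" by (intro integral_nonneg iA A_nonneg)
    have Q: "?IQ \<le> (1 - ell g) * ?IA" by (rule integral_Q_le[OF T G_le])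
    have IM: "?IM \<le> En 0" using energy_decrease[of 0 T] En_nonneg[OF T] T by simp
    have IP: "?IP \<le> (1 - ell g) * ?IA"
    proof -
      \<comment> \<open>One half of the bound comes pointwise from G A, the other half from Young's
        inequality for Q.\<close>
      have "?IP \<le> integral {0..T} (\<lambda>t. (1 - ell g) / 2 * A t t + Q t / 2)"
      proof (rule integral_le[OF iP])
        show "(\<lambda>t. (1 - ell g) / 2 * A t t + Q t / 2) integrable_on {0..T}"
          by (rule i) (intro continuous_intros continuous_A_diag continuous_Q; simp)
        fix t assume t: "t \<in> {0..T}"
        have "G t * A t t \<le> (1 - ell g) * A t t" using G_le[of t] t A_nonneg by (intro mult_right_mono) auto
        then show "P t t \<le> (1 - ell g) / 2 * A t t + Q t / 2"
          using P_cross_bound[of t] t by (simp add: abs_le_iff)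
      qed
      also have "\<dots> = (1 - ell g) / 2 * ?IA + ?IQ / 2"
        by (intro integral_unique has_integral_add has_integral_mult_right has_integral_divide integrable_integral iA iQ)
      also have "\<dots> \<le> (1 - ell g) * ?IA" using Q by (simp add: field_simps)
      finally show ?thesis .
    qed
    have IF: "\<alpha> * ?IF \<le> p1 / \<kappa> * ell g * ?IA"
    proof -
      have "integral {0..T} (\<lambda>t. \<alpha> * F t t) \<le> integral {0..T} (\<lambda>t. p1 / \<kappa> * ell g * A t t)"
      proof (rule integral_le)
        show "(\<lambda>t. \<alpha> * F t t) integrable_on {0..T}" "(\<lambda>t. p1 / \<kappa> * ell g * A t t) integrable_on {0..T}"
          by (rule has_integral_integrable[OF has_integral_mult_right[OF integrable_integral[OF iF]]]
              has_integral_integrable[OF has_integral_mult_right[OF integrable_integral[OF iA]]])+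
        show "\<alpha> * F t t \<le> p1 / \<kappa> * ell g * A t t" if "t \<in> {0..T}" for t
          using F_le[of t] that by (simp add: mult.assoc)
      qed
      then show ?thesis by simp
    qed
    have "e * ?IA \<le> ?IA - ?IP - \<alpha> * ?IF"
    proof -
      have "e * ?IA = ?IA - (1 - ell g) * ?IA - p1 / \<kappa> * ell g * ?IA" by (simp add: e_def algebra_simps)
      then show ?thesis using IP IF by simp
    qed
    also have "\<dots> = ?IM - (U T T + N T T / 2 - (U 0 0 + N 0 0 / 2))" by (rule multiplier_identity[OF T])
    \<comment> \<open>1 for the dissipated integral of M, and K for each of the two
      endpoints.\<close>
    also have "\<dots> \<le> (1 + 2 * K) * En 0"
      using ctl(4)[OF T] ctl(4)[of 0] IM N_nonneg[of T] N_nonneg[of 0] abs_ge_minus_self[of "U T T"] abs_ge_self[of "U 0 0"]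
      by (simp add: distrib_right)
    finally have IA: "?IA \<le> (1 + 2 * K) / e * En 0" using e by (simp add: field_simps)
    have "integral {0..T} En \<le> integral {0..T} (\<lambda>t. M t t / 2 + (3 / 2 + C3) * A t t + Q t)"
    proof (rule integral_le)
      show "En integrable_on {0..T}"
        unfolding En_def by (rule i) (intro continuous_intros continuous_A_diag continuous_Q continuous_\<Phi>
          continuous_diag[OF continuous_M] continuous_diag[OF continuous_P]; simp)
      show "(\<lambda>t. M t t / 2 + (3 / 2 + C3) * A t t + Q t) integrable_on {0..T}"
        by (rule i) (intro continuous_intros continuous_A_diag continuous_Q continuous_diag[OF continuous_M]; simp)
      fix t assume "t \<in> {0..T}"
      then have t: "0 \<le> t" by simp
      have GA: "0 \<le> G t * A t t" "G t * A t t \<le> 1 * A t t"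
      proof -
        show "0 \<le> G t * A t t" using G_bounds[OF t] A_nonneg[of t] by simp
        show "G t * A t t \<le> 1 * A t t" by (rule mult_right_mono) (use G_le[OF t] ell A_nonneg in auto)
      qed
      \<comment> \<open>Here \<open>mem\<close> is estimated by 2 (G A + Q), and the potential term
        by C3 A.\<close>
      have "En t \<le> M t t / 2 + (A t t - G t * A t t) / 2 + (G t * A t t + Q t) + C3 * A t t"
        using mem_bounds(2)[OF t] C3(2)[OF t] unfolding En_eq by (simp add: left_diff_distrib)
      also have "\<dots> \<le> M t t / 2 + (3 / 2 + C3) * A t t + Q t"
        using GA unfolding distrib_right by argo
      finally show "En t \<le> M t t / 2 + (3 / 2 + C3) * A t t + Q t" .
    qed
    also have "\<dots> = ?IM / 2 + (3 / 2 + C3) * ?IA + ?IQ"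
      by (intro integral_unique has_integral_add has_integral_mult_right has_integral_divide integrable_integral iA iQ iM)
    also have "\<dots> \<le> En 0 / 2 + (1/2 + 2 + C3) * ?IA"
    proof -
      have "(1 - ell g) * ?IA \<le> 1 * ?IA" using ell IA0 by (intro mult_right_mono) auto
      then show ?thesis using Q IM by (simp add: distrib_right)
    qed
    also have "\<dots> \<le> En 0 / 2 + (1/2 + 2 + C3) * ((1 + 2 * K) / e * En 0)"
      using IA C3 by (intro add_left_mono mult_left_mono) auto
    also have "\<dots> = C * En 0" unfolding C_def distrib_right[of "1/2"] mult.assoc by simp
    finally show "integral {0..T} En \<le> C * En 0" .
  qed
qed

lemma energy_decay:
  "\<exists>C>0. energy \<Omega> \<alpha> p g u ut absolutely_integrable_on {0..} \<and>
     integral {0..} (energy \<Omega> \<alpha> p g u ut) \<le> C * energy \<Omega> \<alpha> p g u ut 0 \<and>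
     (\<forall>t\<ge>0. energy \<Omega> \<alpha> p g u ut t \<le> C * energy \<Omega> \<alpha> p g u ut 0 * inverse (1 + t))"
proof -
  let ?E = "energy \<Omega> \<alpha> p g u ut"
  obtain C where C: "0 \<le> C" "\<And>T. 0 \<le> T \<Longrightarrow> integral {0..T} En \<le> C * En 0" using integral_En_bound by blast
  have cEn: "continuous_on {0..} En"
    unfolding En_def by (intro continuous_intros continuous_A_diag continuous_Q continuous_\<Phi>
          continuous_diag[OF continuous_M] continuous_diag[OF continuous_P]; simp)
  have c: "continuous_on {0..} ?E" by (rule continuous_on_eq[OF cEn]) (simp add: energy_eq)
  have n: "0 \<le> ?E t" if "0 \<le> t" for t using En_nonneg[OF that] energy_eq[OF that] by simp
  have m: "?E t \<le> ?E s" if "0 \<le> s" "s \<le> t" for s t using En_decreasing[OF that] that by (simp add: energy_eq)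
  have b: "integral {0..T} ?E \<le> C * ?E 0" if "0 \<le> T" for T
  proof -
    have "integral {0..T} ?E = integral {0..T} En"
      by (rule Henstock_Kurzweil_Integration.integral_cong) (simp add: energy_eq)
    then show ?thesis using C(2)[OF that] by (simp add: energy_eq)
  qed
  note D = nonneg_antimono_decay[OF c n m b]
  show ?thesis
  proof (intro exI[of _ "1 + C"] conjI allI impI)
    show "0 < 1 + C" using C by simp
    show "?E absolutely_integrable_on {0..}" by (rule D(1))
    have "C * ?E 0 \<le> (1 + C) * ?E 0" using n[of 0] by (intro mult_right_mono) auto
    then show "integral {0..} ?E \<le> (1 + C) * ?E 0" using D(2) by simp
    show "?E t \<le> (1 + C) * ?E 0 * inverse (1 + t)" if "0 \<le> t" for t by (rule D(3)) (use that in auto)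
  qed
qed

end

text \<open>n (1/2 - 1/k) is the order of the singularity at r = 0 in the proof of the Sobolev
  inequality; it reaches 1 exactly at the critical exponent k = 2n/(n-2).\<close>

lemma subcritical_cond:
  fixes n k :: real
  assumes "2 < n" "0 < k" "k < 2 * n / (n - 2)"
  shows "n * (1/2 - 1/k) < 1"
proof -
  have "k * (n - 2) < 2 * n" using assms by (simp add: field_simps)
  then show ?thesis using assms by (simp add: field_simps)
qed

text \<open>\<open>exp_sup\<close> converts from the extended reals and sends infinite values to 0,
  so the essential supremum has to be shown finite. The value -\<infinity> would make the space
  null, and the claim holds vacuously.\<close>

lemma AE_le_exp_sup:
  assumes "f \<in> borel_measurable (lebesgue_on \<Omega>)" "bounded (f ` \<Omega>)"
  shows "AE x in lebesgue_on \<Omega>. f x \<le> exp_sup \<Omega> f"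
proof -
  let ?e = "esssup (lebesgue_on \<Omega>) (\<lambda>x. ereal (f x))"
  have ae: "AE x in lebesgue_on \<Omega>. ereal (f x) \<le> ?e" by (rule esssup_AE)
  obtain B where B: "\<And>x. x \<in> \<Omega> \<Longrightarrow> \<bar>f x\<bar> \<le> B" using assms(2) by (auto simp: bounded_iff)
  have "AE x in lebesgue_on \<Omega>. x \<in> \<Omega>" by (rule AE_I2) (simp add: space_restrict_space)
  then have "AE x in lebesgue_on \<Omega>. ereal (f x) \<le> ereal B"
    by eventually_elim (use B in \<open>force simp: abs_le_iff\<close>)
  then have le: "?e \<le> ereal B" using assms(1) by (intro esssup_I) auto
  show ?thesis
  proof (cases ?e)
    case (real r)
    then show ?thesis using ae by (simp add: exp_sup_def)
  next
    case PInf
    then show ?thesis using le by simp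
  next
    case MInf
    then have "AE x in lebesgue_on \<Omega>. False" using ae by simp
    then show ?thesis by (rule eventually_mono) simp
  qed
qed

theorem theorem3p1:
  fixes \<Omega> :: "(real^'n::finite) set"
    and p u0 u1 :: "real^'n \<Rightarrow> real" and g :: "real \<Rightarrow> real" and \<mu> :: real
  assumes "CARD('n) \<ge> 3"
    and "bounded_smooth_domain \<Omega>"
    and "cond_A1 g"
    and "cond_P \<Omega> p"
    and "\<mu> > 0"
    and "exp_sup \<Omega> p + \<mu> < 2 * real CARD('n) / (real CARD('n) - 2)"
    and "u0 \<in> H10 \<Omega>" and "u1 \<in> L2 \<Omega>"
  shows "\<exists>\<alpha>0>0. \<forall>\<alpha>. 0 < \<alpha> \<and> \<alpha> < \<alpha>0 \<longrightarrow>
    (\<forall>u ut. weak_solution \<Omega> \<alpha> p g u0 u1 u ut \<and>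
            energy \<Omega> \<alpha> p g u ut 0 < E1 \<Omega> \<alpha> p g \<mu> \<and>
            lam \<Omega> g u 0 < lam1 \<Omega> \<alpha> p g \<mu> \<longrightarrow>
      (\<exists>C>0. energy \<Omega> \<alpha> p g u ut absolutely_integrable_on {0..} \<and>
             integral {0..} (energy \<Omega> \<alpha> p g u ut) \<le> C * energy \<Omega> \<alpha> p g u ut 0 \<and>
             (\<forall>t\<ge>0. energy \<Omega> \<alpha> p g u ut t \<le> C * energy \<Omega> \<alpha> p g u ut 0 * inverse (1 + t))))"
proof (rule exI[of _ 1], intro conjI allI impI)
  fix \<alpha> u ut
  assume al: "0 < \<alpha> \<and> \<alpha> < 1" and h: "weak_solution \<Omega> \<alpha> p g u0 u1 u ut \<and>
            energy \<Omega> \<alpha> p g u ut 0 < E1 \<Omega> \<alpha> p g \<mu> \<and> lam \<Omega> g u 0 < lam1 \<Omega> \<alpha> p g \<mu>"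
  let ?n = "real CARD('n)" and ?p1 = "exp_inf \<Omega> p" and ?p2 = "exp_sup \<Omega> p"
  have n: "2 < ?n" using assms(1) by simp
  have O: "open \<Omega>" "bounded \<Omega>" "\<Omega> \<noteq> {}" using assms(2) by (auto simp: bounded_smooth_domain_def)
  have P: "p \<in> borel_measurable (lebesgue_on \<Omega>)" "bounded (p ` \<Omega>)" "2 < ?p1" "?p2 < 2 * (?n - 1) / (?n - 2)"
    using assms(4) by (auto simp: cond_P_def)
  have up: "AE x in lebesgue_on \<Omega>. p x \<le> ?p2" by (rule AE_le_exp_sup[OF P(1,2)])
  have "bounded ((\<lambda>x. - p x) ` \<Omega>)" using P(2) by (auto simp: bounded_iff)
  then have "AE x in lebesgue_on \<Omega>. - p x \<le> exp_sup \<Omega> (\<lambda>x. - p x)"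
    using P(1) by (intro AE_le_exp_sup) auto
  then have lo: "AE x in lebesgue_on \<Omega>. ?p1 \<le> p x" by eventually_elim (simp add: exp_inf_def)
  have pae: "AE x in lebesgue_on \<Omega>. p x \<in> {?p1..?p2}" using up lo by eventually_elim simp
  have p12: "?p1 \<le> ?p2"
  proof -
    \<comment> \<open>A statement holding almost everywhere yields p1 \<le> p2 only when \<Omega> is
      not a null set; a nonempty open set is not.\<close>
    have "emeasure lebesgue \<Omega> \<noteq> 0"
      using O open_not_negligible[OF O(1,3)] by (auto simp: negligible_iff_emeasure0)
    then have "ae_filter (lebesgue_on \<Omega>) \<noteq> bot"
      using O(1) by (simp add: ae_filter_eq_bot_iff space_restrict_space emeasure_restrict_space)
    then show ?thesis using pae eventually_happens' by fastforce
  qed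
  \<comment> \<open>The midpoint of p2 - 2 and 2/(n-2): the bound on p2 says that the first is
    smaller, and the second is the value of m at which 2m + 2 becomes critical.\<close>
  define m where "m = (?p2 - 2 + 2 / (?n - 2)) / 2"
  have "2 * (?n - 1) / (?n - 2) = 2 + 2 / (?n - 2)" "2 * ?n / (?n - 2) = 2 + 4 / (?n - 2)"
    using n by (simp_all add: field_simps)
  then have mm: "?p2 - 2 < m" "2 * m + 2 < 2 * ?n / (?n - 2)" using P(4) by (auto simp: m_def)
  obtain g' where g': "continuous_on {0..} g'" "\<And>t. 0 \<le> t \<Longrightarrow> (g has_real_derivative g' t) (at t within {0..})"
    and gp: "\<And>t. 0 \<le> t \<Longrightarrow> 0 < g t" "antimono_on {0..} g" "g integrable_on {0..}" "0 < ell g"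
    using assms(3) by (auto simp: cond_A1_def)
  interpret potential_well \<Omega> p u0 u1 g g' \<alpha> ?p1 ?p2 m u ut \<mu>
  proof
    show "?n * (1/2 - 1/(2 * m + 2)) < 1" using n mm P(3) p12 by (intro subcritical_cond) auto
    show "?n * (1/2 - 1/(?p2 + \<mu>)) < 1" using n assms(5,6) P(3) p12 by (intro subcritical_cond) auto
  qed (use O P pae p12 mm g' gp al h assms(5) in auto)
  show "\<exists>C>0. energy \<Omega> \<alpha> p g u ut absolutely_integrable_on {0..} \<and>
             integral {0..} (energy \<Omega> \<alpha> p g u ut) \<le> C * energy \<Omega> \<alpha> p g u ut 0 \<and>
             (\<forall>t\<ge>0. energy \<Omega> \<alpha> p g u ut t \<le> C * energy \<Omega> \<alpha> p g u ut 0 * inverse (1 + t))"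
    by (rule energy_decay)
qed simp

end
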